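(* Let $X$ be a compact Riemann surface of genus $g$ with a fixed canonical basis of $\pi_1=\pi_1(X)$, and let $n\ge1$. If $\rho\in\mathbf{S}_n\cap\mathbf{U}_n$, then $H^1(F_g,\mathrm{Ad}_\rho)\cap\mathrm{Im}(P_{\mathrm{Ad}_\rho})=0$ inside $H^1(\pi_1,\mathrm{Ad}_\rho)$.
   Context: A canonical basis of $\pi_1$ consists of generators $a_1,\dots,a_g,b_1,\dots,b_g$ subject to the single relation $\prod_{i=1}^g a_ib_ia_i^{-1}b_i^{-1}=1$. $F_g$ is the free group on $B_1,\dots,B_g$ and $p:\pi_1\to F_g$ is given by $p(a_i)=1$, $p(b_i)=B_i$. $\mathbf{S}_n=\mathrm{Hom}(F_g,GL(n,\mathbb{C}))/GL(n,\mathbb{C})$ is regarded, via $\rho\mapsto\rho\circ p$, as a subset of $\mathrm{Hom}(\pi_1,GL(n,\mathbb{C}))/GL(n,\mathbb{C})$ (conjugacy classes of $\rho$ with $\rho(a_i)=1$ for all $i$), and $\mathbf{U}_n=\mathrm{Hom}(\pi_1,U(n))/U(n)$ is the set of unitary representations up to conjugation, also regarded as a subset of it. Representations and their conjugacy classes are denoted by the same symbol. $\mathrm{Ad}_\rho$ is the space of $n\times n$ complex matrices with the action $\gamma\cdot M=\rho(\gamma)M\rho(\gamma)^{-1}$; $H^1(F_g,\mathrm{Ad}_\rho)$ is a subspace of $H^1(\pi_1,\mathrm{Ad}_\rho)$ via the injection induced by $p$. $E_\rho$ is the quotient of $\tilde X\times\mathbb{C}^n$ ($\tilde X$ the universal cover)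 by $\gamma\cdot(z,v)=(\gamma z,\rho(\gamma)v)$, and $K$ is the canonical line bundle. The period map $P_{\mathrm{Ad}_\rho}:H^0(X,\mathrm{End}\,E_\rho\otimes K)\to H^1(\pi_1,\mathrm{Ad}_\rho)$ sends $\phi$, viewed as a matrix-valued holomorphic 1-form $\phi(z)dz$ on $\tilde X$ with $\phi(\gamma z)\gamma'(z)=\rho(\gamma)\phi(z)\rho(\gamma)^{-1}$ for all $\gamma\in\pi_1$, to the class of the cocycle $\gamma\mapsto\int_{z_0}^{\gamma z_0}\phi$, which is independent of $z_0\in\tilde X$. *)

theory Defs
  imports
    "HOL-Complex_Analysis.Complex_Analysis"
    "HOL-Homology.Homology"
    "HOL-Algebra.Bij"
    "HOL-Algebra.Generated_Groups"
begin

no_notation fps_nth (infixl \<open>$\<close> 75)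

section \<open>Free groups and canonical bases\<close>

text \<open>
  A letter \<^term>\<open>(i, True)\<close> stands for the generator \<open>i\<close>, and \<^term>\<open>(i, False)\<close> for its
  inverse. Elements of the free group are reduced words.
\<close>

type_synonym 'i word = "('i \<times> bool) list"

definition inv_letter :: "'i \<times> bool \<Rightarrow> 'i \<times> bool" where
  "inv_letter x = (fst x, \<not> snd x)"

definition reduced_word :: "'i word \<Rightarrow> bool" where
  "reduced_word w \<longleftrightarrow> successively (\<lambda>x y. y \<noteq> inv_letter x) w"

definition push_letter :: "'i \<times> bool \<Rightarrow> 'i word \<Rightarrow> 'i word" where
  "push_letter x w = (case w of [] \<Rightarrow> [x] | y # v \<Rightarrow> if y = inv_letter x then v else x # w)"

definition free_group :: "'i set \<Rightarrow> 'i word monoid" where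
  "free_group I = \<lparr>carrier = {w. fst ` set w \<subseteq> I \<and> reduced_word w},
                   monoid.mult = (\<lambda>v w. foldr push_letter v w), one = []\<rparr>"

definition free_gen :: "'i \<Rightarrow> 'i word" where
  "free_gen i = [(i, True)]"

definition word_eval :: "('g, 'm) monoid_scheme \<Rightarrow> ('i \<Rightarrow> 'g) \<Rightarrow> 'i word \<Rightarrow> 'g" where
  "word_eval G f w =
     foldr (\<lambda>x y. (if snd x then f (fst x) else inv\<^bsub>G\<^esub> (f (fst x))) \<otimes>\<^bsub>G\<^esub> y) w \<one>\<^bsub>G\<^esub>"

definition normal_closure :: "('g, 'm) monoid_scheme \<Rightarrow> 'g set \<Rightarrow> 'g set" where
  "normal_closure G R = \<Inter>{N. N \<lhd> G \<and> R \<subseteq> N}"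

text \<open>
  The word \<open>\<Prod>\<^sub>i a\<^sub>i b\<^sub>i a\<^sub>i\<inverse> b\<^sub>i\<inverse>\<close>, where \<open>a\<^sub>i\<close> is the letter \<^term>\<open>Inl i\<close> and \<open>b\<^sub>i\<close> the
  letter \<^term>\<open>Inr i\<close>. Indices run over \<open>0, \<dots>, g - 1\<close>.
\<close>

definition surface_relator :: "nat \<Rightarrow> (nat + nat) word" where
  "surface_relator g = concat (map (\<lambda>i. [(Inl i, True), (Inr i, True), (Inl i, False), (Inr i, False)]) [0..<g])"

text \<open>
  \<open>G\<close> is generated by the \<open>a\<^sub>i\<close>, \<open>b\<^sub>i\<close>, and all relations between them follow from
  \<open>\<Prod>\<^sub>i a\<^sub>i b\<^sub>i a\<^sub>i\<inverse> b\<^sub>i\<inverse> = 1\<close>.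
\<close>

definition canonical_basis ::
  "('g, 'm) monoid_scheme \<Rightarrow> nat \<Rightarrow> (nat \<Rightarrow> 'g) \<Rightarrow> (nat \<Rightarrow> 'g) \<Rightarrow> bool" where
  "canonical_basis G g a b \<longleftrightarrow>
     a \<in> {..<g} \<rightarrow> carrier G \<and> b \<in> {..<g} \<rightarrow> carrier G \<and>
     generate G (a ` {..<g} \<union> b ` {..<g}) = carrier G \<and>
     kernel (free_group (Inl ` {..<g} \<union> Inr ` {..<g})) G (word_eval G (case_sum a b)) =
       normal_closure (free_group (Inl ` {..<g} \<union> Inr ` {..<g})) {surface_relator g}"

section \<open>Riemann surfaces\<close>

type_synonym 'a chart = "'a set \<times> ('a \<Rightarrow> complex)"

definition complex_atlas :: "'a::topological_space set \<Rightarrow> 'a chart set \<Rightarrow> bool" where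
  "complex_atlas S A \<longleftrightarrow>
     (\<Union>(U, z)\<in>A. U) = S \<and>
     (\<forall>(U, z)\<in>A. openin (top_of_set S) U \<and> open (z ` U) \<and> homeomorphism U (z ` U) z (inv_into U z)) \<and>
     (\<forall>(U, z)\<in>A. \<forall>(V, w)\<in>A. (w \<circ> inv_into U z) holomorphic_on z ` (U \<inter> V))"

definition riemann_surface :: "'a::t2_space set \<Rightarrow> 'a chart set \<Rightarrow> bool" where
  "riemann_surface S A \<longleftrightarrow> S \<noteq> {} \<and> connected S \<and> complex_atlas S A"

definition holomorphic_map ::
  "'a::t2_space set \<Rightarrow> 'a chart set \<Rightarrow> 'b::t2_space set \<Rightarrow> 'b chart set \<Rightarrow> ('a \<Rightarrow> 'b) \<Rightarrow> bool" where
  "holomorphic_map S A T B f \<longleftrightarrow>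
     continuous_on S f \<and> f ` S \<subseteq> T \<and>
     (\<forall>(U, z)\<in>A. \<forall>(V, w)\<in>B. (w \<circ> f \<circ> inv_into U z) holomorphic_on z ` (U \<inter> f -` V))"

text \<open>The genus of a compact surface: \<open>H\<^sub>1(S; \<int>) \<cong> \<int>\<^sup>2\<^sup>g\<close>.\<close>

definition has_genus :: "'a::topological_space set \<Rightarrow> nat \<Rightarrow> bool" where
  "has_genus S g \<longleftrightarrow> homology_group 1 (top_of_set S) \<cong> free_Abelian_group {..<2 * g}"

definition universal_cover ::
  "'b::t2_space set \<Rightarrow> 'b chart set \<Rightarrow> ('b \<Rightarrow> 'a) \<Rightarrow> 'a::t2_space set \<Rightarrow> 'a chart set \<Rightarrow> bool" where
  "universal_cover Y B q X A \<longleftrightarrow>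
     riemann_surface Y B \<and> simply_connected Y \<and> covering_space Y q X \<and> holomorphic_map Y B X A q"

section \<open>The fundamental group and its action on the universal cover\<close>

definition fundamental_group ::
  "'a::topological_space set \<Rightarrow> 'a \<Rightarrow> (real \<Rightarrow> 'a) set monoid" where
  "fundamental_group S s =
     \<lparr>carrier = {{k. homotopic_paths S h k} | h.
                   path h \<and> path_image h \<subseteq> S \<and> pathstart h = s \<and> pathfinish h = s},
      monoid.mult = (\<lambda>C D. {k. \<exists>h\<in>C. \<exists>l\<in>D. homotopic_paths S (h +++ l) k}),
      one = {k. homotopic_paths S (\<lambda>t. s) k}\<rparr>"

text \<open>
  Members of \<^const>\<open>Bij\<close> are undefined outside their domain, which makes the deck transformation
  in the next definition unique.
\<close>

definition deck_transformations ::
  "'b::topological_space set \<Rightarrow> ('b \<Rightarrow> 'a) \<Rightarrow> ('b \<Rightarrow> 'b) set" where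
  "deck_transformations Y q =
     {T \<in> Bij Y. homeomorphism Y Y T (inv_into Y T) \<and> (\<forall>y\<in>Y. q (T y) = q y)}"

text \<open>
  The class of a loop at \<^term>\<open>q y0\<close> acts on the universal cover as the deck transformation which
  takes the base point \<open>y0\<close> to the end point of the lift, starting at \<open>y0\<close>, of that loop. As
  \<^term>\<open>h +++ l\<close> runs through \<open>h\<close> first, this is a left action.
\<close>

definition deck_action ::
  "'b::topological_space set \<Rightarrow> ('b \<Rightarrow> 'a) \<Rightarrow> 'b \<Rightarrow> (real \<Rightarrow> 'a) set \<Rightarrow> 'b \<Rightarrow> 'b" where
  "deck_action Y q y0 C =
     (THE T. T \<in> deck_transformations Y q \<and>
             (\<exists>h. path h \<and> path_image h \<subseteq> Y \<and> pathstart h = y0 \<and> pathfinish h = T y0 \<and> q \<circ> h \<in> C))"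

section \<open>Linear and unitary representations\<close>

definition GL :: "(complex^'n^'n) monoid" where
  "GL = \<lparr>carrier = {M. invertible M}, monoid.mult = (**), one = mat 1\<rparr>"

definition conj_transpose :: "complex^'n^'n \<Rightarrow> complex^'n^'n" where
  "conj_transpose M = map_matrix cnj (transpose M)"

definition unitary_group :: "(complex^'n^'n) monoid" where
  "unitary_group = GL\<lparr>carrier := {M. M ** conj_transpose M = mat 1 \<and> conj_transpose M ** M = mat 1}\<rparr>"

definition Ad :: "complex^'n^'n \<Rightarrow> complex^'n^'n \<Rightarrow> complex^'n^'n" where
  "Ad T M = T ** M ** matrix_inv T"

text \<open>
  The point of \<open>Hom(G, GL(n, \<complex>)) / GL(n, \<complex>)\<close> given by \<open>\<rho>\<close>. Only values on the carrier of \<open>G\<close> matter.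
\<close>

definition rep_class ::
  "('g, 'm) monoid_scheme \<Rightarrow> ('g \<Rightarrow> complex^'n^'n) \<Rightarrow> ('g \<Rightarrow> complex^'n^'n) set" where
  "rep_class G \<rho> = {\<sigma> \<in> hom G GL. \<exists>T. invertible T \<and> (\<forall>x\<in>carrier G. \<sigma> x = Ad T (\<rho> x))}"

definition schottky_reps ::
  "('g, 'm) monoid_scheme \<Rightarrow> ('f, 'k) monoid_scheme \<Rightarrow> ('g \<Rightarrow> 'f) \<Rightarrow> ('g \<Rightarrow> complex^'n^'n) set set" where
  "schottky_reps G F p = (\<lambda>\<rho>. rep_class G (\<rho> \<circ> p)) ` hom F GL"

definition unitary_reps ::
  "('g, 'm) monoid_scheme \<Rightarrow> ('g \<Rightarrow> complex^'n^'n) set set" where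
  "unitary_reps G = rep_class G ` hom G unitary_group"

section \<open>First group cohomology with coefficients in \<open>Ad\<^sub>\<rho>\<close>\<close>

definition cocycles ::
  "('g, 'm) monoid_scheme \<Rightarrow> ('g \<Rightarrow> complex^'n^'n) \<Rightarrow> ('g \<Rightarrow> complex^'n^'n) set" where
  "cocycles G \<rho> = {c \<in> extensional (carrier G).
     \<forall>x\<in>carrier G. \<forall>y\<in>carrier G. c (x \<otimes>\<^bsub>G\<^esub> y) = c x + Ad (\<rho> x) (c y)}"

definition coboundaries ::
  "('g, 'm) monoid_scheme \<Rightarrow> ('g \<Rightarrow> complex^'n^'n) \<Rightarrow> ('g \<Rightarrow> complex^'n^'n) set" where
  "coboundaries G \<rho> = range (\<lambda>M. \<lambda>x\<in>carrier G. Ad (\<rho> x) M - M)"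

definition cohomologous ::
  "('g, 'm) monoid_scheme \<Rightarrow> ('g \<Rightarrow> complex^'n^'n) \<Rightarrow> (('g \<Rightarrow> complex^'n^'n) \<times> ('g \<Rightarrow> complex^'n^'n)) set" where
  "cohomologous G \<rho> = {(c, d) \<in> cocycles G \<rho> \<times> cocycles G \<rho>.
     (\<lambda>x\<in>carrier G. c x - d x) \<in> coboundaries G \<rho>}"

definition H1 ::
  "('g, 'm) monoid_scheme \<Rightarrow> ('g \<Rightarrow> complex^'n^'n) \<Rightarrow> ('g \<Rightarrow> complex^'n^'n) set set" where
  "H1 G \<rho> = cocycles G \<rho> // cohomologous G \<rho>"

definition H1_class ::
  "('g, 'm) monoid_scheme \<Rightarrow> ('g \<Rightarrow> complex^'n^'n) \<Rightarrow> ('g \<Rightarrow> complex^'n^'n) \<Rightarrow> ('g \<Rightarrow> complex^'n^'n) set" where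
  "H1_class G \<rho> c = cohomologous G \<rho> `` {c}"

text \<open>
  The map \<open>H\<^sup>1(F, Ad\<^sub>\<sigma>) \<rightarrow> H\<^sup>1(G, Ad\<^sub>\<rho>)\<close> induced by \<open>p: G \<rightarrow> F\<close>, where \<open>\<rho> = \<sigma> \<circ> p\<close>. All representatives
  \<open>c\<close> of a class \<open>C\<close> yield the same class, so the union is that class.
\<close>

definition H1_pullback ::
  "('g, 'm) monoid_scheme \<Rightarrow> ('g \<Rightarrow> complex^'n^'n) \<Rightarrow> ('g \<Rightarrow> 'f) \<Rightarrow>
   ('f \<Rightarrow> complex^'n^'n) set \<Rightarrow> ('g \<Rightarrow> complex^'n^'n) set" where
  "H1_pullback G \<rho> p C = (\<Union>c\<in>C. H1_class G \<rho> (\<lambda>x\<in>carrier G. c (p x)))"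

section \<open>Matrix-valued holomorphic 1-forms and the period map\<close>

definition cscale :: "complex \<Rightarrow> complex^'n^'n \<Rightarrow> complex^'n^'n" where
  "cscale c M = map_matrix ((*) c) M"

text \<open>
  A 1-form \<open>\<phi>\<close> is given by its coefficients: in the chart \<open>(U, z)\<close> it is \<^term>\<open>\<phi> (U, z)\<close> times \<open>dz\<close>.
\<close>

type_synonym ('a, 'n) mform = "'a chart \<Rightarrow> 'a \<Rightarrow> complex^'n^'n"

definition holomorphic_form :: "'a::t2_space chart set \<Rightarrow> ('a, 'n::finite) mform \<Rightarrow> bool" where
  "holomorphic_form A \<phi> \<longleftrightarrow>
     (\<forall>(U, z)\<in>A. \<forall>i j. (\<lambda>\<zeta>. \<phi> (U, z) (inv_into U z \<zeta>) $ i $ j) holomorphic_on z ` U) \<and>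
     (\<forall>(U, z)\<in>A. \<forall>(V, w)\<in>A. \<forall>x\<in>U \<inter> V.
        \<phi> (U, z) x = cscale (deriv (w \<circ> inv_into U z) (z x)) (\<phi> (V, w) x))"

text \<open>
  Path integrals, for paths that are concatenations of paths each of which lies in one chart and
  is piecewise continuously differentiable in it.
\<close>

inductive has_form_integral ::
  "'a::t2_space chart set \<Rightarrow> ('a, 'n::finite) mform \<Rightarrow> (real \<Rightarrow> 'a) \<Rightarrow> complex^'n^'n \<Rightarrow> bool"
  for A \<phi> where
  in_chart: "(U, z) \<in> A \<Longrightarrow> path_image h \<subseteq> U \<Longrightarrow> valid_path (z \<circ> h) \<Longrightarrow>
    has_form_integral A \<phi> h
      (\<chi> i j. contour_integral (z \<circ> h) (\<lambda>\<zeta>. \<phi> (U, z) (inv_into U z \<zeta>) $ i $ j))"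
| join: "has_form_integral A \<phi> h I \<Longrightarrow> has_form_integral A \<phi> l J \<Longrightarrow> pathfinish h = pathstart l \<Longrightarrow>
    has_form_integral A \<phi> (h +++ l) (I + J)"

text \<open>On a simply connected surface, the integral depends on the end points only.\<close>

definition form_integral ::
  "'a::t2_space chart set \<Rightarrow> ('a, 'n::finite) mform \<Rightarrow> 'a \<Rightarrow> 'a \<Rightarrow> complex^'n^'n" where
  "form_integral A \<phi> x y =
     (THE I. \<exists>h. pathstart h = x \<and> pathfinish h = y \<and> has_form_integral A \<phi> h I)"

text \<open>
  \<open>H\<^sup>0(X, End E\<^sub>\<rho> \<otimes> K)\<close>, as the forms \<open>\<phi>\<close> on the universal cover (with atlas \<open>B\<close>) which satisfy
  \<open>\<phi>(\<gamma> z) \<gamma>'(z) = \<rho>(\<gamma>) \<phi>(z) \<rho>(\<gamma>)\<inverse>\<close>. Here \<open>act\<close> is the action of \<open>G = \<pi>\<^sub>1(X)\<close>, and \<open>\<gamma>'\<close> is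
  computed with a chart around \<open>y\<close> and a chart around \<open>\<gamma> y\<close>.
\<close>

definition equivariant_forms ::
  "'b::t2_space chart set \<Rightarrow> ('g, 'm) monoid_scheme \<Rightarrow> ('g \<Rightarrow> 'b \<Rightarrow> 'b) \<Rightarrow>
   ('g \<Rightarrow> complex^'n^'n) \<Rightarrow> ('b, 'n::finite) mform set" where
  "equivariant_forms B G act \<rho> = {\<phi>. holomorphic_form B \<phi> \<and>
     (\<forall>x\<in>carrier G. \<forall>(U, z)\<in>B. \<forall>(V, w)\<in>B. \<forall>y\<in>U. act x y \<in> V \<longrightarrow>
        cscale (deriv (w \<circ> act x \<circ> inv_into U z) (z y)) (\<phi> (V, w) (act x y)) =
          Ad (\<rho> x) (\<phi> (U, z) y))}"

definition period_map ::
  "'b::t2_space chart set \<Rightarrow> ('g, 'm) monoid_scheme \<Rightarrow> ('g \<Rightarrow> 'b \<Rightarrow> 'b) \<Rightarrow> 'b \<Rightarrow>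
   ('g \<Rightarrow> complex^'n^'n) \<Rightarrow> ('b, 'n::finite) mform \<Rightarrow> ('g \<Rightarrow> complex^'n^'n) set" where
  "period_map B G act z0 \<rho> \<phi> = H1_class G \<rho> (\<lambda>x\<in>carrier G. form_integral B \<phi> z0 (act x z0))"

end

theory Submission
  imports Defs
begin

text \<open>
  Let \<open>\<phi>\<close> be an equivariant form whose period class comes from the free group \<open>F\<close>. A form of
  Riemann's bilinear relations shows that the primitives of \<open>\<phi>\<close> are constant.

  On the simply connected universal cover, \<open>\<phi>\<close> has a primitive \<open>f\<close>, and \<open>f(\<gamma> y) = Ad (\<rho> \<gamma>) (f y) + c \<gamma>\<close> for a period cocycle
  \<open>c\<close> (\<open>primitive_exists\<close>, \<open>primitive_equivariant\<close>). Adding a constant to \<open>f\<close> changes \<open>c\<close> by a coboundary, and so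
  \<open>c\<close>, like \<open>\<rho>\<close>, may be taken to depend on \<open>p \<gamma>\<close> only. Since \<open>\<rho>\<close> is conjugate to a unitary representation, one may also assume that
  it is unitary, and then \<open>F\<close> acts on matrices by unitary affine maps for which \<open>f\<close> is equivariant.

  For the hermitian form \<open>\<langle>M, N\<rangle> = tr (M N\<^sup>*)\<close>, the 1-form \<open>\<eta> = \<langle>df, f\<rangle>\<close> has the differential \<open>2\<i> \<bar>f'\<bar>\<^sup>2 dx dy\<close>.
  If \<open>\<eta>\<close> came from the compact surface \<open>X\<close>, Stokes' theorem would give \<open>f' = 0\<close>. However, the action of
  \<open>\<gamma>\<close> changes \<open>\<eta>\<close> by \<open>dh\<^sub>\<gamma>\<close>, where \<open>h\<^sub>\<gamma> = \<langle>Ad (\<rho> \<gamma>) f, c \<gamma>\<rangle>\<close>. The functions \<open>h\<^sub>\<gamma>\<close> satisfy the cocycle identity up to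
  constants, which form the 2-cocycle \<open>\<langle>Ad (\<rho> \<gamma>) (c \<delta>), c \<gamma>\<rangle>\<close>. On \<open>\<pi>\<^sub>1\<close> its class is a genuine obstruction: the bilinear
  relations compute \<open>\<integral>\<bar>f'\<bar>\<^sup>2\<close> from it. But here it is pulled back from \<open>F\<close>, and the second cohomology of a free group
  vanishes (\<open>free_group_2_cocycle_splits\<close>, \<open>hermitian_cocycle_splits\<close>). After a correction by constants, the \<open>h\<^sub>\<gamma>\<close> are an
  exact cocycle, and a partition of unity on \<open>X\<close> turns \<open>\<eta>\<close> into a form on \<open>X\<close> with the same differential
  (\<open>locally_constant_of_exact_cocycle\<close>, \<open>stokes_nonneg\<close>). So \<open>f\<close> is constant (\<open>equivariant_map_constant\<close>) and all
  periods of \<open>\<phi>\<close> are zero.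

  The analytic and topological foundations are developed along the way: lifting in coverings and continuation of primitives, both as
  instances of \<open>local_system\<close>; the action of \<open>\<pi>\<^sub>1\<close> on the universal cover; and Stokes' theorem on a compact Riemann surface.
\<close>

section \<open>Simply connected spaces\<close>

text \<open>
  Simple connectedness makes any two constant loops homotopic, and such a homotopy moves the base point
  along a path.
\<close>

lemma simply_connected_imp_path_connected_general:
  fixes S :: "'a::topological_space set"
  assumes "simply_connected S" shows "path_connected S"
  unfolding path_connected_component
proof (intro ballI)
  fix a b assume "a \<in> S" "b \<in> S"
  then have "path (\<lambda>t. a) \<and> pathfinish (\<lambda>t. a) = pathstart (\<lambda>t. a) \<and> path_image (\<lambda>t. a) \<subseteq> S \<and>
      path (\<lambda>t. b) \<and> pathfinish (\<lambda>t. b) = pathstart (\<lambda>t. b) \<and> path_image (\<lambda>t. b) \<subseteq> S"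
    by (auto simp: path_def path_image_def pathstart_def pathfinish_def)
  then have "homotopic_loops S (\<lambda>t. a) (\<lambda>t. b)"
    using assms unfolding simply_connected_def by blast
  from homotopic_loops_imp_path_component_value[OF this, of 0]
  show "path_component S a b" by simp
qed

text \<open>
  Let \<open>K\<close> contract the loop that runs along \<open>h\<close> and back along \<open>k\<close>. In the square on which \<open>K\<close> is
  defined, each half of the side which \<open>K\<close> maps to that loop can be deformed to a broken line along the adjacent side, half of
  the opposite side, and the segment that joins the midpoints of these two opposite sides. As \<open>K\<close> takes equal values on
  the two sides next to the loop, and is constant on the side opposite to it, the images of the two broken lines are the same path.
\<close>

lemma simply_connected_imp_homotopic_paths:
  fixes S :: "'a::topological_space set"
  assumes S: "simply_connected S"
    and h: "path h" "path_image h \<subseteq> S" and k: "path k" "path_image k \<subseteq> S"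
    and ends: "pathstart h = pathstart k" "pathfinish h = pathfinish k"
  shows "homotopic_paths S h k"
proof -
  let ?p = "h +++ reversepath k" and ?c = "\<lambda>t::real. pathstart h" and ?Q = "{0..1} \<times> {0..1} :: (real \<times> real) set"
  have "path ?p" "pathfinish ?p = pathstart ?p" "path_image ?p \<subseteq> S"
    using h k ends by (auto simp: subset_path_image_join)
  moreover have "path ?c" "pathfinish ?c = pathstart ?c" "path_image ?c \<subseteq> S"
    using h by (auto simp: path_def path_image_def pathstart_def pathfinish_def)
  ultimately have "homotopic_loops S ?p ?c" using S unfolding simply_connected_def by blast
  then obtain K :: "real \<times> real \<Rightarrow> 'a" where K: "continuous_on ?Q K" "K \<in> ?Q \<rightarrow> S"
    and K0: "\<forall>x\<in>{0..1}. K (0, x) = ?p x" and K1: "\<forall>x\<in>{0..1}. K (1, x) = pathstart h"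
    and Ke: "\<forall>t\<in>{0..1}. K (t, 0) = K (t, 1)"
    unfolding homotopic_loops pathstart_def pathfinish_def by (auto simp: o_def)
  have conv: "convex ?Q" by (intro convex_Times) auto
  have square: "homotopic_paths ?Q f g"
    if "path f" "path_image f \<subseteq> ?Q" "path g" "path_image g \<subseteq> ?Q" "pathstart f = pathstart g" "pathfinish f = pathfinish g"
    for f g
  proof (rule homotopic_paths_linear)
    show "closed_segment (f t) (g t) \<subseteq> ?Q" if "t \<in> {0..1}" for t
      using that \<open>path_image f \<subseteq> ?Q\<close> \<open>path_image g \<subseteq> ?Q\<close>
      by (intro closed_segment_subset conv) (auto simp: path_image_def)
  qed (use that in auto)
  note image = homotopic_paths_continuous_image[OF _ K]
  \<comment> \<open>the two broken lines; they end at the midpoint of the side \<open>{0} \<times> {0..1}\<close>, which separates \<open>h\<close> from \<open>k\<close>\<close>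
  define A where "A = linepath (0::real, 0::real) (1, 0) +++ linepath (1, 0) (1, 1/2) +++ linepath (1, 1/2) (0, 1/2::real)"
  define B where "B = linepath (0::real, 1::real) (1, 1) +++ linepath (1, 1) (1, 1/2) +++ linepath (1, 1/2) (0, 1/2::real)"
  have seg: "closed_segment p q \<subseteq> ?Q" if "p \<in> ?Q" "q \<in> ?Q" for p q
    using that by (rule closed_segment_subset[OF _ _ conv])
  have A: "path A" "path_image A \<subseteq> ?Q" and B: "path B" "path_image B \<subseteq> ?Q"
    unfolding A_def B_def by (simp_all, (intro subset_path_image_join; simp only: path_image_linepath; rule seg; simp)+)
  have l: "path_image (linepath (0, 0) (0, 1/2)) \<subseteq> ?Q" "path_image (linepath (0, 1) (0, 1/2)) \<subseteq> ?Q"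
    by (simp_all only: path_image_linepath, (rule seg; simp)+)
  have hA: "homotopic_paths S (K \<circ> linepath (0, 0) (0, 1/2)) (K \<circ> A)"
    by (rule image[OF square]) (use A l(1) in \<open>simp_all add: A_def\<close>)
  have kB: "homotopic_paths S (K \<circ> linepath (0, 1) (0, 1/2)) (K \<circ> B)"
    by (rule image[OF square]) (use B l(2) in \<open>simp_all add: B_def\<close>)
  have AB: "(K \<circ> A) t = (K \<circ> B) t" if t: "t \<in> {0..1}" for t
  proof -
    consider "t \<le> 1/2" | "t > 1/2" "t \<le> 3/4" | "t > 3/4" by linarith
    then show ?thesis
    proof cases
      case 1
      then have "A t = (2 * t, 0)" "B t = (2 * t, 1)"
        by (auto simp: A_def B_def joinpaths_def linepath_def)
      then show ?thesis using Ke t 1 by simp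
    next
      case 2
      then have "A t = (1, 2 * t - 1)" "B t = (1, 2 - 2 * t)" "2 * t - 1 \<in> {0..1}" "2 - 2 * t \<in> {0..1}"
        by (auto simp: A_def B_def joinpaths_def linepath_def field_simps)
      then show ?thesis using K1 by auto
    next
      case 3
      then show ?thesis by (auto simp: A_def B_def joinpaths_def)
    qed
  qed
  have "homotopic_paths S h (K \<circ> linepath (0, 0) (0, 1/2))"
  proof (rule homotopic_paths_eq[OF h])
    fix t :: real assume "t \<in> {0..1}"
    then show "h t = (K \<circ> linepath (0, 0) (0, 1/2)) t"
      using K0 by (simp add: linepath_def joinpaths_def)
  qed
  also note hA
  also have "homotopic_paths S (K \<circ> A) (K \<circ> B)"
    using homotopic_paths_eq[OF conjunct2[OF homotopic_paths_imp_path[OF hA]] conjunct2[OF homotopic_paths_imp_subset[OF hA]] AB] .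
  also note homotopic_paths_sym[OF kB]
  also have "homotopic_paths S (K \<circ> linepath (0, 1) (0, 1/2)) k"
  proof (rule homotopic_paths_sym, rule homotopic_paths_eq[OF k])
    fix t :: real assume t: "t \<in> {0..1}"
    have "linepath (0::real, 1::real) (0, 1/2) t = (0, 1 - t/2)" by (simp add: linepath_def algebra_simps)
    moreover have "?p (1 - t/2) = k t"
      using t ends(2) by (auto simp: joinpaths_def reversepath_def pathfinish_def)
    ultimately show "k t = (K \<circ> linepath (0, 1) (0, 1/2)) t" using K0 t by simp
  qed
  finally show ?thesis .
qed

section \<open>Continuation in locally trivial families of sections\<close>

text \<open>
  A family of local sections of a bundle with fibres \<open>fib z\<close>: over each of the sets \<open>N\<close>, the sections in \<open>\<S>\<close>
  fill every fibre without crossing each other. A single theory of continuation covers both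
  uses below: the sheets of a covering, and the local primitives of a closed 1-form.
\<close>

locale local_system =
  fixes Z :: "'z::topological_space set" and fib :: "'z \<Rightarrow> 'c set"
    and \<T> :: "('z set \<times> ('z \<Rightarrow> 'c) set) set"
  assumes cover: "z \<in> Z \<Longrightarrow> \<exists>(N, \<S>)\<in>\<T>. z \<in> N"
    and open_domain: "(N, \<S>) \<in> \<T> \<Longrightarrow> openin (top_of_set Z) N"
    and section_in_fib: "(N, \<S>) \<in> \<T> \<Longrightarrow> P \<in> \<S> \<Longrightarrow> z \<in> N \<Longrightarrow> P z \<in> fib z"
    and section_through: "(N, \<S>) \<in> \<T> \<Longrightarrow> z \<in> N \<Longrightarrow> v \<in> fib z \<Longrightarrow> \<exists>P\<in>\<S>. P z = v"
    and sections_disjoint: "(N, \<S>) \<in> \<T> \<Longrightarrow> P \<in> \<S> \<Longrightarrow> P' \<in> \<S> \<Longrightarrow> z \<in> N \<Longrightarrow> z' \<in> N \<Longrightarrow>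
      P z = P' z \<Longrightarrow> P z' = P' z'"
    and sections_agree_near: "(N, \<S>) \<in> \<T> \<Longrightarrow> (N', \<S>') \<in> \<T> \<Longrightarrow> P \<in> \<S> \<Longrightarrow> P' \<in> \<S>' \<Longrightarrow> z \<in> N \<Longrightarrow> z \<in> N' \<Longrightarrow>
      P z = P' z \<Longrightarrow> \<exists>M. openin (top_of_set Z) M \<and> z \<in> M \<and> (\<forall>y\<in>M. P y = P' y)"
begin

text \<open>
  A lift follows \<open>H\<close> with the value of a local section that changes continuously. Stating this by sections makes no
  use of a topology on the values: this is needed for primitives, where sections that differ by
  a constant must count as different sheets.
\<close>

definition lifts :: "'d::topological_space set \<Rightarrow> ('d \<Rightarrow> 'z) \<Rightarrow> ('d \<Rightarrow> 'c) \<Rightarrow> bool" where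
  "lifts S H u \<longleftrightarrow> (\<forall>x\<in>S. \<exists>(N, \<S>)\<in>\<T>. \<exists>P\<in>\<S>. \<exists>M. openin (top_of_set S) M \<and> x \<in> M \<and>
     (\<forall>x'\<in>M. H x' \<in> N \<and> u x' = P (H x')))"

lemma lifts_in_fib: "lifts S H u \<Longrightarrow> x \<in> S \<Longrightarrow> u x \<in> fib (H x)"
  unfolding lifts_def using section_in_fib by fastforce

text \<open>
  The definition of a lift provides one suitable section near each point; by \<open>sections_agree_near\<close>, every
  section with the right value at the point does as well.
\<close>

lemma lifts_near:
  assumes u: "lifts S H u" and H: "continuous_on S H" "H \<in> S \<rightarrow> Z" and x: "x \<in> S"
    and N: "(N, \<S>) \<in> \<T>" "P \<in> \<S>" "H x \<in> N" "P (H x) = u x"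
  obtains M where "openin (top_of_set S) M" "x \<in> M" "\<And>x'. x' \<in> M \<Longrightarrow> H x' \<in> N" "\<And>x'. x' \<in> M \<Longrightarrow> u x' = P (H x')"
proof -
  obtain N' \<S>' P' M' where N': "(N', \<S>') \<in> \<T>" "P' \<in> \<S>'" "openin (top_of_set S) M'" "x \<in> M'"
    and M': "\<And>x'. x' \<in> M' \<Longrightarrow> H x' \<in> N' \<and> u x' = P' (H x')"
    using u x unfolding lifts_def by fast
  obtain M where M: "openin (top_of_set Z) M" "H x \<in> M" "\<forall>y\<in>M. P y = P' y"
    using sections_agree_near[OF N(1) N'(1) N(2) N'(2) N(3)] M'[OF N'(4)] N(4) by auto
  have pre: "openin (top_of_set S) (S \<inter> H -` Q)" if "openin (top_of_set Z) Q" for Q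
    using continuous_openin_preimage[OF H(1) H(2) that] .
  show ?thesis
  proof
    show "openin (top_of_set S) (M' \<inter> (S \<inter> H -` M) \<inter> (S \<inter> H -` N))"
      using openin_Int[OF openin_Int[OF N'(3) pre[OF M(1)]] pre[OF open_domain[OF N(1)]]] .
  qed (use x M M' N' N in auto)
qed

lemma lifts_subset: "lifts S H u \<Longrightarrow> T \<subseteq> S \<Longrightarrow> lifts T H u"
  unfolding lifts_def
proof (intro ballI)
  fix x assume l: "\<forall>x\<in>S. \<exists>(N, \<S>)\<in>\<T>. \<exists>P\<in>\<S>. \<exists>M. openin (top_of_set S) M \<and> x \<in> M \<and>
     (\<forall>x'\<in>M. H x' \<in> N \<and> u x' = P (H x'))" and T: "T \<subseteq> S" and x: "x \<in> T"
  then obtain N \<S> P M where *: "(N, \<S>) \<in> \<T>" "P \<in> \<S>" "openin (top_of_set S) M" "x \<in> M"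
    "\<forall>x'\<in>M. H x' \<in> N \<and> u x' = P (H x')" by fast
  have "openin (top_of_set T) (T \<inter> M)"
    using *(3) T by (auto simp: openin_open)
  then show "\<exists>(N, \<S>)\<in>\<T>. \<exists>P\<in>\<S>. \<exists>M. openin (top_of_set T) M \<and> x \<in> M \<and>
     (\<forall>x'\<in>M. H x' \<in> N \<and> u x' = P (H x'))"
    using * x by (intro bexI[of _ "(N, \<S>)"] case_prodI bexI[of _ P] exI[of _ "T \<inter> M"]) auto
qed

lemma lifts_compose:
  assumes u: "lifts S H u" and f: "continuous_on T f" "f \<in> T \<rightarrow> S"
  shows "lifts T (H \<circ> f) (u \<circ> f)"
  unfolding lifts_def
proof
  fix x assume x: "x \<in> T"
  then obtain N \<S> P M where *: "(N, \<S>) \<in> \<T>" "P \<in> \<S>" "openin (top_of_set S) M" "f x \<in> M"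
    "\<forall>x'\<in>M. H x' \<in> N \<and> u x' = P (H x')" using u f unfolding lifts_def by fast
  have "openin (top_of_set T) (T \<inter> f -` M)"
    using continuous_openin_preimage[OF f *(3)] .
  then show "\<exists>(N, \<S>)\<in>\<T>. \<exists>P\<in>\<S>. \<exists>M. openin (top_of_set T) M \<and> x \<in> M \<and>
     (\<forall>x'\<in>M. (H \<circ> f) x' \<in> N \<and> (u \<circ> f) x' = P ((H \<circ> f) x'))"
    using * x by (intro bexI[of _ "(N, \<S>)"] case_prodI bexI[of _ P] exI[of _ "T \<inter> f -` M"]) auto
qed

lemma lifts_section:
  assumes "(N, \<S>) \<in> \<T>" "Q \<in> \<S>" "H \<in> S \<rightarrow> N" shows "lifts S H (Q \<circ> H)"
  unfolding lifts_def
proof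
  fix x assume "x \<in> S"
  then show "\<exists>(N, \<S>)\<in>\<T>. \<exists>P\<in>\<S>. \<exists>M. openin (top_of_set S) M \<and> x \<in> M \<and>
     (\<forall>x'\<in>M. H x' \<in> N \<and> (Q \<circ> H) x' = P (H x'))"
    using assms by (intro bexI[of _ "(N, \<S>)"] case_prodI bexI[of _ Q] exI[of _ S]) auto
qed

lemma lifts_cong: 
  assumes "lifts S H u" "\<And>x. x \<in> S \<Longrightarrow> H x = H' x" "\<And>x. x \<in> S \<Longrightarrow> u x = u' x"
  shows "lifts S H' u'"
  unfolding lifts_def
proof
  fix x assume x: "x \<in> S"
  then obtain N \<S> P M where *: "(N, \<S>) \<in> \<T>" "P \<in> \<S>" "openin (top_of_set S) M" "x \<in> M"
    "\<forall>x'\<in>M. H x' \<in> N \<and> u x' = P (H x')" using assms(1) unfolding lifts_def by fast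
  then have "\<forall>x'\<in>M. H' x' \<in> N \<and> u' x' = P (H' x')"
    using assms(2,3) openin_subset[OF *(3)] by (metis topspace_euclidean_subtopology subsetD)
  with * show "\<exists>(N, \<S>)\<in>\<T>. \<exists>P\<in>\<S>. \<exists>M. openin (top_of_set S) M \<and> x \<in> M \<and>
     (\<forall>x'\<in>M. H' x' \<in> N \<and> u' x' = P (H' x'))"
    by (intro bexI[of _ "(N, \<S>)"] case_prodI bexI[of _ P] exI[of _ M]) auto
qed

text \<open>
  The set on which two lifts agree is open, and so is its complement, because sections that differ at
  one point differ throughout their common domain.
\<close>

lemma lifts_unique:
  assumes S: "connected S" and H: "continuous_on S H" "H \<in> S \<rightarrow> Z"
    and u: "lifts S H u" and v: "lifts S H v" and a: "a \<in> S" "u a = v a" and x: "x \<in> S"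
  shows "u x = v x"
proof -
  have "(u x = v x) = (u a = v a)"
  proof (rule connected_equivalence_relation_gen[OF S a(1) x, where P="\<lambda>_. True" and R="\<lambda>x y. (u y = v y) = (u x = v x)"])
    fix w assume w: "w \<in> S"
    obtain N \<S> where N: "(N, \<S>) \<in> \<T>" "H w \<in> N" using cover H w by blast
    obtain P Q where P: "P \<in> \<S>" "P (H w) = u w" "Q \<in> \<S>" "Q (H w) = v w"
      using section_through[OF N] lifts_in_fib[OF u w] lifts_in_fib[OF v w] by metis
    obtain M where M: "openin (top_of_set S) M" "w \<in> M" "\<And>x'. x' \<in> M \<Longrightarrow> H x' \<in> N" "\<And>x'. x' \<in> M \<Longrightarrow> u x' = P (H x')"
      using lifts_near[OF u H w N(1) P(1) N(2) P(2)] by metis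
    obtain M' where M': "openin (top_of_set S) M'" "w \<in> M'" "\<And>x'. x' \<in> M' \<Longrightarrow> v x' = Q (H x')"
      using lifts_near[OF v H w N(1) P(3) N(2) P(4)] by metis
    show "\<exists>T. openin (top_of_set S) T \<and> w \<in> T \<and> (\<forall>x\<in>T. \<forall>y\<in>T. True \<and> True \<longrightarrow> (u y = v y) = (u x = v x))"
    proof (intro exI[of _ "M \<inter> M'"] conjI ballI impI)
      fix x y assume "x \<in> M \<inter> M'" "y \<in> M \<inter> M'"
      then show "(u y = v y) = (u x = v x)"
        using M M' sections_disjoint[OF N(1) P(1,3)] by (metis IntE)
    qed (use M M' in \<open>auto intro: openin_Int\<close>)
  next
    show "\<exists>z. z \<in> T \<and> True" if "openin (top_of_set S) T" "t \<in> T" for T t using that by blast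
  qed auto
  with a show ?thesis by simp
qed

lemma lifts_const:
  assumes "connected S" "H \<in> S \<rightarrow> Z" "\<And>x. x \<in> S \<Longrightarrow> H x = z" "lifts S H u" "x \<in> S" "y \<in> S"
  shows "u x = u y"
proof -
  have z: "z \<in> Z" using assms by fastforce
  obtain N \<S> where N: "(N, \<S>) \<in> \<T>" "z \<in> N" using cover z by blast
  obtain P where P: "P \<in> \<S>" "P z = u y"
    using section_through[OF N] lifts_in_fib[OF assms(4,6)] assms(3,6) by metis
  have "lifts S H (P \<circ> H)"
    using lifts_section[OF N(1) P(1)] assms(3) N(2) by auto
  moreover have "continuous_on S H" using assms(3) by (simp cong: continuous_on_cong)
  ultimately have "u x = (P \<circ> H) x"
    using lifts_unique[OF assms(1) _ assms(2,4) _ assms(6) _ assms(5)] P assms(3,6) by simp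
  then show ?thesis using P assms by simp
qed

text \<open>
  Only points of \<open>S \<inter> T\<close> are critical. There \<open>u\<close> and \<open>v\<close> agree, by uniqueness on this connected set, so that a
  section through the common value computes both of them near the point.
\<close>

lemma lifts_glue:
  assumes cl: "closedin (top_of_set (S \<union> T)) S" "closedin (top_of_set (S \<union> T)) T"
    and con: "connected (S \<inter> T)" and a: "a \<in> S \<inter> T" "u a = v a"
    and H: "continuous_on (S \<union> T) H" "H \<in> S \<union> T \<rightarrow> Z"
    and u: "lifts S H u" and v: "lifts T H v"
  shows "lifts (S \<union> T) H (\<lambda>x. if x \<in> S then u x else v x)"
proof -
  let ?w = "\<lambda>x. if x \<in> S then u x else v x"
  have eq: "u x = v x" if "x \<in> S \<inter> T" for x
  proof (rule lifts_unique[OF con, where H=H and a=a])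
    show "continuous_on (S \<inter> T) H" "H \<in> S \<inter> T \<rightarrow> Z" using H continuous_on_subset[OF H(1), of "S \<inter> T"] by auto
    show "lifts (S \<inter> T) H u" "lifts (S \<inter> T) H v"
      using lifts_subset[OF u] lifts_subset[OF v] by auto
  qed (use a that in auto)
  have near: "\<exists>M. openin (top_of_set (S \<union> T)) M \<and> x \<in> M \<and> (\<forall>x'\<in>M \<inter> R. H x' \<in> N \<and> k x' = P (H x'))"
    if R: "R \<subseteq> S \<union> T" "closedin (top_of_set (S \<union> T)) R" "lifts R H k" and x: "x \<in> S \<union> T"
      and N: "(N, \<S>) \<in> \<T>" "P \<in> \<S>" "H x \<in> N" "x \<in> R \<Longrightarrow> P (H x) = k x" for R k x N \<S> P
  proof (cases "x \<in> R")
    case False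
    then show ?thesis using R x by (intro exI[of _ "(S \<union> T) - R"]) (auto intro: openin_diff)
  next
    case True
    have "continuous_on R H" "H \<in> R \<rightarrow> Z" using H R continuous_on_subset by blast+
    then obtain M where M: "openin (top_of_set R) M" "x \<in> M" "\<And>x'. x' \<in> M \<Longrightarrow> H x' \<in> N \<and> k x' = P (H x')"
      using lifts_near[OF R(3) _ _ True N(1,2,3) N(4)[OF True]] by metis
    then obtain M' where M': "open M'" "M = R \<inter> M'" by (auto simp: openin_open)
    show ?thesis using M M' x R
      by (intro exI[of _ "(S \<union> T) \<inter> M'"]) (auto simp: openin_open)
  qed
  show ?thesis
    unfolding lifts_def
  proof
    fix x assume x: "x \<in> S \<union> T"
    obtain N \<S> where N: "(N, \<S>) \<in> \<T>" "H x \<in> N" using cover H x by blast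
    have "?w x \<in> fib (H x)" using lifts_in_fib[OF u] lifts_in_fib[OF v] x by auto
    then obtain P where P: "P \<in> \<S>" "P (H x) = ?w x" using section_through[OF N] by blast
    have 1: "x \<in> S \<Longrightarrow> P (H x) = u x" and 2: "x \<in> T \<Longrightarrow> P (H x) = v x"
      using P eq by (auto split: if_splits)
    obtain M where M: "openin (top_of_set (S \<union> T)) M" "x \<in> M" "\<forall>x'\<in>M \<inter> S. H x' \<in> N \<and> u x' = P (H x')"
      using near[OF _ cl(1) u x N(1) P(1) N(2) 1] by blast
    obtain M' where M': "openin (top_of_set (S \<union> T)) M'" "x \<in> M'" "\<forall>x'\<in>M' \<inter> T. H x' \<in> N \<and> v x' = P (H x')"
      using near[OF _ cl(2) v x N(1) P(1) N(2) 2] by blast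
    have "\<forall>x'\<in>M \<inter> M'. H x' \<in> N \<and> ?w x' = P (H x')"
      using M(3) M'(3) openin_subset[OF M(1)] by auto
    then show "\<exists>(N, \<S>)\<in>\<T>. \<exists>P\<in>\<S>. \<exists>M. openin (top_of_set (S \<union> T)) M \<and> x \<in> M \<and>
        (\<forall>x'\<in>M. H x' \<in> N \<and> ?w x' = P (H x'))"
      using N P M M' by (intro bexI[of _ "(N, \<S>)"] case_prodI bexI[of _ P] exI[of _ "M \<inter> M'"]) (auto intro: openin_Int)
  qed
qed

text \<open>
  Rectangles which \<open>H\<close> maps into the domain of one family of sections have lifts, and lifts on two adjacent rectangles can be
  glued along their common side. The bisection principle \<open>Bolzano\<close>, used for each thin
  vertical strip and then for all strips together, extends this from small rectangles to the whole square.
\<close>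

lemma lift_exists_rectangle:
  assumes H: "continuous_on ({0..1::real} \<times> {0..1::real}) H" "H \<in> {0..1} \<times> {0..1} \<rightarrow> Z"
    and v: "v \<in> fib (H (0, 0))"
  obtains u where "lifts ({0..1} \<times> {0..1}) H u" "u (0, 0) = v"
proof -
  let ?R = "\<lambda>a b c d. \<forall>v\<in>fib (H (a, c)). \<exists>u. lifts ({a..b::real} \<times> {c..d::real}) H u \<and> u (a, c) = v"
  have glue: "\<exists>w. lifts (S \<union> T) H w \<and> w p = v"
    if "S = {a..b} \<times> {c..d}" "T = {a'..b'} \<times> {c'..d'}" "S \<union> T \<subseteq> {0..1} \<times> {0..1}"
      "lifts S H u" "u p = v" "lifts T H u'" "q \<in> S \<inter> T" "u q = u' q" "p \<in> S"
    for S T a b c d a' b' c' d' p q u u' v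
  proof (intro exI conjI)
    have "S \<inter> T = ({a..b} \<inter> {a'..b'}) \<times> ({c..d} \<inter> {c'..d'})" using that by auto
    then have "convex (S \<inter> T)" by (metis convex_Times convex_Int convex_real_interval(5))
    moreover have "closed S" "closed T" using that by (auto intro: closed_Times)
    ultimately show "lifts (S \<union> T) H (\<lambda>x. if x \<in> S then u x else u' x)"
      using that continuous_on_subset[OF H(1) that(3)] H(2)
      by (intro lifts_glue[where a=q]) (auto intro: convex_connected closed_subset)
  qed (use that in auto)
  \<comment> \<open>bisection in the vertical direction, for all strips around \<open>t\<close> that are narrow enough\<close>
  have column: "\<exists>\<delta>>0. \<forall>a b. 0 \<le> a \<and> a \<le> t \<and> t \<le> b \<and> b \<le> 1 \<and> b - a < \<delta> \<longrightarrow> ?R a b 0 1" if t: "t \<in> {0..1}" for t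
  proof -
    let ?C = "\<lambda>c d. \<exists>\<delta>>0. \<forall>a b. 0 \<le> a \<and> a \<le> t \<and> t \<le> b \<and> b \<le> 1 \<and> b - a < \<delta> \<longrightarrow> ?R a b c d"
    have "0 \<le> (0::real) \<longrightarrow> (1::real) \<le> 1 \<longrightarrow> ?C 0 1"
    proof (rule Bolzano[where P="\<lambda>c d. 0 \<le> c \<longrightarrow> d \<le> 1 \<longrightarrow> ?C c d"])
      fix c d e :: real
      assume trans: "0 \<le> c \<longrightarrow> d \<le> 1 \<longrightarrow> ?C c d" "0 \<le> d \<longrightarrow> e \<le> 1 \<longrightarrow> ?C d e" "c \<le> d" "d \<le> e"
      show "0 \<le> c \<longrightarrow> e \<le> 1 \<longrightarrow> ?C c e"
      proof (intro impI)
        assume c: "0 \<le> c" and e: "e \<le> 1"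
        have d: "0 \<le> d" "d \<le> 1" using trans(3,4) c e by linarith+
        obtain \<delta> where \<delta>: "\<delta> > 0" "\<forall>a b. 0 \<le> a \<and> a \<le> t \<and> t \<le> b \<and> b \<le> 1 \<and> b - a < \<delta> \<longrightarrow> ?R a b c d"
          using trans(1)[THEN mp, THEN mp, OF c d(2)] by blast
        obtain \<delta>' where \<delta>': "\<delta>' > 0" "\<forall>a b. 0 \<le> a \<and> a \<le> t \<and> t \<le> b \<and> b \<le> 1 \<and> b - a < \<delta>' \<longrightarrow> ?R a b d e"
          using trans(2)[THEN mp, THEN mp, OF d(1) e] by blast
        have "?R a b c e" if ab: "0 \<le> a" "a \<le> t" "t \<le> b" "b \<le> 1" "b - a < min \<delta> \<delta>'" for a b
        proof
          fix v assume "v \<in> fib (H (a, c))"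
          moreover have "?R a b c d" using \<delta>(2) ab by simp
          ultimately obtain u where u: "lifts ({a..b} \<times> {c..d}) H u" "u (a, c) = v" by blast
          have "u (a, d) \<in> fib (H (a, d))" using lifts_in_fib[OF u(1)] ab trans(3) by simp
          moreover have "?R a b d e" using \<delta>'(2) ab by simp
          ultimately obtain u' where u': "lifts ({a..b} \<times> {d..e}) H u'" "u' (a, d) = u (a, d)" by blast
          have eq: "{a..b} \<times> {c..d} \<union> {a..b} \<times> {d..e} = {a..b} \<times> {c..e}"
            using ivl_disj_un_two_touch(4)[OF trans(3,4)] by blast
          have "{a..b} \<times> {c..e} \<subseteq> {0..1} \<times> {0..1}" using ab c e by (intro Sigma_mono) auto
          then have sub: "{a..b} \<times> {c..d} \<union> {a..b} \<times> {d..e} \<subseteq> {0..1} \<times> {0..1}" using eq by simp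
          have "(a, d) \<in> {a..b} \<times> {c..d} \<inter> {a..b} \<times> {d..e}" "(a, c) \<in> {a..b} \<times> {c..d}"
            using ab trans(3,4) by simp_all
          from glue[OF refl refl sub u u'(1) this(1) u'(2)[symmetric] this(2)]
          show "\<exists>u. lifts ({a..b} \<times> {c..e}) H u \<and> u (a, c) = v" unfolding eq .
        qed
        then have "\<forall>a b. 0 \<le> a \<and> a \<le> t \<and> t \<le> b \<and> b \<le> 1 \<and> b - a < min \<delta> \<delta>' \<longrightarrow> ?R a b c e" by blast
        moreover have "min \<delta> \<delta>' > 0" using \<delta>(1) \<delta>'(1) by simp
        ultimately show "\<exists>\<delta>>0. \<forall>a b. 0 \<le> a \<and> a \<le> t \<and> t \<le> b \<and> b \<le> 1 \<and> b - a < \<delta> \<longrightarrow> ?R a b c e" by blast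
      qed
    next
      fix s :: real assume "0 \<le> s" "s \<le> 1"
      then have ts: "(t, s) \<in> {0..1} \<times> {0..1}" using t by auto
      obtain N \<S> where N: "(N, \<S>) \<in> \<T>" "H (t, s) \<in> N" using cover H(2) ts by blast
      have "openin (top_of_set ({0..1} \<times> {0..1})) ({0..1} \<times> {0..1} \<inter> H -` N)"
        using continuous_openin_preimage[OF H open_domain[OF N(1)]] .
      moreover have "(t, s) \<in> {0..1} \<times> {0..1} \<inter> H -` N" using ts N(2) by blast
      ultimately have "\<exists>e>0. ball (t, s) e \<inter> {0..1} \<times> {0..1} \<subseteq> {0..1} \<times> {0..1} \<inter> H -` N"
        using openin_contains_ball[of "{0..1} \<times> {0..1}" "{0..1} \<times> {0..1} \<inter> H -` N"] by meson
      then obtain e where e: "e > 0" "ball (t, s) e \<inter> {0..1} \<times> {0..1} \<subseteq> {0..1} \<times> {0..1} \<inter> H -` N"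
        by blast
      have R: "?R a b c d" if "0 \<le> a" "a \<le> t" "t \<le> b" "b \<le> 1" "b - a < e/2" "c \<le> s" "s \<le> d" "d - c < e/2" "0 \<le> c" "d \<le> 1" for a b c d
      proof
        fix v assume v: "v \<in> fib (H (a, c))"
        have "dist (t, s) p < e" if "p \<in> {a..b} \<times> {c..d}" for p
        proof -
          have "dist (t, s) p \<le> \<bar>t - fst p\<bar> + \<bar>s - snd p\<bar>"
            by (cases p) (simp add: dist_prod_def dist_real_def sqrt_sum_squares_le_sum_abs)
          then show ?thesis using that \<open>a \<le> t\<close> \<open>t \<le> b\<close> \<open>b - a < e/2\<close> \<open>c \<le> s\<close> \<open>s \<le> d\<close> \<open>d - c < e/2\<close>
            by (cases p) (auto simp: abs_if split: if_splits)
        qed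
        moreover have "{a..b} \<times> {c..d} \<subseteq> {0..1} \<times> {0..1}" using that by auto
        ultimately have "{a..b} \<times> {c..d} \<subseteq> ball (t, s) e \<inter> {0..1} \<times> {0..1}" by (auto simp: mem_ball)
        then have HN: "H \<in> {a..b} \<times> {c..d} \<rightarrow> N" using e(2) by blast
        have "(a, c) \<in> {a..b} \<times> {c..d}" using that by simp
        then obtain P where P: "P \<in> \<S>" "P (H (a, c)) = v"
          using section_through[OF N(1) _ v] HN by blast
        then show "\<exists>u. lifts ({a..b} \<times> {c..d}) H u \<and> u (a, c) = v"
          using lifts_section[OF N(1) P(1) HN] by (intro exI[of _ "P \<circ> H"]) auto
      qed
      show "\<exists>\<delta>>0. \<forall>c d. c \<le> s \<and> s \<le> d \<and> d - c < \<delta> \<longrightarrow> 0 \<le> c \<longrightarrow> d \<le> 1 \<longrightarrow> ?C c d"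
      proof (rule exI[of _ "e/2"], intro conjI allI impI)
        fix c d
        assume "c \<le> s \<and> s \<le> d \<and> d - c < e/2" "0 \<le> c" "d \<le> 1"
        then show "\<exists>\<delta>>0. \<forall>a b. 0 \<le> a \<and> a \<le> t \<and> t \<le> b \<and> b \<le> 1 \<and> b - a < \<delta> \<longrightarrow> ?R a b c d"
          using R e(1) by (intro exI[of _ "e/2"]) simp
      qed (use e(1) in simp)
    qed simp
    then show ?thesis by simp
  qed
  \<comment> \<open>bisection in the horizontal direction\<close>
  have "0 \<le> (0::real) \<longrightarrow> (1::real) \<le> 1 \<longrightarrow> ?R 0 1 0 1"
  proof (rule Bolzano[where P="\<lambda>a b. 0 \<le> a \<longrightarrow> b \<le> 1 \<longrightarrow> ?R a b 0 1"])
    fix a b c :: real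
    assume trans: "0 \<le> a \<longrightarrow> b \<le> 1 \<longrightarrow> ?R a b 0 1" "0 \<le> b \<longrightarrow> c \<le> 1 \<longrightarrow> ?R b c 0 1" "a \<le> b" "b \<le> c"
    show "0 \<le> a \<longrightarrow> c \<le> 1 \<longrightarrow> ?R a c 0 1"
    proof (intro impI ballI)
      fix v assume "0 \<le> a" "c \<le> 1" and v: "v \<in> fib (H (a, 0))"
      have b: "0 \<le> b" "b \<le> 1" using trans(3,4) \<open>0 \<le> a\<close> \<open>c \<le> 1\<close> by linarith+
      obtain u where u: "lifts ({a..b} \<times> {0..1}) H u" "u (a, 0) = v"
        using trans(1)[THEN mp, THEN mp, OF \<open>0 \<le> a\<close> b(2)] v by blast
      have "u (b, 0) \<in> fib (H (b, 0))" using lifts_in_fib[OF u(1)] trans(3) by simp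
      then obtain u' where u': "lifts ({b..c} \<times> {0..1}) H u'" "u' (b, 0) = u (b, 0)"
        using trans(2)[THEN mp, THEN mp, OF b(1) \<open>c \<le> 1\<close>] by blast
      have eq: "{a..b} \<times> {0..1} \<union> {b..c} \<times> {0..1} = {a..c} \<times> {0..1::real}"
        using ivl_disj_un_two_touch(4)[OF trans(3,4)] by blast
      have "{a..c} \<times> {0..1} \<subseteq> {0..1} \<times> {0..1::real}" using \<open>0 \<le> a\<close> \<open>c \<le> 1\<close> by (intro Sigma_mono) auto
      then have sub: "{a..b} \<times> {0..1} \<union> {b..c} \<times> {0..1} \<subseteq> {0..1} \<times> {0..1::real}" using eq by simp
      have "(b, 0) \<in> {a..b} \<times> {0..1} \<inter> {b..c} \<times> {0..1::real}" "(a, 0) \<in> {a..b} \<times> {0..1::real}"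
        using trans(3,4) by simp_all
      from glue[OF refl refl sub u u'(1) this(1) u'(2)[symmetric] this(2)]
      show "\<exists>u. lifts ({a..c} \<times> {0..1}) H u \<and> u (a, 0) = v" unfolding eq .
    qed
  next
    fix t :: real assume "0 \<le> t" "t \<le> 1"
    then obtain \<delta> where "\<delta> > 0" "\<forall>a b. 0 \<le> a \<and> a \<le> t \<and> t \<le> b \<and> b \<le> 1 \<and> b - a < \<delta> \<longrightarrow> ?R a b 0 1"
      using column[of t] by auto
    then show "\<exists>\<delta>>0. \<forall>a b. a \<le> t \<and> t \<le> b \<and> b - a < \<delta> \<longrightarrow> 0 \<le> a \<longrightarrow> b \<le> 1 \<longrightarrow> ?R a b 0 1"
      by (intro exI[of _ \<delta>]) simp
  qed simp
  then show ?thesis using that v by auto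
qed

lemma lift_path_exists:
  assumes "path h" "path_image h \<subseteq> Z" "v \<in> fib (pathstart h)"
  obtains u where "lifts {0..1} h u" "u 0 = v"
proof -
  have "continuous_on ({0..1::real} \<times> {0..1}) (h \<circ> snd)"
    using assms(1) by (intro continuous_on_compose continuous_on_snd) (auto simp: path_def)
  moreover have "h \<circ> snd \<in> {0..1::real} \<times> {0..1} \<rightarrow> Z" using assms(2) by (auto simp: path_image_def)
  ultimately obtain u where u: "lifts ({0..1::real} \<times> {0..1}) (h \<circ> snd) u" "u (0, 0) = v"
    using lift_exists_rectangle[of "h \<circ> snd" v] assms(3) 
    by (auto simp: pathstart_def o_def)
  have "lifts {0..1} ((h \<circ> snd) \<circ> Pair (0::real)) (u \<circ> Pair 0)"
    by (rule lifts_compose[OF u(1)]) (auto intro!: continuous_intros)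
  then show ?thesis using that[of "u \<circ> Pair 0"] u(2) by (auto simp: o_def)
qed

text \<open>
  Lift the whole homotopy. Its two constant sides lift to constants, so the lifts of the two
  other sides, which start together, end together.
\<close>

lemma monodromy:
  assumes hom: "homotopic_paths Z h k" and u: "lifts {0..1} h u" and v: "lifts {0..1} k v" and eq: "u 0 = v 0"
  shows "u 1 = v 1"
proof -
  obtain H :: "real \<times> real \<Rightarrow> 'z" where H: "continuous_on ({0..1} \<times> {0..1}) H" "H \<in> {0..1} \<times> {0..1} \<rightarrow> Z"
    and H0: "\<forall>t\<in>{0..1}. H (0, t) = h t" and H1: "\<forall>t\<in>{0..1}. H (1, t) = k t"
    and Hs: "\<forall>s\<in>{0..1}. H (s, 0) = h 0 \<and> H (s, 1) = h 1"
    using hom unfolding homotopic_paths pathstart_def pathfinish_def o_def by blast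
  have "u 0 \<in> fib (H (0, 0))" using lifts_in_fib[OF u] H0 by auto
  then obtain U where U: "lifts ({0..1} \<times> {0..1}) H U" "U (0, 0) = u 0"
    using lift_exists_rectangle[OF H] by blast
  have side: "lifts {0..1} (H \<circ> f) (U \<circ> f) \<and> continuous_on {0..1} (H \<circ> f) \<and> H \<circ> f \<in> {0..1} \<rightarrow> Z"
    if "continuous_on {0..1::real} f" "f \<in> {0..1} \<rightarrow> {0..1} \<times> {0..1}" for f :: "real \<Rightarrow> real \<times> real"
  proof (intro conjI continuous_on_compose continuous_on_subset[OF H(1)])
    show "f ` {0..1} \<subseteq> {0..1} \<times> {0..1}" using that(2) by blast
    then show "H \<circ> f \<in> {0..1} \<rightarrow> Z" using H(2) by fastforce
  qed (use lifts_compose[OF U(1) that] that in auto)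
  have "lifts {0..1} (\<lambda>t. H (0, t)) (\<lambda>t. U (0, t))" "lifts {0..1} (\<lambda>t. H (1, t)) (\<lambda>t. U (1, t))"
    and sides: "lifts {0..1} (\<lambda>s. H (s, 0)) (\<lambda>s. U (s, 0))" "lifts {0..1} (\<lambda>s. H (s, 1)) (\<lambda>s. U (s, 1))"
    using side[of "\<lambda>t. (0, t)"] side[of "\<lambda>t. (1, t)"] side[of "\<lambda>s. (s, 0)"] side[of "\<lambda>s. (s, 1)"]
    by (simp_all add: o_def continuous_on_Pair)
  note edges = this(1,2)
  have "lifts {0..1} h (\<lambda>t. U (0, t))" by (rule lifts_cong[OF edges(1)]) (use H0 in auto)
  moreover have "lifts {0..1} k (\<lambda>t. U (1, t))" by (rule lifts_cong[OF edges(2)]) (use H1 in auto)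
  moreover have "continuous_on {0..1} h" "continuous_on {0..1} k" "h \<in> {0..1} \<rightarrow> Z" "k \<in> {0..1} \<rightarrow> Z"
    using homotopic_paths_imp_path[OF hom] homotopic_paths_imp_subset[OF hom] by (auto simp: path_def path_image_def)
  moreover have "U (0, 0) = U (1, 0)"
    using lifts_const[OF _ _ _ sides(1), of "h 0" 0 1] Hs \<open>h \<in> {0..1} \<rightarrow> Z\<close> by (simp add: Pi_iff)
  moreover have "U (0, 1) = U (1, 1)"
    using lifts_const[OF _ _ _ sides(2), of "h 1" 0 1] Hs \<open>h \<in> {0..1} \<rightarrow> Z\<close> by (simp add: Pi_iff)
  ultimately show ?thesis
    using lifts_unique[of "{0..1}" h u "\<lambda>t. U (0, t)" 0 1] lifts_unique[of "{0..1}" k v "\<lambda>t. U (1, t)" 0 1] U(2) u v eq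
    by auto
qed

text \<open>
  A lift along a path is determined by its start, and on a simply connected space its end depends
  on the end point of the path only; this end is the value of the global lift.
\<close>

lemma global_lift_exists:
  fixes Y :: "'d::topological_space set"
  assumes Y: "simply_connected Y" and loc: "\<And>y N. openin (top_of_set Y) N \<Longrightarrow> y \<in> N \<Longrightarrow>
      \<exists>M. openin (top_of_set Y) M \<and> y \<in> M \<and> M \<subseteq> N \<and> path_connected M"
    and H: "continuous_on Y H" "H \<in> Y \<rightarrow> Z" and y0: "y0 \<in> Y" and v: "v \<in> fib (H y0)"
  obtains u where "lifts Y H u" "u y0 = v"
proof -
  have pc: "path_connected Y" using simply_connected_imp_path_connected_general[OF Y] .
  \<comment> \<open>\<open>w\<close> is the end of a lift along some path from \<open>y0\<close> to \<open>y\<close>\<close>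
  define R where "R y w \<longleftrightarrow> (\<exists>h k. path h \<and> path_image h \<subseteq> Y \<and> pathstart h = y0 \<and> pathfinish h = y \<and>
      lifts {0..1} (H \<circ> h) k \<and> k 0 = v \<and> k 1 = w)" for y w
  have Hpath: "path (H \<circ> h)" "path_image (H \<circ> h) \<subseteq> Z" if "path h" "path_image h \<subseteq> Y" for h
    using path_continuous_image[OF that(1) continuous_on_subset[OF H(1) that(2)]] that(2) H(2)
    by (auto simp: path_image_def)
  have unique: "w = w'" if "R y w" "R y w'" for y w w'
  proof -
    obtain h k where h: "path h" "path_image h \<subseteq> Y" "pathstart h = y0" "pathfinish h = y"
      "lifts {0..1} (H \<circ> h) k" "k 0 = v" "k 1 = w" using \<open>R y w\<close> unfolding R_def by blast
    obtain h' k' where h': "path h'" "path_image h' \<subseteq> Y" "pathstart h' = y0" "pathfinish h' = y"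
      "lifts {0..1} (H \<circ> h') k'" "k' 0 = v" "k' 1 = w'" using \<open>R y w'\<close> unfolding R_def by blast
    have "homotopic_paths Y h h'"
      using simply_connected_imp_homotopic_paths[OF Y] h h' by simp
    then have "homotopic_paths Z (H \<circ> h) (H \<circ> h')"
      using homotopic_paths_continuous_image H by blast
    from monodromy[OF this h(5) h'(5)] h h' show ?thesis by simp
  qed
  have ex: "\<exists>w. R y w" if y: "y \<in> Y" for y
  proof -
    obtain h where h: "path h" "path_image h \<subseteq> Y" "pathstart h = y0" "pathfinish h = y"
      using pc y0 y unfolding path_connected_def by blast
    obtain k where "lifts {0..1} (H \<circ> h) k" "k 0 = v"
      using lift_path_exists[OF Hpath[OF h(1,2)], of v] v h(3) by (auto simp: pathstart_def)
    then show ?thesis using h unfolding R_def by blast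
  qed
  define u where "u y = (SOME w. R y w)" for y
  have uR: "R y (u y)" if "y \<in> Y" for y
    unfolding u_def using someI_ex[OF ex[OF that]] .
  have "lifts Y H u"
    unfolding lifts_def
  proof
    fix y assume y: "y \<in> Y"
    obtain N \<S> where N: "(N, \<S>) \<in> \<T>" "H y \<in> N" using cover H y by blast
    obtain h k where h: "path h" "path_image h \<subseteq> Y" "pathstart h = y0" "pathfinish h = y"
      "lifts {0..1} (H \<circ> h) k" "k 0 = v" "k 1 = u y" using uR[OF y] unfolding R_def by blast
    have "u y \<in> fib (H y)" using lifts_in_fib[OF h(5), of 1] h by (simp add: pathfinish_def)
    then obtain P where P: "P \<in> \<S>" "P (H y) = u y" using section_through[OF N] by blast
    have "openin (top_of_set Y) (Y \<inter> H -` N)" using continuous_openin_preimage[OF H open_domain[OF N(1)]] .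
    then obtain M where M: "openin (top_of_set Y) M" "y \<in> M" "M \<subseteq> Y \<inter> H -` N" "path_connected M"
      using loc[of "Y \<inter> H -` N" y] y N(2) by blast
    have "u y' = P (H y')" if y': "y' \<in> M" for y'
    proof -
      obtain l where l: "path l" "path_image l \<subseteq> M" "pathstart l = y" "pathfinish l = y'"
        using M(2,4) y' unfolding path_connected_def by blast
      let ?w = "\<lambda>t. if t \<in> {0..1/2} then k (2 * t) else P (H (l (2 * t - 1)))"
      have "lifts ({0..1/2} \<union> {1/2..1}) (H \<circ> (h +++ l)) ?w"
      proof (rule lifts_glue[where a="1/2"])
        show "closedin (top_of_set ({0..1/2} \<union> {1/2..1})) {0..1/2::real}"
          "closedin (top_of_set ({0..1/2} \<union> {1/2..1})) {1/2..1::real}" by (auto intro: closed_subset)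
        have "{0..1/2} \<inter> {1/2..1::real} = {1/2}" by auto
        then show "connected ({0..1/2} \<inter> {1/2..1::real})" by simp
        show "k (2 * (1/2)) = P (H (l (2 * (1/2) - 1)))"
          using h(7) P(2) l(3) by (simp add: pathstart_def)
        have eq: "{0..1/2} \<union> {1/2..1} = {0..1::real}" by auto
        have j: "path (h +++ l)" "path_image (h +++ l) \<subseteq> Y"
          using h l M(3) by (simp, intro subset_path_image_join) auto
        show "continuous_on ({0..1/2} \<union> {1/2..1}) (H \<circ> (h +++ l))" "H \<circ> (h +++ l) \<in> {0..1/2} \<union> {1/2..1} \<rightarrow> Z"
          unfolding eq using Hpath[OF j] by (auto simp: path_def path_image_def)
        have "lifts {0..1/2} ((H \<circ> h) \<circ> (\<lambda>t. 2 * t)) (k \<circ> (\<lambda>t. 2 * t))"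
          by (rule lifts_compose[OF h(5)]) (auto intro!: continuous_intros)
        then show "lifts {0..1/2} (H \<circ> (h +++ l)) (\<lambda>t. k (2 * t))"
          by (rule lifts_cong) (auto simp: joinpaths_def)
        have "H \<circ> (l \<circ> (\<lambda>t. 2 * t - 1)) \<in> {1/2..1} \<rightarrow> N"
          using l(2) M(3) by (auto simp: path_image_def image_subset_iff subset_iff)
        from lifts_section[OF N(1) P(1) this]
        show "lifts {1/2..1} (H \<circ> (h +++ l)) (\<lambda>t. P (H (l (2 * t - 1))))"
        proof (rule lifts_cong)
          fix t :: real assume "t \<in> {1/2..1}"
          then show "(H \<circ> (l \<circ> (\<lambda>t. 2 * t - 1))) t = (H \<circ> (h +++ l)) t"
            using l(3) h(4) by (cases "2 * t = 1") (auto simp: joinpaths_def pathstart_def pathfinish_def)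
        qed simp
      qed auto
      moreover have "{0..1/2} \<union> {1/2..1} = {0..1::real}" by auto
      ultimately have w: "lifts {0..1} (H \<circ> (h +++ l)) ?w" by simp
      have "path_image (h +++ l) \<subseteq> Y" using h(2) l(2) M(3) by (intro subset_path_image_join) auto
      moreover have "path (h +++ l)" "pathstart (h +++ l) = y0" "pathfinish (h +++ l) = y'" using h l by simp_all
      moreover have "?w 0 = v" "?w 1 = P (H y')" using h(6) l(4) by (simp_all add: pathfinish_def)
      ultimately have "R y' (P (H y'))"
        unfolding R_def using w by blast
      moreover have "y' \<in> Y" using y' M(3) by auto
      ultimately show ?thesis using unique uR by blast
    qed
    then show "\<exists>(N, \<S>)\<in>\<T>. \<exists>P\<in>\<S>. \<exists>M. openin (top_of_set Y) M \<and> y \<in> M \<and>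
       (\<forall>x'\<in>M. H x' \<in> N \<and> u x' = P (H x'))"
      using N P M by (intro bexI[of _ "(N, \<S>)"] case_prodI bexI[of _ P] exI[of _ M]) auto
  qed
  moreover have "u y0 = v"
  proof -
    obtain k where "lifts {0..1::real} (H \<circ> (\<lambda>t. y0)) k" "k 0 = v"
      using lift_path_exists[of "H \<circ> (\<lambda>t. y0)" v] v Hpath[of "\<lambda>t. y0"] y0 
      by (auto simp: pathstart_def path_def path_image_def)
    moreover have "k 1 = k 0"
      by (rule lifts_const[OF _ _ _ calculation(1), where z="H y0"]) (use H y0 in auto)
    ultimately have "R y0 v"
      unfolding R_def using y0 by (intro exI[of _ "\<lambda>t. y0"] exI[of _ k]) (auto simp: path_def path_image_def pathstart_def pathfinish_def)
    then show ?thesis using unique uR y0 by blast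
  qed
  ultimately show ?thesis using that by blast
qed

end

section \<open>Holomorphic change of variables in plane integrals\<close>

definition vec_of_complex :: "complex \<Rightarrow> real^2" where
  "vec_of_complex z = vector [Re z, Im z]"

definition complex_of_vec :: "real^2 \<Rightarrow> complex" where
  "complex_of_vec v = Complex (v $ 1) (v $ 2)"

lemma complex_of_vec_of_complex [simp]: "complex_of_vec (vec_of_complex z) = z"
  by (simp add: complex_of_vec_def vec_of_complex_def)

lemma vec_of_complex_of_vec [simp]: "vec_of_complex (complex_of_vec v) = v"
  by (simp add: complex_of_vec_def vec_of_complex_def vec_eq_iff forall_2)

lemma bounded_linear_vec_of_complex: "bounded_linear vec_of_complex"
  by (intro linear_conv_bounded_linear[THEN iffD1] linearI)
    (simp_all add: vec_of_complex_def vec_eq_iff forall_2)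

lemma bounded_linear_complex_of_vec: "bounded_linear complex_of_vec"
  by (intro linear_conv_bounded_linear[THEN iffD1] linearI)
    (simp_all add: complex_of_vec_def complex_eq_iff)

lemma borel_vec_of_complex [measurable]: "vec_of_complex \<in> borel \<rightarrow>\<^sub>M borel"
  by (intro borel_measurable_continuous_onI linear_continuous_on bounded_linear_vec_of_complex)

lemma borel_complex_of_vec [measurable]: "complex_of_vec \<in> borel \<rightarrow>\<^sub>M borel"
  by (intro borel_measurable_continuous_onI linear_continuous_on bounded_linear_complex_of_vec)

text \<open>
  Both measures give every box the product of its side lengths.
\<close>

lemma lborel_vec_of_complex: "distr lborel borel vec_of_complex = lborel"
proof (rule lborel_eqI[symmetric])
  fix l u :: "real^2" assume le: "\<And>b. b \<in> Basis \<Longrightarrow> l \<bullet> b \<le> u \<bullet> b"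
  have B: "(Basis :: (real^2) set) = {axis 1 1, axis 2 1}"
    by (auto simp: Basis_vec_def UNIV_2)
  have le: "l $ 1 \<le> u $ 1" "l $ 2 \<le> u $ 2"
    using le[of "axis 1 1"] le[of "axis 2 1"] by (simp_all add: B inner_axis)
  have "vec_of_complex -` box l u = box (complex_of_vec l) (complex_of_vec u)"
    by (auto simp: box_def B inner_axis vec_of_complex_def complex_of_vec_def Basis_complex_def)
  moreover have "(axis 1 1 :: real^2) \<noteq> axis 2 1" by (simp add: axis_eq_axis)
  moreover have "1 \<noteq> \<i>" by (simp add: complex_eq_iff)
  ultimately show "emeasure (distr lborel borel vec_of_complex) (box l u) = (\<Prod>b\<in>Basis. (u - l) \<bullet> b)"
    using le by (subst emeasure_distr)
      (auto simp: emeasure_lborel_box_eq B inner_axis complex_of_vec_def Basis_complex_def)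
qed simp

lemma det_complex_multiplication:
  "det (matrix (\<lambda>v. vec_of_complex (c * complex_of_vec v))) = (cmod c)\<^sup>2"
  by (simp add: det_2 matrix_def vec_of_complex_def complex_of_vec_def axis_def cmod_power2[unfolded power2_eq_square] power2_eq_square)

text \<open>
  The Jacobian determinant of a holomorphic map is \<open>\<bar>\<tau>'\<bar>\<^sup>2\<close>. The change-of-variables theorem is stated for
  \<^typ>\<open>real^'n\<close>, so the integrals are transported along the measure-preserving identification of
  \<open>\<complex>\<close> with \<open>\<real>\<^sup>2\<close>.
\<close>

lemma integral_holomorphic_substitution:
  fixes G :: "complex \<Rightarrow> complex"
  assumes S: "open S" and \<tau>: "\<tau> holomorphic_on S" "inj_on \<tau> S" and G: "set_integrable lborel (\<tau> ` S) G"
    and h: "set_integrable lborel S (\<lambda>z. (cmod (deriv \<tau> z))\<^sup>2 *\<^sub>R G (\<tau> z))"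
  shows "(LINT z:S|lborel. (cmod (deriv \<tau> z))\<^sup>2 *\<^sub>R G (\<tau> z)) = (LINT w:\<tau> ` S|lborel. G w)"
proof -
  let ?V = vec_of_complex and ?C = complex_of_vec
  define g where "g = ?V \<circ> \<tau> \<circ> ?C"
  define g' where "g' x = (\<lambda>v. ?V (deriv \<tau> (?C x) * ?C v))" for x
  define f where "f = ?V \<circ> G \<circ> ?C"
  have open_im: "open (\<tau> ` T)" if "open T" "T \<subseteq> S" for T
    using open_mapping_thm3[OF holomorphic_on_subset[OF \<tau>(1) that(2)] that(1)] inj_on_subset[OF \<tau>(2) that(2)] by blast
  have img: "?V ` T = ?C -` T" for T
    by (force simp: image_iff)
  have open_V: "open (?V ` T)" if "open T" for T
    unfolding img using linear_continuous_on[OF bounded_linear_complex_of_vec] that by (intro open_vimage) auto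
  have gS: "g ` (?V ` S) = ?V ` (\<tau> ` S)" by (auto simp: g_def image_image)
  have transfer: "integrable lebesgue (\<lambda>x. indicator (?V ` T) x *\<^sub>R ?V (h (?C x))) \<and>
      (\<integral>x. indicator (?V ` T) x *\<^sub>R ?V (h (?C x)) \<partial>lebesgue) = ?V (LINT z:T|lborel. h z)"
    if T: "set_integrable lborel T h" for T and h :: "complex \<Rightarrow> complex"
  proof -
    let ?k = "\<lambda>z. indicator T z *\<^sub>R h z" and ?l = "\<lambda>x. indicator (?V ` T) x *\<^sub>R ?V (h (?C x))"
    have k: "integrable lborel ?k" using T by (simp add: set_integrable_def)
    have l: "?l = ?V \<circ> ?k \<circ> ?C" unfolding img
      by (auto simp: fun_eq_iff indicator_def linear_0[OF bounded_linear.linear[OF bounded_linear_vec_of_complex]])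
    have m: "?l \<in> borel_measurable lborel"
      unfolding l using borel_measurable_integrable[OF k] by (auto intro!: measurable_comp[of _ _ borel])
    have Vk: "integrable lborel (\<lambda>z. ?V (?k z))" "(\<integral>z. ?V (?k z) \<partial>lborel) = ?V (\<integral>z. ?k z \<partial>lborel)"
      using integrable_bounded_linear[OF bounded_linear_vec_of_complex k] integral_bounded_linear[OF bounded_linear_vec_of_complex k]
      by auto
    have lV: "(\<lambda>z. ?l (?V z)) = (\<lambda>z. ?V (?k z))"
      using fun_cong[OF l, of "?V _"] by (auto simp: fun_eq_iff)
    have "integrable (distr lborel borel ?V) ?l"
      using integrable_distr_eq[of ?V lborel borel ?l] m Vk(1) unfolding lV by simp
    moreover have "integral\<^sup>L (distr lborel borel ?V) ?l = ?V (\<integral>z. ?k z \<partial>lborel)"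
      using integral_distr[of ?V lborel borel ?l] m Vk(2) unfolding lV by simp
    ultimately show ?thesis
      using m by (simp add: lborel_vec_of_complex integrable_completion integral_completion set_lebesgue_integral_def)
  qed
  have eqD: "\<bar>det (matrix (g' x))\<bar> *\<^sub>R f (g x) = ?V ((cmod (deriv \<tau> (?C x)))\<^sup>2 *\<^sub>R G (\<tau> (?C x)))" for x
    unfolding g'_def det_complex_multiplication
    by (simp add: f_def g_def linear_scale[OF bounded_linear.linear[OF bounded_linear_vec_of_complex]])
  have "f absolutely_integrable_on g ` (?V ` S)" "integral (g ` (?V ` S)) f = ?V (LINT w:\<tau> ` S|lborel. G w)"
    using transfer[OF G] set_lebesgue_integral_eq_integral(2)[of "g ` (?V ` S)" f]
    unfolding gS by (simp_all add: set_integrable_def set_lebesgue_integral_def f_def)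
  moreover have "(g has_derivative g' x) (at x within ?V ` S)" if "x \<in> ?V ` S" for x
  proof -
    have "?C x \<in> S" using that by auto
    then have "(\<tau> has_derivative (*) (deriv \<tau> (?C x))) (at (?C x))"
      using holomorphic_derivI[OF \<tau>(1) S] by (simp add: has_field_derivative_def)
    then have "(\<tau> \<circ> ?C has_derivative (*) (deriv \<tau> (?C x)) \<circ> ?C) (at x)"
      by (rule diff_chain_at[OF bounded_linear_imp_has_derivative[OF bounded_linear_complex_of_vec]])
    then have "(?V \<circ> (\<tau> \<circ> ?C) has_derivative ?V \<circ> ((*) (deriv \<tau> (?C x)) \<circ> ?C)) (at x)"
      by (rule diff_chain_at[OF _ bounded_linear_imp_has_derivative[OF bounded_linear_vec_of_complex]])
    then have "(g has_derivative g' x) (at x)" unfolding g_def g'_def o_def .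
    then show ?thesis by (rule has_derivative_at_withinI)
  qed
  moreover have "inj_on g (?V ` S)"
    using \<tau>(2) unfolding inj_on_def g_def by (metis comp_apply complex_of_vec_of_complex imageE)
  moreover have "?V ` S \<in> sets lebesgue" using open_V[OF S] by auto
  ultimately have D: "(\<lambda>x. \<bar>det (matrix (g' x))\<bar> *\<^sub>R f (g x)) absolutely_integrable_on ?V ` S"
    "integral (?V ` S) (\<lambda>x. \<bar>det (matrix (g' x))\<bar> *\<^sub>R f (g x)) = ?V (LINT w:\<tau> ` S|lborel. G w)"
    using has_absolute_integral_change_of_variables[of "?V ` S" g g' f "?V (LINT w:\<tau> ` S|lborel. G w)"] by auto
  let ?h = "\<lambda>z. (cmod (deriv \<tau> z))\<^sup>2 *\<^sub>R G (\<tau> z)"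
  have "?V (LINT z:S|lborel. ?h z) = integral (?V ` S) (\<lambda>x. ?V (?h (?C x)))"
    using transfer[OF h] set_lebesgue_integral_eq_integral(2)[of "?V ` S" "\<lambda>x. ?V (?h (?C x))"]
    by (simp add: set_integrable_def set_lebesgue_integral_def)
  also have "\<dots> = ?V (LINT w:\<tau> ` S|lborel. G w)" using D(2) unfolding eqD .
  finally show ?thesis by (metis complex_of_vec_of_complex)
qed

section \<open>Wirtinger derivatives\<close>

text \<open>
  The coefficients \<open>a\<close> and \<open>b\<close> are \<open>\<partial>f/\<partial>z\<close> and \<open>\<partial>f/\<partial>cnj z\<close>. In these coordinates a holomorphic change of chart acts on
  differentials by multiplication with its derivative and with the conjugate of its derivative.
\<close>

definition wirtinger :: "complex set \<Rightarrow> (complex \<Rightarrow> complex) \<Rightarrow> (complex \<Rightarrow> complex) \<Rightarrow> (complex \<Rightarrow> complex) \<Rightarrow> bool" where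
  "wirtinger S f a b \<longleftrightarrow> continuous_on S a \<and> continuous_on S b \<and>
     (\<forall>z\<in>S. (f has_derivative (\<lambda>h. a z * h + b z * cnj h)) (at z))"

lemma wirtinger_has_derivative:
  "wirtinger S f a b \<Longrightarrow> z \<in> S \<Longrightarrow> (f has_derivative (\<lambda>h. a z * h + b z * cnj h)) (at z)"
  by (simp add: wirtinger_def)

lemma wirtinger_continuous: "wirtinger S f a b \<Longrightarrow> continuous_on S f"
  by (meson wirtinger_has_derivative has_derivative_continuous continuous_at_imp_continuous_on)

lemma wirtinger_eqI:
  "wirtinger S f a b \<Longrightarrow> (\<And>z. z \<in> S \<Longrightarrow> a z = a' z) \<Longrightarrow> (\<And>z. z \<in> S \<Longrightarrow> b z = b' z) \<Longrightarrow> wirtinger S f a' b'"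
  unfolding wirtinger_def by (auto cong: continuous_on_cong)

lemma wirtinger_unique:
  assumes "wirtinger S f a b" "wirtinger S f a' b'" "z \<in> S"
  shows "a z = a' z" "b z = b' z"
proof -
  have "(\<lambda>h. a z * h + b z * cnj h) = (\<lambda>h. a' z * h + b' z * cnj h)"
    using assms has_derivative_unique wirtinger_has_derivative by blast
  from fun_cong[OF this, of 1] fun_cong[OF this, of \<i>]
  have "a z + b z = a' z + b' z" "(a z - b z) * \<i> = (a' z - b' z) * \<i>"
    by (simp_all add: algebra_simps)
  then have "a z + b z = a' z + b' z" "a z - b z = a' z - b' z" by simp_all
  moreover have "a z = ((a z + b z) + (a z - b z)) / 2" "b z = ((a z + b z) - (a z - b z)) / 2"
    "a' z = ((a' z + b' z) + (a' z - b' z)) / 2" "b' z = ((a' z + b' z) - (a' z - b' z)) / 2" by simp_all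
  ultimately show "a z = a' z" "b z = b' z" by metis+
qed

lemma wirtinger_transform:
  assumes "wirtinger S f a b" "open S" "\<And>z. z \<in> S \<Longrightarrow> f z = g z"
  shows "wirtinger S g a b"
  unfolding wirtinger_def
proof (intro conjI ballI)
  fix z assume z: "z \<in> S"
  then show "(g has_derivative (\<lambda>h. a z * h + b z * cnj h)) (at z)"
    using wirtinger_has_derivative[OF assms(1) z] assms(2,3) has_derivative_transform_within_open by blast
qed (use assms(1) wirtinger_def in auto)

lemma wirtinger_subset: "wirtinger S f a b \<Longrightarrow> T \<subseteq> S \<Longrightarrow> wirtinger T f a b"
  unfolding wirtinger_def using continuous_on_subset by blast

lemma wirtinger_Union:
  assumes "\<And>z. z \<in> S \<Longrightarrow> \<exists>T. open T \<and> z \<in> T \<and> wirtinger T f a b"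
  shows "wirtinger S f a b"
  unfolding wirtinger_def
proof (intro conjI continuous_at_imp_continuous_on ballI)
  fix z assume "z \<in> S"
  then obtain T where T: "open T" "z \<in> T" "wirtinger T f a b" using assms by blast
  then show "isCont a z" "isCont b z" unfolding wirtinger_def by (auto simp: continuous_on_eq_continuous_at)
  show "(f has_derivative (\<lambda>h. a z * h + b z * cnj h)) (at z)" using T wirtinger_has_derivative by blast
qed

lemma wirtinger_const: "wirtinger S (\<lambda>_. c) (\<lambda>_. 0) (\<lambda>_. 0)"
  by (simp add: wirtinger_def)

lemma wirtinger_holomorphic:
  assumes "f holomorphic_on S" "open S" shows "wirtinger S f (deriv f) (\<lambda>_. 0)"
  unfolding wirtinger_def
  using holomorphic_derivI[OF assms] holomorphic_on_imp_continuous_on[OF holomorphic_deriv[OF assms]]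
  by (simp add: has_field_derivative_def)

lemma wirtinger_add:
  assumes "wirtinger S f a b" "wirtinger S g c d"
  shows "wirtinger S (\<lambda>z. f z + g z) (\<lambda>z. a z + c z) (\<lambda>z. b z + d z)"
  unfolding wirtinger_def
proof (intro conjI ballI)
  fix z assume z: "z \<in> S"
  show "((\<lambda>z. f z + g z) has_derivative (\<lambda>h. (a z + c z) * h + (b z + d z) * cnj h)) (at z)"
    using has_derivative_add[OF assms[THEN wirtinger_has_derivative, OF z]] by (simp add: algebra_simps)
qed (use assms in \<open>auto simp: wirtinger_def intro: continuous_on_add\<close>)

lemma wirtinger_sum:
  assumes "\<And>i. i \<in> I \<Longrightarrow> wirtinger S (f i) (a i) (b i)"
  shows "wirtinger S (\<lambda>z. \<Sum>i\<in>I. f i z) (\<lambda>z. \<Sum>i\<in>I. a i z) (\<lambda>z. \<Sum>i\<in>I. b i z)"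
  using assms
  by (induction I rule: infinite_finite_induct) (auto intro: wirtinger_const wirtinger_add)

lemma wirtinger_mult:
  assumes "wirtinger S f a b" "wirtinger S g c d"
  shows "wirtinger S (\<lambda>z. f z * g z) (\<lambda>z. a z * g z + f z * c z) (\<lambda>z. b z * g z + f z * d z)"
  unfolding wirtinger_def
proof (intro conjI ballI)
  fix z assume z: "z \<in> S"
  show "((\<lambda>z. f z * g z) has_derivative (\<lambda>h. (a z * g z + f z * c z) * h + (b z * g z + f z * d z) * cnj h)) (at z)"
    using has_derivative_mult[OF assms[THEN wirtinger_has_derivative, OF z]] by (simp add: algebra_simps)
qed (use assms wirtinger_continuous[OF assms(1)] wirtinger_continuous[OF assms(2)] in
    \<open>auto simp: wirtinger_def intro!: continuous_intros\<close>)

lemma wirtinger_uminus: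
  assumes "wirtinger S f a b" shows "wirtinger S (\<lambda>z. - f z) (\<lambda>z. - a z) (\<lambda>z. - b z)"
  using wirtinger_mult[OF wirtinger_const[of S "-1"] assms] by simp

lemma wirtinger_cnj:
  assumes "wirtinger S f a b"
  shows "wirtinger S (\<lambda>z. cnj (f z)) (\<lambda>z. cnj (b z)) (\<lambda>z. cnj (a z))"
  unfolding wirtinger_def
proof (intro conjI ballI)
  fix z assume z: "z \<in> S"
  show "((\<lambda>z. cnj (f z)) has_derivative (\<lambda>h. cnj (b z) * h + cnj (a z) * cnj h)) (at z)"
    using has_derivative_cnj[OF wirtinger_has_derivative[OF assms z]] by (simp add: algebra_simps)
qed (use assms in \<open>auto simp: wirtinger_def intro!: continuous_intros\<close>)

lemma wirtinger_inverse:
  assumes "wirtinger S f a b" "\<And>z. z \<in> S \<Longrightarrow> f z \<noteq> 0"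
  shows "wirtinger S (\<lambda>z. inverse (f z)) (\<lambda>z. - a z * (inverse (f z) * inverse (f z))) (\<lambda>z. - b z * (inverse (f z) * inverse (f z)))"
  unfolding wirtinger_def
proof (intro conjI ballI)
  fix z assume z: "z \<in> S"
  show "((\<lambda>z. inverse (f z)) has_derivative (\<lambda>h. - a z * (inverse (f z) * inverse (f z)) * h + - b z * (inverse (f z) * inverse (f z)) * cnj h)) (at z)"
    using Deriv.has_derivative_inverse[OF assms(2)[OF z] wirtinger_has_derivative[OF assms(1) z]]
    by (simp add: algebra_simps)
qed (use assms wirtinger_continuous[OF assms(1)] in \<open>auto simp: wirtinger_def intro!: continuous_intros\<close>)

lemma wirtinger_compose:
  assumes "wirtinger S f a b" "\<tau> holomorphic_on T" "open T" "\<tau> ` T \<subseteq> S"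
  shows "wirtinger T (\<lambda>z. f (\<tau> z)) (\<lambda>z. a (\<tau> z) * deriv \<tau> z) (\<lambda>z. b (\<tau> z) * cnj (deriv \<tau> z))"
  unfolding wirtinger_def
proof (intro conjI ballI)
  fix z assume z: "z \<in> T"
  have "(\<tau> has_derivative (*) (deriv \<tau> z)) (at z)"
    using holomorphic_derivI[OF assms(2,3) z] by (simp add: has_field_derivative_def)
  moreover have "(f has_derivative (\<lambda>h. a (\<tau> z) * h + b (\<tau> z) * cnj h)) (at (\<tau> z))"
    using wirtinger_has_derivative[OF assms(1)] assms(4) z by blast
  ultimately have "(f \<circ> \<tau> has_derivative (\<lambda>h. a (\<tau> z) * h + b (\<tau> z) * cnj h) \<circ> (*) (deriv \<tau> z)) (at z)"
    by (rule diff_chain_at)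
  then show "((\<lambda>z. f (\<tau> z)) has_derivative (\<lambda>h. a (\<tau> z) * deriv \<tau> z * h + b (\<tau> z) * cnj (deriv \<tau> z) * cnj h)) (at z)"
    by (simp add: o_def algebra_simps)
next
  have "continuous_on T \<tau>" "continuous_on T (deriv \<tau>)"
    using assms holomorphic_on_imp_continuous_on holomorphic_deriv by blast+
  moreover have "continuous_on S a" "continuous_on S b" using assms(1) by (auto simp: wirtinger_def)
  ultimately show "continuous_on T (\<lambda>z. a (\<tau> z) * deriv \<tau> z)" "continuous_on T (\<lambda>z. b (\<tau> z) * cnj (deriv \<tau> z))"
    using assms(4) by (auto intro!: continuous_intros intro: continuous_on_compose2)
qed

text \<open>
  The two mixed second derivatives are required to be the same function \<open>c\<close>. This is the identity
  \<open>d(df) = 0\<close>, which is all that is used of second derivatives; building it into the definition replaces a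
  proof of Schwarz's theorem by the observation that the operations below preserve it.
\<close>

definition C2_on :: "complex set \<Rightarrow> (complex \<Rightarrow> complex) \<Rightarrow> bool" where
  "C2_on S f \<longleftrightarrow> (\<exists>a b p c q. wirtinger S f a b \<and> wirtinger S a p c \<and> wirtinger S b c q)"

lemma C2_on_transform: "C2_on S f \<Longrightarrow> open S \<Longrightarrow> (\<And>z. z \<in> S \<Longrightarrow> f z = g z) \<Longrightarrow> C2_on S g"
  unfolding C2_on_def using wirtinger_transform by blast

lemma C2_on_subset: "C2_on S f \<Longrightarrow> T \<subseteq> S \<Longrightarrow> C2_on T f"
  unfolding C2_on_def using wirtinger_subset by meson

text \<open>
  The derivatives on \<open>S\<close> and on \<open>T\<close> coincide on \<open>S \<inter> T\<close> by uniqueness, so they can be patched together.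
\<close>

lemma C2_on_Un:
  assumes "C2_on S f" "C2_on T f" "open S" "open T" shows "C2_on (S \<union> T) f"
proof -
  obtain a b p c q where S: "wirtinger S f a b" "wirtinger S a p c" "wirtinger S b c q"
    using assms unfolding C2_on_def by blast
  obtain a' b' p' c' q' where T: "wirtinger T f a' b'" "wirtinger T a' p' c'" "wirtinger T b' c' q'"
    using assms unfolding C2_on_def by blast
  define mix where "mix u u' = (\<lambda>z. if z \<in> S then u z else u' z)" for u u' :: "complex \<Rightarrow> complex"
  have int: "wirtinger (S \<inter> T) u v w" if "wirtinger S u v w \<or> wirtinger T u v w" for u v w
    using that wirtinger_subset by blast
  note ab = wirtinger_unique[OF int int, of f a b a' b']
  have a: "a z = a' z" and b: "b z = b' z" if "z \<in> S \<inter> T" for z using ab S T that by auto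
  have S2: "wirtinger (S \<inter> T) a' p c" "wirtinger (S \<inter> T) b' c q"
    using wirtinger_transform[OF int[of a p c]] wirtinger_transform[OF int[of b c q]] a b S assms(3,4) by auto
  have "p z = p' z" "c z = c' z" "q z = q' z" if "z \<in> S \<inter> T" for z
    using wirtinger_unique[OF S2(1) int[of a' p' c']] wirtinger_unique[OF S2(2) int[of b' c' q']] T that by auto
  note eq = a b this
  have glue: "wirtinger (S \<union> T) (mix u u') (mix v v') (mix w w')"
    if "wirtinger S u v w" "wirtinger T u' v' w'" "\<And>z. z \<in> S \<inter> T \<Longrightarrow> u z = u' z \<and> v z = v' z \<and> w z = w' z" for u u' v v' w w'
  proof (rule wirtinger_Union)
    fix z assume z: "z \<in> S \<union> T"
    have "wirtinger S (mix u u') (mix v v') (mix w w')"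
      by (rule wirtinger_eqI[OF wirtinger_transform[OF that(1) assms(3)]]) (auto simp: mix_def)
    moreover have "wirtinger T (mix u u') (mix v v') (mix w w')"
      by (rule wirtinger_eqI[OF wirtinger_transform[OF that(2) assms(4)]]) (use that(3) in \<open>auto simp: mix_def\<close>)
    ultimately show "\<exists>T. open T \<and> z \<in> T \<and> wirtinger T (mix u u') (mix v v') (mix w w')"
      using z assms(3,4) by blast
  qed
  have "wirtinger (S \<union> T) (mix f f) (mix a a') (mix b b')" "wirtinger (S \<union> T) (mix a a') (mix p p') (mix c c')"
    "wirtinger (S \<union> T) (mix b b') (mix c c') (mix q q')"
    by (rule glue; use S T eq in auto)+
  moreover have "mix f f = f" by (simp add: mix_def)
  ultimately show ?thesis unfolding C2_on_def by metis
qed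

lemma C2_on_const: "C2_on S (\<lambda>_. c)"
  unfolding C2_on_def using wirtinger_const by blast

lemma C2_on_holomorphic: "f holomorphic_on S \<Longrightarrow> open S \<Longrightarrow> C2_on S f"
  unfolding C2_on_def using wirtinger_holomorphic wirtinger_const holomorphic_deriv by blast

lemma C2_on_add:
  assumes "C2_on S f" "C2_on S g" shows "C2_on S (\<lambda>z. f z + g z)"
  using assms unfolding C2_on_def by (elim exE conjE) (intro exI conjI; (rule wirtinger_add; assumption))

lemma C2_on_sum: "(\<And>i. i \<in> I \<Longrightarrow> C2_on S (f i)) \<Longrightarrow> C2_on S (\<lambda>z. \<Sum>i\<in>I. f i z)"
  by (induction I rule: infinite_finite_induct) (auto intro: C2_on_const C2_on_add)

lemma C2_on_mult:
  assumes "C2_on S f" "C2_on S g" shows "C2_on S (\<lambda>z. f z * g z)"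
proof -
  obtain a b p c q where f: "wirtinger S f a b" "wirtinger S a p c" "wirtinger S b c q"
    using assms unfolding C2_on_def by blast
  obtain a' b' p' c' q' where g: "wirtinger S g a' b'" "wirtinger S a' p' c'" "wirtinger S b' c' q'"
    using assms unfolding C2_on_def by blast
  have "wirtinger S (\<lambda>z. b z * g z + f z * b' z) (\<lambda>z. (c z * g z + a z * b' z) + (b z * a' z + f z * c' z))
     (\<lambda>z. (q z * g z + b z * b' z) + (b z * b' z + f z * q' z))"
    by (rule wirtinger_eqI[OF wirtinger_add[OF wirtinger_mult[OF f(3) g(1)] wirtinger_mult[OF f(1) g(3)]]]) simp_all
  then show ?thesis
    unfolding C2_on_def
    using wirtinger_mult[OF f(1) g(1)] wirtinger_add[OF wirtinger_mult[OF f(2) g(1)] wirtinger_mult[OF f(1) g(2)]]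
    by (intro exI conjI) (assumption, assumption, rule wirtinger_eqI, assumption, simp_all)
qed

lemma C2_on_inverse:
  assumes "C2_on S f" "\<And>z. z \<in> S \<Longrightarrow> f z \<noteq> 0" shows "C2_on S (\<lambda>z. inverse (f z))"
proof -
  obtain a b p c q where f: "wirtinger S f a b" "wirtinger S a p c" "wirtinger S b c q"
    using assms unfolding C2_on_def by blast
  note i = wirtinger_inverse[OF f(1) assms(2)]
  note a = wirtinger_mult[OF wirtinger_uminus[OF f(2)] wirtinger_mult[OF i i]]
  note b = wirtinger_mult[OF wirtinger_uminus[OF f(3)] wirtinger_mult[OF i i]]
  have "wirtinger S (\<lambda>z. - b z * (inverse (f z) * inverse (f z)))
     (\<lambda>z. - c z * (inverse (f z) * inverse (f z)) +
        - a z * (- b z * (inverse (f z) * inverse (f z)) * inverse (f z) + inverse (f z) * (- b z * (inverse (f z) * inverse (f z)))))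
     (\<lambda>z. - q z * (inverse (f z) * inverse (f z)) +
        - b z * (- b z * (inverse (f z) * inverse (f z)) * inverse (f z) + inverse (f z) * (- b z * (inverse (f z) * inverse (f z)))))"
    by (rule wirtinger_eqI[OF b]) simp_all
  then show ?thesis unfolding C2_on_def using i a by blast
qed

lemma C2_on_compose:
  assumes "C2_on S f" "\<tau> holomorphic_on T" "open T" "\<tau> ` T \<subseteq> S"
  shows "C2_on T (\<lambda>z. f (\<tau> z))"
proof -
  obtain a b p c q where f: "wirtinger S f a b" "wirtinger S a p c" "wirtinger S b c q"
    using assms unfolding C2_on_def by blast
  note d = wirtinger_holomorphic[OF holomorphic_deriv[OF assms(2,3)] assms(3)]
  note c = f[THEN wirtinger_compose, OF assms(2-4)]
  show ?thesis
    unfolding C2_on_def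
    using c(1) wirtinger_mult[OF c(2) d] wirtinger_mult[OF c(3) wirtinger_cnj[OF d]]
    by (intro exI conjI) (assumption, assumption, rule wirtinger_eqI, assumption, simp_all)
qed

section \<open>Integrals of derivatives of compactly supported functions\<close>

text \<open>
  The difference quotients of \<open>F\<close> in direction \<open>v\<close> have integral zero because Lebesgue measure is translation
  invariant. They converge to the derivative, and they are dominated, as \<open>F\<close> is Lipschitz with compact support.
\<close>

lemma integral_directional_derivative_eq_0:
  assumes F: "wirtinger UNIV F a b" and K: "compact K" "\<And>z. z \<notin> K \<Longrightarrow> F z = 0"
  shows "integrable lborel (\<lambda>z. a z * v + b z * cnj v) \<and> (\<integral>z. a z * v + b z * cnj v \<partial>lborel) = 0"
proof -
  let ?D = "\<lambda>z. a z * v + b z * cnj v"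
  have cont: "continuous_on UNIV F" "continuous_on UNIV a" "continuous_on UNIV b"
    using F wirtinger_continuous[OF F] by (auto simp: wirtinger_def)
  have zero: "a z = 0 \<and> b z = 0" if "z \<notin> K" for z
  proof -
    have "wirtinger (-K) F a b" "wirtinger (-K) F (\<lambda>_. 0) (\<lambda>_. 0)"
      using wirtinger_subset[OF F] wirtinger_transform[OF wirtinger_const[of "-K" 0], of F] K compact_imp_closed by auto
    from wirtinger_unique[OF this] that show ?thesis by auto
  qed
  obtain M where M: "\<And>z. norm (a z) + norm (b z) \<le> M" "M \<ge> 0"
  proof -
    have im: "compact ((\<lambda>z. norm (a z) + norm (b z)) ` K)"
      by (intro compact_continuous_image[OF _ K(1)] continuous_on_add continuous_on_norm
          continuous_on_subset[OF cont(2) subset_UNIV] continuous_on_subset[OF cont(3) subset_UNIV])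
    obtain B where "\<forall>x\<in>(\<lambda>z. norm (a z) + norm (b z)) ` K. norm x \<le> B"
      using compact_imp_bounded[OF im, unfolded bounded_iff] by auto
    then have B: "\<And>z. z \<in> K \<Longrightarrow> norm (norm (a z) + norm (b z)) \<le> B" by blast
    have "norm (a z) + norm (b z) \<le> max B 0" for z
      using B[of z] zero[of z] by (cases "z \<in> K") auto
    then show ?thesis using that[of "max B 0"] by simp
  qed
  have lip: "norm (F x - F y) \<le> M * norm (x - y)" for x y
  proof (rule differentiable_bound[of UNIV])
    show "(F has_derivative (\<lambda>h. a z * h + b z * cnj h)) (at z within UNIV)" for z
      using wirtinger_has_derivative[OF F] by simp
    show "onorm (\<lambda>h. a z * h + b z * cnj h) \<le> M" for z
    proof (rule onorm_le)
      fix h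
      have "norm (a z * h + b z * cnj h) \<le> (norm (a z) + norm (b z)) * norm h"
        by (rule order_trans[OF norm_triangle_ineq]) (simp add: norm_mult algebra_simps)
      also have "\<dots> \<le> M * norm h" using M by (simp add: mult_right_mono)
      finally show "norm (a z * h + b z * cnj h) \<le> M * norm h" .
    qed
  qed auto
  obtain R where R: "\<And>z. z \<in> K \<Longrightarrow> norm z \<le> R" using compact_imp_bounded[OF K(1)] bounded_iff by metis
  \<comment> \<open>the difference quotients\<close>
  define s where "s n z = real (Suc n) *\<^sub>R (F (z + v / of_nat (Suc n)) - F z)" for n z
  let ?w = "\<lambda>z. M * norm v * indicator (cball (0::complex) (R + norm v)) z"
  have Fint: "integrable lborel F"
  proof -
    have "integrable lborel (\<lambda>z. indicator K z *\<^sub>R F z)"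
      using borel_integrable_compact[OF K(1) continuous_on_subset[OF cont(1)]] by auto
    moreover have "(\<lambda>z. indicator K z *\<^sub>R F z) = F" using K(2) by (auto simp: fun_eq_iff indicator_def)
    ultimately show ?thesis by simp
  qed
  have shift: "integrable lborel (\<lambda>z. F (z + c)) \<and> (\<integral>z. F (z + c) \<partial>lborel) = integral\<^sup>L lborel F" for c
  proof -
    have "integrable (distr lborel borel ((+) c)) F" using Fint by (simp add: lborel_distr_plus)
    then have 1: "integrable lborel (\<lambda>z. F (c + z))" by (subst (asm) integrable_distr_eq) (use Fint in auto)
    have "(\<integral>z. F (c + z) \<partial>lborel) = integral\<^sup>L (distr lborel borel ((+) c)) F"
      using Fint by (subst integral_distr) auto
    with 1 show ?thesis by (simp add: lborel_distr_plus add.commute)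
  qed
  have s: "integrable lborel (s n) \<and> integral\<^sup>L lborel (s n) = 0" for n
    unfolding s_def using shift[of "v / of_nat (Suc n)"] Fint by simp
  have lim: "(\<lambda>n. s n z) \<longlonglongrightarrow> ?D z" for z
  proof (cases "v = 0")
    case False
    let ?L = "\<lambda>h. a z * h + b z * cnj h"
    have "(F has_derivative ?L) (at z)" using wirtinger_has_derivative[OF F] by simp
    then have "((\<lambda>y. ((F y - F z) - ?L (y - z)) /\<^sub>R norm (y - z)) \<longlongrightarrow> 0) (at z)"
      by (simp add: has_derivative_at_within)
    moreover have "filterlim (\<lambda>n. z + v / of_nat (Suc n)) (at z) sequentially"
    proof (rule filterlim_atI)
      have "(\<lambda>n. z + v * of_real (inverse (real (Suc n)))) \<longlonglongrightarrow> z + v * of_real 0"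
        by (intro tendsto_intros LIMSEQ_inverse_real_of_nat)
      then show "(\<lambda>n. z + v / of_nat (Suc n)) \<longlonglongrightarrow> z" by (simp add: divide_inverse)
    qed (use False in \<open>simp del: of_nat_Suc\<close>)
    ultimately have "(\<lambda>n. ((F (z + v / of_nat (Suc n)) - F z) - ?L (v / of_nat (Suc n))) /\<^sub>R norm (v / of_nat (Suc n))) \<longlonglongrightarrow> 0"
      using filterlim_compose by fastforce
    then have "(\<lambda>n. norm v *\<^sub>R (((F (z + v / of_nat (Suc n)) - F z) - ?L (v / of_nat (Suc n))) /\<^sub>R norm (v / of_nat (Suc n)))) \<longlonglongrightarrow> norm v *\<^sub>R 0"
      by (intro tendsto_intros)
    moreover have "norm v *\<^sub>R (((F (z + v / of_nat (Suc n)) - F z) - ?L (v / of_nat (Suc n))) /\<^sub>R norm (v / of_nat (Suc n))) = s n z - ?D z" for n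
    proof -
      have "norm v / norm (v / of_nat (Suc n)) = real (Suc n)" using False by (simp add: norm_divide del: of_nat_Suc)
      then have "norm v *\<^sub>R (x /\<^sub>R norm (v / of_nat (Suc n))) = real (Suc n) *\<^sub>R x" for x :: complex
        by (simp add: divide_inverse del: of_nat_Suc)
      moreover have "real (Suc n) *\<^sub>R ?L (v / of_nat (Suc n)) = ?D z"
        by (simp add: scaleR_conv_of_real field_simps del: of_nat_Suc)
      ultimately show ?thesis unfolding s_def scaleR_diff_right by (simp only:)
    qed
    ultimately have "(\<lambda>n. s n z - ?D z) \<longlonglongrightarrow> 0" by simp
    then show ?thesis by (rule LIM_zero_cancel)
  qed (simp add: s_def)
  have bound: "norm (s n z) \<le> ?w z" for n z
  proof (cases "z \<in> cball 0 (R + norm v)")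
    case True
    have "norm (s n z) = real (Suc n) * norm (F (z + v / of_nat (Suc n)) - F z)" by (simp add: s_def del: of_nat_Suc)
    also have "\<dots> \<le> real (Suc n) * (M * norm (v / of_nat (Suc n)))"
      using lip[of "z + v / of_nat (Suc n)" z] by (intro mult_left_mono) auto
    also have "\<dots> = M * norm v" by (simp add: norm_divide del: of_nat_Suc)
    finally show ?thesis using True by simp
  next
    case False
    then have "norm z > R + norm v" by simp
    moreover have "norm (v / of_nat (Suc n)) \<le> norm v"
      by (simp add: norm_divide divide_le_eq mult_le_cancel_left1 del: of_nat_Suc) 
    moreover have "norm z \<le> norm (z + v / of_nat (Suc n)) + norm (v / of_nat (Suc n))"
      using norm_triangle_ineq4[of "z + v / of_nat (Suc n)" "v / of_nat (Suc n)"] by simp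
    ultimately have "norm z > R" "norm (z + v / of_nat (Suc n)) > R" using norm_ge_zero[of v] by linarith+
    then have "z \<notin> K" "z + v / of_nat (Suc n) \<notin> K" using R by force+
    then show ?thesis using K(2) False by (simp add: s_def)
  qed
  have w: "integrable lborel ?w"
    by (intro integrable_mult_right integrable_real_indicator) (auto intro: emeasure_compact_finite[OF compact_cball, unfolded infinity_ennreal_def])
  have D: "?D \<in> borel_measurable lborel"
    using cont by (auto intro!: borel_measurable_continuous_onI continuous_intros)
  note dom = D borel_measurable_integrable[OF conjunct1[OF s]] w AE_I2[OF lim] AE_I2[OF bound]
  have "integrable lborel ?D" using integrable_dominated_convergence[OF dom] .
  moreover have "(\<lambda>n. integral\<^sup>L lborel (s n)) \<longlonglongrightarrow> integral\<^sup>L lborel ?D" using integral_dominated_convergence[OF dom] .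
  ultimately show ?thesis using s by (auto dest: LIMSEQ_unique[OF tendsto_const])
qed

text \<open>
  The directions \<open>1\<close> and \<open>\<i>\<close> yield \<open>a + b\<close> and \<open>\<i>(a - b)\<close>.
\<close>

lemma integral_wirtinger_eq_0:
  assumes F: "wirtinger UNIV F a b" and K: "compact K" "\<And>z. z \<notin> K \<Longrightarrow> F z = 0"
  shows "integrable lborel a" "integrable lborel b" "integral\<^sup>L lborel a = 0" "integral\<^sup>L lborel b = 0"
proof -
  have 1: "integrable lborel (\<lambda>z. a z + b z)" "(\<integral>z. a z + b z \<partial>lborel) = 0"
    using integral_directional_derivative_eq_0[OF F K(1), of 1] K(2) by simp_all
  have i: "integrable lborel (\<lambda>z. a z * \<i> + b z * cnj \<i>) \<and> (\<integral>z. a z * \<i> + b z * cnj \<i> \<partial>lborel) = 0"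
    by (rule integral_directional_derivative_eq_0[OF F K(1)]) (rule K(2))
  have "integrable lborel (\<lambda>z. - \<i> * (a z * \<i> + b z * cnj \<i>))" "(\<integral>z. - \<i> * (a z * \<i> + b z * cnj \<i>) \<partial>lborel) = 0"
    using integrable_mult_right[OF conjunct1[OF i], of "- \<i>"] conjunct2[OF i]
    by (simp_all only: integral_mult_right_zero mult_zero_right simp_thms)
  moreover have eq: "(\<lambda>z. - \<i> * (a z * \<i> + b z * cnj \<i>)) = (\<lambda>z. a z - b z)" by (auto simp: algebra_simps)
  ultimately have 2: "integrable lborel (\<lambda>z. a z - b z)" "(\<integral>z. a z - b z \<partial>lborel) = 0" unfolding eq by simp_all
  have "a = (\<lambda>z. (1/2) * ((a z + b z) + (a z - b z)))" "b = (\<lambda>z. (1/2) * ((a z + b z) - (a z - b z)))" by auto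
  then show "integrable lborel a" "integrable lborel b"
    using integrable_mult_right[OF Bochner_Integration.integrable_add[OF 1(1) 2(1)], of "1/2"]
      integrable_mult_right[OF Bochner_Integration.integrable_diff[OF 1(1) 2(1)], of "1/2"] by auto
  then show "integral\<^sup>L lborel a = 0" "integral\<^sup>L lborel b = 0" using 1(2) 2(2) by simp_all
qed

section \<open>Charts\<close>

lemma chart_inv:
  assumes "complex_atlas X A" "(U, z) \<in> A"
  shows "openin (top_of_set X) U" "open (z ` U)" "continuous_on U z" "continuous_on (z ` U) (inv_into U z)"
    "x \<in> U \<Longrightarrow> inv_into U z (z x) = x" "\<zeta> \<in> z ` U \<Longrightarrow> z (inv_into U z \<zeta>) = \<zeta>" "\<zeta> \<in> z ` U \<Longrightarrow> inv_into U z \<zeta> \<in> U"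
    "U \<subseteq> X"
proof -
  have h: "openin (top_of_set X) U \<and> open (z ` U) \<and> homeomorphism U (z ` U) z (inv_into U z)"
    using assms unfolding complex_atlas_def by fast
  then show o: "openin (top_of_set X) U" and "open (z ` U)" "continuous_on U z" "continuous_on (z ` U) (inv_into U z)"
    "x \<in> U \<Longrightarrow> inv_into U z (z x) = x" "\<zeta> \<in> z ` U \<Longrightarrow> z (inv_into U z \<zeta>) = \<zeta>" "\<zeta> \<in> z ` U \<Longrightarrow> inv_into U z \<zeta> \<in> U"
    by (auto simp: homeomorphism_def)
  show "U \<subseteq> X" using openin_subset[OF o] by simp
qed

lemma chart_inj: "complex_atlas X A \<Longrightarrow> (U, z) \<in> A \<Longrightarrow> inj_on z U"
  using chart_inv(5) inj_on_inverseI by metis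

lemma chart_exists: "complex_atlas X A \<Longrightarrow> x \<in> X \<Longrightarrow> \<exists>U z. (U, z) \<in> A \<and> x \<in> U"
  unfolding complex_atlas_def by blast

lemma chart_open_image:
  assumes "complex_atlas X A" "(U, z) \<in> A" "openin (top_of_set X) W" "W \<subseteq> U"
  shows "open (z ` W)"
proof -
  note c = chart_inv[OF assms(1,2)]
  obtain W' where W': "open W'" "W = X \<inter> W'" using assms(3) by (auto simp: openin_open)
  have "z ` W = z ` U \<inter> inv_into U z -` W'"
  proof
    show "z ` W \<subseteq> z ` U \<inter> inv_into U z -` W'" using W' assms(4) c(5) by auto
    show "z ` U \<inter> inv_into U z -` W' \<subseteq> z ` W"
    proof
      fix \<zeta> assume \<zeta>: "\<zeta> \<in> z ` U \<inter> inv_into U z -` W'"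
      then have "inv_into U z \<zeta> \<in> W" using W' c(7,8) by auto
      then show "\<zeta> \<in> z ` W" using c(6) \<zeta> by (metis IntD1 imageI)
    qed
  qed
  moreover have "open (z ` U \<inter> inv_into U z -` W')"
    using continuous_open_preimage[OF c(4,2) W'(1)] .
  ultimately show ?thesis by simp
qed

lemma chart_transition:
  assumes A: "complex_atlas X A" and U: "(U, z) \<in> A" and V: "(V, w) \<in> A"
  shows "open (z ` (U \<inter> V))" "(w \<circ> inv_into U z) holomorphic_on z ` (U \<inter> V)"
    "(w \<circ> inv_into U z) ` (z ` (U \<inter> V)) = w ` (U \<inter> V)" "inj_on (w \<circ> inv_into U z) (z ` (U \<inter> V))"
proof -
  have "openin (top_of_set X) (U \<inter> V)"
    using chart_inv(1)[OF A U] chart_inv(1)[OF A V] by (rule openin_Int)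
  then show "open (z ` (U \<inter> V))" by (rule chart_open_image[OF A U]) simp
  show "(w \<circ> inv_into U z) holomorphic_on z ` (U \<inter> V)"
    using A U V unfolding complex_atlas_def by fast
  have i: "inv_into U z (z x) = x" if "x \<in> U \<inter> V" for x using chart_inv(5)[OF A U] that by auto
  then show "(w \<circ> inv_into U z) ` (z ` (U \<inter> V)) = w ` (U \<inter> V)" by (auto simp: image_image)
  show "inj_on (w \<circ> inv_into U z) (z ` (U \<inter> V))"
  proof (rule inj_onI)
    fix \<xi> \<eta> assume *: "\<xi> \<in> z ` (U \<inter> V)" "\<eta> \<in> z ` (U \<inter> V)" "(w \<circ> inv_into U z) \<xi> = (w \<circ> inv_into U z) \<eta>"
    then obtain x y where xy: "x \<in> U \<inter> V" "y \<in> U \<inter> V" "\<xi> = z x" "\<eta> = z y" by blast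
    then have "w x = w y" using *(3) i by simp
    then show "\<xi> = \<eta>" using inj_onD[OF chart_inj[OF A V], of x y] xy by auto
  qed
qed

section \<open>Partitions of unity\<close>

lemma has_derivative_max_power:
  "((\<lambda>t::real. max 0 t ^ Suc (Suc n)) has_real_derivative real (Suc (Suc n)) * max 0 t ^ Suc n) (at t)"
proof -
  consider "t > 0" | "t < 0" | "t = 0" by linarith
  then show ?thesis
  proof cases
    case 1
    have "((\<lambda>t::real. t ^ Suc (Suc n)) has_real_derivative real (Suc (Suc n)) * t ^ Suc n) (at t)"
      using DERIV_pow[of "Suc (Suc n)" t] by simp
    then show ?thesis
      using 1 by (subst DERIV_cong_ev[OF refl eventually_mono[OF eventually_nhds_in_open[of "{0<..}" t]] refl]) auto
  next
    case 2
    have "((\<lambda>t::real. 0) has_real_derivative 0) (at t)" by simp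
    then show ?thesis
      using 2 by (subst DERIV_cong_ev[OF refl eventually_mono[OF eventually_nhds_in_open[of "{..<0}" t]] refl, where g="\<lambda>_. 0"]) auto
  next
    case 3
    have "(\<lambda>h. max 0 h ^ Suc (Suc n) / h) = (\<lambda>h::real. max 0 h ^ Suc n)" by (auto simp: fun_eq_iff max_def)
    moreover have "((\<lambda>h::real. max 0 h ^ Suc n) \<longlongrightarrow> max 0 0 ^ Suc n) (at 0)" by (intro tendsto_intros)
    ultimately show ?thesis using 3 by (simp add: DERIV_def)
  qed
qed

text \<open>
  For exponents of at least 2 the truncation at 0 is continuously differentiable, and differentiation lowers the exponent by one.
\<close>

lemma wirtinger_bump:
  fixes c :: complex and r :: real
  defines "P \<equiv> \<lambda>m \<zeta>. max 0 (r\<^sup>2 - (cmod (\<zeta> - c))\<^sup>2) ^ m"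
  shows "wirtinger UNIV (\<lambda>\<zeta>. of_real (P (Suc (Suc n)) \<zeta>))
    (\<lambda>\<zeta>. - of_nat (Suc (Suc n)) * of_real (P (Suc n) \<zeta>) * cnj (\<zeta> - c))
    (\<lambda>\<zeta>. - of_nat (Suc (Suc n)) * of_real (P (Suc n) \<zeta>) * (\<zeta> - c))"
  unfolding wirtinger_def
proof (intro conjI ballI)
  fix z
  have "((\<lambda>\<zeta>. r\<^sup>2 - ((Re \<zeta> - Re c)\<^sup>2 + (Im \<zeta> - Im c)\<^sup>2)) has_derivative
      (\<lambda>h. - (2 * (Re z - Re c) * Re h + 2 * (Im z - Im c) * Im h))) (at z)"
    by (auto intro!: derivative_eq_intros simp: algebra_simps)
  then have d: "((\<lambda>\<zeta>. r\<^sup>2 - (cmod (\<zeta> - c))\<^sup>2) has_derivative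
      (\<lambda>h. - (2 * (Re z - Re c) * Re h + 2 * (Im z - Im c) * Im h))) (at z)"
    by (simp add: cmod_power2)
  have "((\<lambda>\<zeta>. P (Suc (Suc n)) \<zeta>) has_derivative
      (\<lambda>h. (real (Suc (Suc n)) * P (Suc n) z) * (- (2 * (Re z - Re c) * Re h + 2 * (Im z - Im c) * Im h)))) (at z)"
    unfolding P_def
    using diff_chain_at[OF d has_derivative_max_power[unfolded has_field_derivative_def]] by (simp add: o_def)
  from bounded_linear.has_derivative[OF bounded_linear_of_real this]
  have "((\<lambda>\<zeta>. of_real (P (Suc (Suc n)) \<zeta>)) has_derivative
      (\<lambda>h. complex_of_real ((real (Suc (Suc n)) * P (Suc n) z) * (- (2 * (Re z - Re c) * Re h + 2 * (Im z - Im c) * Im h))))) (at z)" .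
  moreover have "complex_of_real ((real (Suc (Suc n)) * P (Suc n) z) * (- (2 * (Re z - Re c) * Re h + 2 * (Im z - Im c) * Im h)))
     = - of_nat (Suc (Suc n)) * of_real (P (Suc n) z) * cnj (z - c) * h + - of_nat (Suc (Suc n)) * of_real (P (Suc n) z) * (z - c) * cnj h" for h
    by (simp add: complex_eq_iff algebra_simps del: of_nat_Suc)
  ultimately show "((\<lambda>\<zeta>. of_real (P (Suc (Suc n)) \<zeta>)) has_derivative (\<lambda>h. - of_nat (Suc (Suc n)) * of_real (P (Suc n) z) * cnj (z - c) * h +
      - of_nat (Suc (Suc n)) * of_real (P (Suc n) z) * (z - c) * cnj h)) (at z)" by (simp only:)
qed (auto simp: P_def intro!: continuous_intros)

text \<open>
  The cube is the smallest power of the truncated function that is twice continuously differentiable. Bump functions of class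
  \<open>C\<^sup>2\<close> suffice for Stokes' theorem, and piecewise polynomial ones are the simplest.
\<close>

lemma C2_on_bump: "C2_on UNIV (\<lambda>\<zeta>. of_real (max 0 (r\<^sup>2 - (cmod (\<zeta> - c))\<^sup>2) ^ 3))"
proof -
  let ?P = "\<lambda>m \<zeta>. complex_of_real (max 0 (r\<^sup>2 - (cmod (\<zeta> - c))\<^sup>2) ^ m)"
  have id: "wirtinger UNIV (\<lambda>\<zeta>. \<zeta> - c) (\<lambda>_. 1) (\<lambda>_. 0)"
    by (rule wirtinger_eqI[OF wirtinger_holomorphic]) (auto intro!: holomorphic_intros)
  have cnj: "wirtinger UNIV (\<lambda>\<zeta>. cnj (\<zeta> - c)) (\<lambda>_. 0) (\<lambda>_. 1)"
    by (rule wirtinger_eqI[OF wirtinger_cnj[OF id]]) auto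
  have 1: "wirtinger UNIV (\<lambda>\<zeta>. ?P 3 \<zeta>) (\<lambda>\<zeta>. - 3 * ?P 2 \<zeta> * cnj (\<zeta> - c)) (\<lambda>\<zeta>. - 3 * ?P 2 \<zeta> * (\<zeta> - c))"
    using wirtinger_bump[of r c 1] by (simp add: numeral_3_eq_3 numeral_2_eq_2)
  have "wirtinger UNIV (\<lambda>\<zeta>. ?P 2 \<zeta>) (\<lambda>\<zeta>. - 2 * ?P 1 \<zeta> * cnj (\<zeta> - c)) (\<lambda>\<zeta>. - 2 * ?P 1 \<zeta> * (\<zeta> - c))"
    using wirtinger_bump[of r c 0] by (simp add: numeral_2_eq_2)
  note m = wirtinger_mult[OF wirtinger_const[of UNIV "-3"] this]
  have 2: "wirtinger UNIV (\<lambda>\<zeta>. - 3 * ?P 2 \<zeta> * cnj (\<zeta> - c)) (\<lambda>\<zeta>. 6 * ?P 1 \<zeta> * cnj (\<zeta> - c) * cnj (\<zeta> - c))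
      (\<lambda>\<zeta>. 6 * ?P 1 \<zeta> * (\<zeta> - c) * cnj (\<zeta> - c) - 3 * ?P 2 \<zeta>)"
    by (rule wirtinger_eqI[OF wirtinger_mult[OF m cnj]]) (simp_all add: algebra_simps)
  have 3: "wirtinger UNIV (\<lambda>\<zeta>. - 3 * ?P 2 \<zeta> * (\<zeta> - c)) (\<lambda>\<zeta>. 6 * ?P 1 \<zeta> * (\<zeta> - c) * cnj (\<zeta> - c) - 3 * ?P 2 \<zeta>)
      (\<lambda>\<zeta>. 6 * ?P 1 \<zeta> * (\<zeta> - c) * (\<zeta> - c))"
    by (rule wirtinger_eqI[OF wirtinger_mult[OF m id]]) (simp_all add: algebra_simps)
  show ?thesis unfolding C2_on_def using 1 2 3 by blast
qed

text \<open>
  The bump function of a disc in a chart is extended by zero. Smoothness in a second chart holds on the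
  image of the first chart by composition, and off the support trivially. These two sets are open and cover the second chart;
  the second one is open because the compact support is closed in the Hausdorff space \<open>X\<close>.
\<close>

lemma bump_function:
  fixes X :: "'a::t2_space set"
  assumes A: "complex_atlas X A" and x: "x \<in> X"
  obtains U z K and \<psi> :: "'a \<Rightarrow> real" and N where "(U, z) \<in> A" "compact K" "K \<subseteq> U" "\<And>y. y \<notin> K \<Longrightarrow> \<psi> y = 0" "\<And>y. 0 \<le> \<psi> y"
    "openin (top_of_set X) N" "x \<in> N" "\<And>y. y \<in> N \<Longrightarrow> \<psi> y > 0"
    "\<And>V w. (V, w) \<in> A \<Longrightarrow> C2_on (w ` V) (\<lambda>\<zeta>. of_real (\<psi> (inv_into V w \<zeta>)))"
proof -
  obtain U z where U: "(U, z) \<in> A" "x \<in> U" using chart_exists[OF A x] by blast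
  note c = chart_inv[OF A U(1)]
  obtain r where r: "r > 0" "cball (z x) r \<subseteq> z ` U" using c(2) U(2) open_contains_cball by (metis imageI)
  define K where "K = inv_into U z ` cball (z x) r"
  define b where "b \<zeta> = max 0 (r\<^sup>2 - (cmod (\<zeta> - z x))\<^sup>2) ^ 3" for \<zeta>
  define \<psi> where "\<psi> y = (if y \<in> U then b (z y) else 0)" for y
  have K: "compact K" "K \<subseteq> U"
    unfolding K_def using compact_continuous_image[OF continuous_on_subset[OF c(4) r(2)]] r(2) c(7) by auto
  have b0: "b \<zeta> = 0" if "\<zeta> \<notin> cball (z x) r" for \<zeta>
  proof -
    have "r \<le> cmod (\<zeta> - z x)" using that by (simp add: dist_norm norm_minus_commute)
    then have "r\<^sup>2 \<le> (cmod (\<zeta> - z x))\<^sup>2" using r(1) by (intro power_mono) auto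
    then show ?thesis by (simp add: b_def)
  qed
  have \<psi>0: "\<psi> y = 0" if "y \<notin> K" for y
  proof (cases "y \<in> U")
    case True
    then have "z y \<notin> cball (z x) r" using that c(5) unfolding K_def by (metis imageI)
    then show ?thesis using b0 by (simp add: \<psi>_def)
  qed (simp add: \<psi>_def)
  show thesis
  proof (rule that[OF U(1) K \<psi>0])
    show "0 \<le> \<psi> y" for y by (simp add: \<psi>_def b_def)
    have "openin (top_of_set U) (U \<inter> z -` ball (z x) r)"
      using continuous_openin_preimage_gen[OF c(3)] by simp
    then show "openin (top_of_set X) (U \<inter> z -` ball (z x) r)"
      using c(1) openin_trans by blast
    show "x \<in> U \<inter> z -` ball (z x) r" using U r by simp
    show "\<psi> y > 0" if "y \<in> U \<inter> z -` ball (z x) r" for y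
    proof -
      have "cmod (z y - z x) < r" using that by (simp add: dist_norm norm_minus_commute)
      then have "(cmod (z y - z x))\<^sup>2 < r\<^sup>2" by (intro power_strict_mono) auto
      then show ?thesis using that by (simp add: \<psi>_def b_def)
    qed
    fix V w assume V: "(V, w) \<in> A"
    note d = chart_inv[OF A V]
    have "C2_on (w ` (V \<inter> U)) (\<lambda>\<zeta>. of_real (b ((z \<circ> inv_into V w) \<zeta>)))"
      unfolding b_def
      by (rule C2_on_compose[OF C2_on_bump chart_transition(2,1)[OF A V U(1)]]) simp
    then have 1: "C2_on (w ` (V \<inter> U)) (\<lambda>\<zeta>. of_real (\<psi> (inv_into V w \<zeta>)))"
      by (rule C2_on_transform[OF _ chart_transition(1)[OF A V U(1)]]) (use d(5) in \<open>auto simp: \<psi>_def\<close>)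
    have "openin (top_of_set X) (V - K)"
      using openin_diff[OF d(1) closed_subset[OF _ compact_imp_closed[OF K(1)]]] K(2) c(8) by simp
    then have o: "open (w ` (V - K))" by (rule chart_open_image[OF A V]) auto
    have 2: "C2_on (w ` (V - K)) (\<lambda>\<zeta>. of_real (\<psi> (inv_into V w \<zeta>)))"
      by (rule C2_on_transform[OF C2_on_const[of _ 0] o]) (use d(5) \<psi>0 in auto)
    have "w ` (V \<inter> U) \<union> w ` (V - K) = w ` V" using K(2) by auto
    then show "C2_on (w ` V) (\<lambda>\<zeta>. of_real (\<psi> (inv_into V w \<zeta>)))"
      using C2_on_Un[OF 1 2 chart_transition(1)[OF A V U(1)] o] by simp
  qed
qed

lemma partition_of_unity:
  fixes X :: "'a::t2_space set"
  assumes A: "complex_atlas X A" and X: "compact X"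
  obtains J :: "'a set" and U z K and \<theta> :: "'a \<Rightarrow> 'a \<Rightarrow> real" where "finite J"
    "\<And>j. j \<in> J \<Longrightarrow> (U j, z j) \<in> A" "\<And>j. j \<in> J \<Longrightarrow> compact (K j)" "\<And>j. j \<in> J \<Longrightarrow> K j \<subseteq> U j"
    "\<And>j y. j \<in> J \<Longrightarrow> y \<notin> K j \<Longrightarrow> \<theta> j y = 0" "\<And>j y. j \<in> J \<Longrightarrow> 0 \<le> \<theta> j y"
    "\<And>y. y \<in> X \<Longrightarrow> (\<Sum>j\<in>J. \<theta> j y) = 1"
    "\<And>j V w. j \<in> J \<Longrightarrow> (V, w) \<in> A \<Longrightarrow> C2_on (w ` V) (\<lambda>\<zeta>. of_real (\<theta> j (inv_into V w \<zeta>)))"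
proof -
  have "\<forall>x\<in>X. \<exists>U z K \<psi> N. (U, z) \<in> A \<and> compact K \<and> K \<subseteq> U \<and> (\<forall>y. y \<notin> K \<longrightarrow> \<psi> y = 0) \<and> (\<forall>y. 0 \<le> (\<psi> y :: real)) \<and>
    openin (top_of_set X) N \<and> x \<in> N \<and> (\<forall>y\<in>N. \<psi> y > 0) \<and>
    (\<forall>V w. (V, w) \<in> A \<longrightarrow> C2_on (w ` V) (\<lambda>\<zeta>. of_real (\<psi> (inv_into V w \<zeta>))))"
    by (intro ballI, rule bump_function[OF A], assumption) blast
  then obtain U z K \<psi> N where *: "\<forall>x\<in>X. (U x, z x) \<in> A \<and> compact (K x) \<and> K x \<subseteq> U x \<and>
     (\<forall>y. y \<notin> K x \<longrightarrow> \<psi> x y = 0) \<and> (\<forall>y. 0 \<le> (\<psi> x y :: real)) \<and>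
    openin (top_of_set X) (N x) \<and> x \<in> N x \<and> (\<forall>y\<in>N x. \<psi> x y > 0) \<and>
    (\<forall>V w. (V, w) \<in> A \<longrightarrow> C2_on (w ` V) (\<lambda>\<zeta>. of_real (\<psi> x (inv_into V w \<zeta>))))"
    by metis
  have "(\<forall>c\<in>N ` X. openin (top_of_set X) c) \<and> X \<subseteq> \<Union>(N ` X)" using * by blast
  then obtain D where D: "D \<subseteq> N ` X" "finite D" "X \<subseteq> \<Union>D"
    using X unfolding compact_eq_openin_cover by meson
  obtain J where J: "J \<subseteq> X" "finite J" "D = N ` J" using finite_subset_image[OF D(2,1)] by blast
  define s where "s y = (\<Sum>j\<in>J. \<psi> j y)" for y
  have s: "s y > 0" if y: "y \<in> X" for y
  proof -
    obtain j where j: "j \<in> J" "y \<in> N j" using D(3) J(3) y by blast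
    have "0 < \<psi> j y" using * j J(1) by blast
    also have "\<psi> j y \<le> s y"
      unfolding s_def using * j J by (intro member_le_sum) auto
    finally show ?thesis .
  qed
  show thesis
  proof (rule that[of J U z K "\<lambda>j y. \<psi> j y / s y"])
    show "(\<Sum>j\<in>J. \<psi> j y / s y) = 1" if "y \<in> X" for y
      using s[OF that] by (simp add: sum_divide_distrib[symmetric] s_def)
    show "0 \<le> \<psi> j y / s y" if "j \<in> J" for j y
      using * J(1) that by (auto simp: s_def intro!: divide_nonneg_nonneg sum_nonneg)
    fix j V w assume j: "j \<in> J" and V: "(V, w) \<in> A"
    have c: "C2_on (w ` V) (\<lambda>\<zeta>. of_real (\<psi> j (inv_into V w \<zeta>)))" if "j \<in> J" for j
      using * J(1) that V by blast
    have "C2_on (w ` V) (\<lambda>\<zeta>. of_real (\<psi> j (inv_into V w \<zeta>)) * inverse (\<Sum>i\<in>J. of_real (\<psi> i (inv_into V w \<zeta>))))"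
    proof (intro C2_on_mult C2_on_inverse C2_on_sum c j)
      fix \<zeta> assume "\<zeta> \<in> w ` V"
      then have "s (inv_into V w \<zeta>) > 0" using s chart_inv(7,8)[OF A V] by blast
      then show "(\<Sum>i\<in>J. complex_of_real (\<psi> i (inv_into V w \<zeta>))) \<noteq> 0"
        unfolding s_def of_real_sum[symmetric] of_real_eq_0_iff by linarith
    qed
    then show "C2_on (w ` V) (\<lambda>\<zeta>. of_real (\<psi> j (inv_into V w \<zeta>) / s (inv_into V w \<zeta>)))"
      by (simp add: s_def divide_inverse)
  qed (use * J in auto)
qed

section \<open>Stokes' theorem on a compact Riemann surface\<close>

lemma integral_compact_support:
  fixes g :: "complex \<Rightarrow> complex"
  assumes "continuous_on K g" "compact K" "K \<subseteq> S" "\<And>\<zeta>. \<zeta> \<in> S \<Longrightarrow> \<zeta> \<notin> K \<Longrightarrow> g \<zeta> = 0"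
  shows "set_integrable lborel S g" "(LINT \<zeta>:S|lborel. g \<zeta>) = (LINT \<zeta>:K|lborel. g \<zeta>)"
proof -
  have eq: "(\<lambda>\<zeta>. indicator S \<zeta> *\<^sub>R g \<zeta>) = (\<lambda>\<zeta>. indicator K \<zeta> *\<^sub>R g \<zeta>)"
    using assms(3,4) by (auto simp: fun_eq_iff indicator_def)
  then show "(LINT \<zeta>:S|lborel. g \<zeta>) = (LINT \<zeta>:K|lborel. g \<zeta>)" by (simp add: set_lebesgue_integral_def)
  show "set_integrable lborel S g"
    using borel_integrable_compact[OF assms(2,1)] by (simp add: set_integrable_def eq)
qed

text \<open>
  The coefficients of 2-forms transform with \<open>\<bar>\<tau>'\<bar>\<^sup>2\<close>, which is the Jacobian of the transition map \<open>\<tau>\<close>. The support condition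
  reduces both integrals to the overlap of the charts.
\<close>

lemma integral_change_of_chart:
  fixes G G' :: "'a::t2_space \<Rightarrow> complex"
  assumes A: "complex_atlas X A" and U: "(U, z) \<in> A" and V: "(V, w) \<in> A" and K: "compact K" "K \<subseteq> U \<inter> V"
    and G: "continuous_on (z ` U) (\<lambda>\<zeta>. G (inv_into U z \<zeta>))" "\<And>x. x \<in> U - K \<Longrightarrow> G x = 0"
    and G': "continuous_on (w ` V) (\<lambda>\<zeta>. G' (inv_into V w \<zeta>))" "\<And>x. x \<in> V - K \<Longrightarrow> G' x = 0"
    and eq: "\<And>x. x \<in> U \<inter> V \<Longrightarrow> G x = of_real ((cmod (deriv (w \<circ> inv_into U z) (z x)))\<^sup>2) * G' x"
  shows "(LINT \<zeta>:z ` U|lborel. G (inv_into U z \<zeta>)) = (LINT \<zeta>:w ` V|lborel. G' (inv_into V w \<zeta>))"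
proof -
  note t = chart_transition[OF A U V] and u = chart_inv[OF A U] and v = chart_inv[OF A V]
  let ?\<tau> = "w \<circ> inv_into U z" and ?g = "\<lambda>\<zeta>. G (inv_into U z \<zeta>)" and ?g' = "\<lambda>\<zeta>. G' (inv_into V w \<zeta>)"
  have zK: "compact (z ` K)" "z ` K \<subseteq> z ` U" "z ` K \<subseteq> z ` (U \<inter> V)"
    and wK: "compact (w ` K)" "w ` K \<subseteq> w ` V" "w ` K \<subseteq> w ` (U \<inter> V)"
    using compact_continuous_image[OF continuous_on_subset[OF u(3)] K(1)] compact_continuous_image[OF continuous_on_subset[OF v(3)] K(1)] K(2)
    by auto
  have z0: "?g \<zeta> = 0" if \<zeta>: "\<zeta> \<in> z ` U" "\<zeta> \<notin> z ` K" for \<zeta>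
  proof -
    obtain x where "x \<in> U - K" "\<zeta> = z x" using \<zeta> by blast
    then show ?thesis using G(2)[of x] u(5)[of x] by simp
  qed
  have w0: "?g' \<zeta> = 0" if \<zeta>: "\<zeta> \<in> w ` V" "\<zeta> \<notin> w ` K" for \<zeta>
  proof -
    obtain x where "x \<in> V - K" "\<zeta> = w x" using \<zeta> by blast
    then show ?thesis using G'(2)[of x] v(5)[of x] by simp
  qed
  have sub: "z ` (U \<inter> V) \<subseteq> z ` U" "w ` (U \<inter> V) \<subseteq> w ` V" by auto
  note gz = integral_compact_support[OF continuous_on_subset[OF G(1) zK(2)] zK(1)]
  note gw = integral_compact_support[OF continuous_on_subset[OF G'(1) wK(2)] wK(1)]
  have eq': "(cmod (deriv ?\<tau> \<zeta>))\<^sup>2 *\<^sub>R ?g' (?\<tau> \<zeta>) = ?g \<zeta>" if \<zeta>: "\<zeta> \<in> z ` (U \<inter> V)" for \<zeta>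
  proof -
    obtain x where x: "x \<in> U \<inter> V" "\<zeta> = z x" using \<zeta> by blast
    then have "?g \<zeta> = of_real ((cmod (deriv ?\<tau> \<zeta>))\<^sup>2) * G' x" using eq u(5) by simp
    moreover have "?g' (?\<tau> \<zeta>) = G' x" using x u(5) v(5) by simp
    ultimately show ?thesis by (simp add: scaleR_conv_of_real)
  qed
  have int: "(LINT \<zeta>:z ` (U \<inter> V)|lborel. (cmod (deriv ?\<tau> \<zeta>))\<^sup>2 *\<^sub>R ?g' (?\<tau> \<zeta>)) = (LINT \<zeta>:z ` (U \<inter> V)|lborel. ?g \<zeta>)"
    using eq' t(1) by (intro set_lebesgue_integral_cong) auto
  have "(LINT \<zeta>:z ` U|lborel. ?g \<zeta>) = (LINT \<zeta>:z ` K|lborel. ?g \<zeta>)" by (rule gz(2)[OF zK(2)]) (rule z0)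
  also have "\<dots> = (LINT \<zeta>:z ` (U \<inter> V)|lborel. ?g \<zeta>)"
    by (rule gz(2)[OF zK(3), symmetric]) (use z0 sub(1) in blast)
  also have "\<dots> = (LINT \<zeta>:w ` (U \<inter> V)|lborel. ?g' \<zeta>)"
    unfolding int[symmetric] t(3)[symmetric]
  proof (rule integral_holomorphic_substitution[OF t(1,2,4)])
    show "set_integrable lborel (?\<tau> ` z ` (U \<inter> V)) ?g'"
      unfolding t(3) using gw(1)[OF wK(3)] w0 sub(2) by blast
    have "set_integrable lborel (z ` (U \<inter> V)) ?g" using gz(1)[OF zK(3)] z0 sub(1) by blast
    then show "set_integrable lborel (z ` (U \<inter> V)) (\<lambda>\<zeta>. (cmod (deriv ?\<tau> \<zeta>))\<^sup>2 *\<^sub>R ?g' (?\<tau> \<zeta>))"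
      by (subst set_integrable_cong[OF refl refl eq']) assumption+
  qed
  also have "\<dots> = (LINT \<zeta>:w ` K|lborel. ?g' \<zeta>)"
    by (rule gw(2)[OF wK(3)]) (use w0 sub(2) in blast)
  also have "\<dots> = (LINT \<zeta>:w ` V|lborel. ?g' \<zeta>)" by (rule gw(2)[OF wK(2), symmetric]) (rule w0)
  finally show ?thesis .
qed

lemma wirtinger_zero_outside:
  assumes "open S" "wirtinger S f a b" "compact K" "\<And>z. z \<in> S \<Longrightarrow> z \<notin> K \<Longrightarrow> f z = 0" "z \<in> S" "z \<notin> K"
  shows "a z = 0" "b z = 0"
proof -
  have o: "open (S - K)" using assms(1) compact_imp_closed[OF assms(3)] by (rule open_Diff)
  have "wirtinger (S - K) f (\<lambda>_. 0) (\<lambda>_. 0)"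
    by (rule wirtinger_transform[OF wirtinger_const[of _ 0] o]) (use assms(4) in auto)
  from wirtinger_unique[OF wirtinger_subset[OF assms(2)] this] assms(5,6)
  show "a z = 0" "b z = 0" by auto
qed

lemma wirtinger_extend_by_0:
  assumes S: "open S" and f: "wirtinger S f a b" and K: "compact K" "K \<subseteq> S" "\<And>z. z \<in> S \<Longrightarrow> z \<notin> K \<Longrightarrow> f z = 0"
  shows "wirtinger UNIV (\<lambda>z. if z \<in> S then f z else 0) (\<lambda>z. if z \<in> S then a z else 0) (\<lambda>z. if z \<in> S then b z else 0)"
proof (rule wirtinger_Union)
  fix z
  let ?E = "\<lambda>u z. if z \<in> S then u z else (0::complex)"
  have "wirtinger S (?E f) (?E a) (?E b)"
    by (rule wirtinger_eqI[OF wirtinger_transform[OF f S]]) auto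
  moreover have "wirtinger (-K) (?E f) (?E a) (?E b)"
  proof (rule wirtinger_eqI[OF wirtinger_transform[OF wirtinger_const[of _ 0]]])
    show "open (-K)" using compact_imp_closed[OF K(1)] by (rule open_Compl)
    fix z assume z: "z \<in> -K"
    then show "0 = ?E f z" using K(3) by simp
    have "a z = 0 \<and> b z = 0" if "z \<in> S"
      using wirtinger_zero_outside[OF S f K(1) _ that] K(3) z by blast
    then show "0 = ?E a z" "0 = ?E b z" by auto
  qed
  moreover have "open (-K)" using compact_imp_closed[OF K(1)] by (rule open_Compl)
  moreover have "z \<in> S \<or> z \<in> -K" using K(2) by blast
  ultimately show "\<exists>T. open T \<and> z \<in> T \<and> wirtinger T (?E f) (?E a) (?E b)"
    using S by blast
qed

text \<open>
  This is Stokes' theorem for \<open>\<eta> = f dz + g d(cnj z)\<close>, as \<open>d\<eta>\<close> has the coefficient \<open>b - c\<close> up to a constant.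
\<close>

lemma stokes_compact_support:
  assumes S: "open S" and K: "compact K" "K \<subseteq> S"
    and f: "wirtinger S f a b" "\<And>z. z \<in> S \<Longrightarrow> z \<notin> K \<Longrightarrow> f z = 0"
    and g: "wirtinger S g c d" "\<And>z. z \<in> S \<Longrightarrow> z \<notin> K \<Longrightarrow> g z = 0"
  shows "(LINT z:S|lborel. b z - c z) = 0"
proof -
  let ?E = "\<lambda>u z. if z \<in> S then u z else (0::complex)"
  have F: "integrable lborel (?E b)" "integral\<^sup>L lborel (?E b) = 0"
    using integral_wirtinger_eq_0[OF wirtinger_extend_by_0[OF S f(1) K f(2)] K(1)] K(2) f(2) by auto
  have G: "integrable lborel (?E c)" "integral\<^sup>L lborel (?E c) = 0"
    using integral_wirtinger_eq_0[OF wirtinger_extend_by_0[OF S g(1) K g(2)] K(1)] K(2) g(2) by auto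
  have "(\<lambda>z. indicator S z *\<^sub>R (b z - c z)) = (\<lambda>z. ?E b z - ?E c z)" by (auto simp: fun_eq_iff indicator_def)
  then show ?thesis unfolding set_lebesgue_integral_def using F G by simp
qed

lemma continuous_nonneg_integral_eq_0:
  fixes g :: "complex \<Rightarrow> real"
  assumes S: "open S" and g: "continuous_on S g" "\<And>z. z \<in> S \<Longrightarrow> 0 \<le> g z" and int: "set_integrable lborel S g"
    and 0: "(LINT z:S|lborel. g z) = 0" and z: "z \<in> S"
  shows "g z = 0"
proof -
  have "AE x in lborel. indicator S x *\<^sub>R g x = 0"
    using integral_nonneg_eq_0_iff_AE[OF int[unfolded set_integrable_def]] g(2) 0
    by (auto simp: set_lebesgue_integral_def indicator_def)
  then obtain N where N: "N \<in> null_sets lborel" "{x \<in> space lborel. \<not> (indicator S x *\<^sub>R g x = 0)} \<subseteq> N"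
    unfolding eventually_ae_filter by blast
  then have neg: "negligible N" using null_sets_completionI negligible_iff_null_sets by blast
  have "open (S \<inter> g -` (-{0}))" using continuous_open_preimage[OF g(1) S] by auto
  moreover have "S \<inter> g -` (-{0}) \<subseteq> N" using N(2) by (auto simp: indicator_def)
  ultimately have "S \<inter> g -` (-{0}) = {}"
    using negligible_subset[OF neg] open_not_negligible by metis
  then show ?thesis using z by auto
qed

text \<open>
  In each chart, \<open>\<eta> = a dz + b d(cnj z)\<close> and \<open>d\<eta> = 2\<i> \<kappa> dx dy\<close>. As the integral of \<open>d\<eta>\<close> over the compact surface vanishes, \<open>\<kappa> \<ge> 0\<close>
  forces \<open>\<kappa> = 0\<close>. With a partition of unity \<open>\<theta>\<close>,
  Stokes' theorem in the plane applies to each \<open>d(\<theta>\<^sub>j \<eta>) = \<theta>\<^sub>j d\<eta> + d\<theta>\<^sub>j \<and> \<eta>\<close>. The integrals of the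
  \<open>d\<theta>\<^sub>j \<and> \<eta>\<close> add up to zero since \<open>\<Sum>\<^sub>j d\<theta>\<^sub>j = 0\<close>, so those of the \<open>\<theta>\<^sub>j d\<eta>\<close> do, too, and each of them is zero
  because \<open>\<theta>\<^sub>j \<kappa> \<ge> 0\<close>.
\<close>

lemma stokes_nonneg:
  fixes X :: "'a::t2_space set" and a b :: "'a chart \<Rightarrow> 'a \<Rightarrow> complex" and \<kappa> :: "'a chart \<Rightarrow> 'a \<Rightarrow> real"
  assumes A: "complex_atlas X A" and X: "compact X"
    and form: "\<And>U z. (U, z) \<in> A \<Longrightarrow> \<exists>p q p' q'. wirtinger (z ` U) (\<lambda>\<zeta>. a (U, z) (inv_into U z \<zeta>)) p q \<and>
      wirtinger (z ` U) (\<lambda>\<zeta>. b (U, z) (inv_into U z \<zeta>)) p' q' \<and> (\<forall>x\<in>U. q (z x) - p' (z x) = of_real (\<kappa> (U, z) x))"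
    and trans: "\<And>U z V w x. (U, z) \<in> A \<Longrightarrow> (V, w) \<in> A \<Longrightarrow> x \<in> U \<Longrightarrow> x \<in> V \<Longrightarrow>
      a (U, z) x = a (V, w) x * deriv (w \<circ> inv_into U z) (z x) \<and>
      b (U, z) x = b (V, w) x * cnj (deriv (w \<circ> inv_into U z) (z x))"
    and nonneg: "\<And>U z x. (U, z) \<in> A \<Longrightarrow> x \<in> U \<Longrightarrow> 0 \<le> \<kappa> (U, z) x"
    and x: "x \<in> X"
  shows "\<exists>(U, z)\<in>A. x \<in> U \<and> \<kappa> (U, z) x = 0"
proof -
  obtain J U z K \<theta> where J: "finite (J :: 'a set)" and Uz: "\<And>j. j \<in> J \<Longrightarrow> (U j, z j) \<in> A"
    and K: "\<And>j. j \<in> J \<Longrightarrow> compact (K j)" "\<And>j. j \<in> J \<Longrightarrow> K j \<subseteq> U j"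
    and \<theta>0: "\<And>j y. j \<in> J \<Longrightarrow> y \<notin> K j \<Longrightarrow> \<theta> j y = 0" and \<theta>nn: "\<And>j y. j \<in> J \<Longrightarrow> 0 \<le> (\<theta> j y :: real)"
    and \<theta>1: "\<And>y. y \<in> X \<Longrightarrow> (\<Sum>j\<in>J. \<theta> j y) = 1"
    and \<theta>C2: "\<And>j V w. j \<in> J \<Longrightarrow> (V, w) \<in> A \<Longrightarrow> C2_on (w ` V) (\<lambda>\<zeta>. of_real (\<theta> j (inv_into V w \<zeta>)))"
    by (rule partition_of_unity[OF A X]) (rule that; assumption)
  have "\<exists>u v. \<forall>j\<in>J. \<forall>V w. (V, w) \<in> A \<longrightarrow>
      wirtinger (w ` V) (\<lambda>\<zeta>. of_real (\<theta> j (inv_into V w \<zeta>))) (u j (V, w)) (v j (V, w))"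
  proof -
    have "\<forall>j \<alpha>. \<exists>u v. j \<in> J \<longrightarrow> \<alpha> \<in> A \<longrightarrow>
      wirtinger (snd \<alpha> ` fst \<alpha>) (\<lambda>\<zeta>. of_real (\<theta> j (inv_into (fst \<alpha>) (snd \<alpha>) \<zeta>))) u v"
    proof (intro allI)
      fix j and \<alpha> :: "'a chart"
      obtain V w where "\<alpha> = (V, w)" by (cases \<alpha>)
      then show "\<exists>u v. j \<in> J \<longrightarrow> \<alpha> \<in> A \<longrightarrow>
          wirtinger (snd \<alpha> ` fst \<alpha>) (\<lambda>\<zeta>. of_real (\<theta> j (inv_into (fst \<alpha>) (snd \<alpha>) \<zeta>))) u v"
        using \<theta>C2[of j V w] unfolding C2_on_def by auto
    qed
    then obtain u v where "\<forall>j \<alpha>. j \<in> J \<longrightarrow> \<alpha> \<in> A \<longrightarrow>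
      wirtinger (snd \<alpha> ` fst \<alpha>) (\<lambda>\<zeta>. of_real (\<theta> j (inv_into (fst \<alpha>) (snd \<alpha>) \<zeta>))) (u j \<alpha>) (v j \<alpha>)" by metis
    then show ?thesis by (intro exI[of _ u] exI[of _ v]) auto
  qed
  then obtain u v where uv: "\<And>j V w. j \<in> J \<Longrightarrow> (V, w) \<in> A \<Longrightarrow>
      wirtinger (w ` V) (\<lambda>\<zeta>. of_real (\<theta> j (inv_into V w \<zeta>))) (u j (V, w)) (v j (V, w))" by blast
  \<comment> \<open>the coefficient of the 2-form \<open>d\<theta>\<^sub>j \<and> \<eta>\<close>, normalized like \<open>\<kappa>\<close>\<close>
  define \<omega> where "\<omega> j \<alpha> y = v j \<alpha> (snd \<alpha> y) * a \<alpha> y - u j \<alpha> (snd \<alpha> y) * b \<alpha> y" for j \<alpha> y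
  have zero: "u j (V, w) (w y) = 0 \<and> v j (V, w) (w y) = 0" if "j \<in> J" "(V, w) \<in> A" "y \<in> V" "y \<notin> K j" for j V w y
  proof -
    note c = chart_inv[OF A that(2)]
    have "openin (top_of_set X) (V - K j)"
      using openin_diff[OF c(1) closed_subset[OF _ compact_imp_closed[OF K(1)[OF that(1)]]]] K(2)[OF that(1)] chart_inv(8)[OF A Uz[OF that(1)]]
      by auto
    then have o: "open (w ` (V - K j))" by (rule chart_open_image[OF A that(2)]) auto
    have "wirtinger (w ` (V - K j)) (\<lambda>\<zeta>. of_real (\<theta> j (inv_into V w \<zeta>))) (\<lambda>_. 0) (\<lambda>_. 0)"
      by (rule wirtinger_transform[OF wirtinger_const[of _ 0] o]) (use c(5) \<theta>0 that(1) in auto)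
    from wirtinger_unique[OF wirtinger_subset[OF uv[OF that(1,2)]] this, of "w y"] that(3,4)
    show ?thesis by auto
  qed
  have \<omega>trans: "\<omega> j (V, w) y = of_real ((cmod (deriv (w' \<circ> inv_into V w) (w y)))\<^sup>2) * \<omega> j (V', w') y"
    if j: "j \<in> J" and V: "(V, w) \<in> A" and V': "(V', w') \<in> A" and y: "y \<in> V" "y \<in> V'" for j V w V' w' y
  proof -
    let ?\<tau> = "w' \<circ> inv_into V w" and ?T = "w ` (V \<inter> V')"
    note t = chart_transition[OF A V V'] and c = chart_inv[OF A V] and c' = chart_inv[OF A V']
    have "wirtinger ?T (\<lambda>\<zeta>. of_real (\<theta> j (inv_into V' w' (?\<tau> \<zeta>)))) (\<lambda>\<zeta>. u j (V', w') (?\<tau> \<zeta>) * deriv ?\<tau> \<zeta>)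
        (\<lambda>\<zeta>. v j (V', w') (?\<tau> \<zeta>) * cnj (deriv ?\<tau> \<zeta>))"
      by (rule wirtinger_compose[OF uv[OF j V'] t(2,1)]) (use t(3) in auto)
    then have "wirtinger ?T (\<lambda>\<zeta>. of_real (\<theta> j (inv_into V w \<zeta>))) (\<lambda>\<zeta>. u j (V', w') (?\<tau> \<zeta>) * deriv ?\<tau> \<zeta>)
        (\<lambda>\<zeta>. v j (V', w') (?\<tau> \<zeta>) * cnj (deriv ?\<tau> \<zeta>))"
      by (rule wirtinger_transform[OF _ t(1)]) (use c(5) c'(5) in auto)
    from wirtinger_unique[OF wirtinger_subset[OF uv[OF j V]] this, of "w y"] y c(5)[OF y(1)]
    have "u j (V, w) (w y) = u j (V', w') (w' y) * deriv ?\<tau> (w y)" "v j (V, w) (w y) = v j (V', w') (w' y) * cnj (deriv ?\<tau> (w y))"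
      by auto
    moreover note trans[OF V V' y]
    moreover have "complex_of_real ((cmod (deriv ?\<tau> (w y)))\<^sup>2) = deriv ?\<tau> (w y) * cnj (deriv ?\<tau> (w y))"
      by (simp only: complex_norm_square)
    ultimately show ?thesis by (simp add: \<omega>_def algebra_simps)
  qed
  have ab_cont: "continuous_on (w ` V) (\<lambda>\<zeta>. a (V, w) (inv_into V w \<zeta>))" "continuous_on (w ` V) (\<lambda>\<zeta>. b (V, w) (inv_into V w \<zeta>))"
    if "(V, w) \<in> A" for V w
    using form[OF that] wirtinger_continuous by blast+
  have \<theta>_cont: "continuous_on (w ` V) (\<lambda>\<zeta>. complex_of_real (\<theta> j (inv_into V w \<zeta>)))" if "j \<in> J" "(V, w) \<in> A" for j V w
    using uv[OF that] wirtinger_continuous by blast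
  have \<omega>_cont: "continuous_on (w ` V) (\<lambda>\<zeta>. \<omega> j (V, w) (inv_into V w \<zeta>))" if "j \<in> J" "(V, w) \<in> A" for j V w
  proof -
    have "continuous_on (w ` V) (u j (V, w))" "continuous_on (w ` V) (v j (V, w))"
      using uv[OF that] by (auto simp: wirtinger_def)
    then have "continuous_on (w ` V) (\<lambda>\<zeta>. v j (V, w) \<zeta> * a (V, w) (inv_into V w \<zeta>) - u j (V, w) \<zeta> * b (V, w) (inv_into V w \<zeta>))"
      using ab_cont[OF that(2)] by (intro continuous_intros)
    then show ?thesis using chart_inv(6)[OF A that(2)] by (simp add: \<omega>_def cong: continuous_on_cong)
  qed
  have comp: "compact (K i \<inter> K j)" if "i \<in> J" "j \<in> J" for i j
    using K(1) that by (intro compact_Int_closed compact_imp_closed)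
  let ?I = "\<lambda>i j k. LINT \<zeta>:z k ` U k|lborel. of_real (\<theta> i (inv_into (U k) (z k) \<zeta>)) * \<omega> j (U k, z k) (inv_into (U k) (z k) \<zeta>)"
  \<comment> \<open>\<open>\<theta>\<^sub>i d\<theta>\<^sub>j \<and> \<eta>\<close> is supported in both charts, and so it can be integrated in either of them\<close>
  have swap: "?I i j j = ?I i j i" if i: "i \<in> J" and j: "j \<in> J" for i j
  proof (rule integral_change_of_chart[OF A Uz[OF j] Uz[OF i] comp[OF i j]])
    show "K i \<inter> K j \<subseteq> U j \<inter> U i" using K(2) i j by blast
    show "of_real (\<theta> i y) * \<omega> j (U j, z j) y = 0" if "y \<in> U j - K i \<inter> K j" for y
      using zero[OF j Uz[OF j], of y] \<theta>0[OF i, of y] that by (auto simp: \<omega>_def)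
    show "of_real (\<theta> i y) * \<omega> j (U i, z i) y = 0" if "y \<in> U i - K i \<inter> K j" for y
      using zero[OF j Uz[OF i], of y] \<theta>0[OF i, of y] that by (auto simp: \<omega>_def)
    show "of_real (\<theta> i y) * \<omega> j (U j, z j) y =
        of_real ((cmod (deriv (z i \<circ> inv_into (U j) (z j)) (z j y)))\<^sup>2) * (of_real (\<theta> i y) * \<omega> j (U i, z i) y)" if "y \<in> U j \<inter> U i" for y
      using \<omega>trans[OF j Uz[OF j] Uz[OF i], of y] that by simp
  qed (intro continuous_on_mult \<theta>_cont \<omega>_cont i j Uz)+
  have int: "set_integrable lborel (z k ` U k) (\<lambda>\<zeta>. of_real (\<theta> i (inv_into (U k) (z k) \<zeta>)) * \<omega> j (U k, z k) (inv_into (U k) (z k) \<zeta>))"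
    if k: "k = i \<or> k = j" and i: "i \<in> J" and j: "j \<in> J" for i j k
  proof (rule integral_compact_support(1)[where K="z k ` (K i \<inter> K j)"])
    have kJ: "k \<in> J" using k i j by blast
    note c = chart_inv[OF A Uz[OF kJ]]
    have sub: "K i \<inter> K j \<subseteq> U k" using k K(2) i j by blast
    then show s: "z k ` (K i \<inter> K j) \<subseteq> z k ` U k" by auto
    show "compact (z k ` (K i \<inter> K j))"
      by (rule compact_continuous_image[OF continuous_on_subset[OF c(3) sub] comp[OF i j]])
    show "continuous_on (z k ` (K i \<inter> K j)) (\<lambda>\<zeta>. of_real (\<theta> i (inv_into (U k) (z k) \<zeta>)) * \<omega> j (U k, z k) (inv_into (U k) (z k) \<zeta>))"
      by (rule continuous_on_subset[OF _ s]) (intro continuous_on_mult \<theta>_cont \<omega>_cont i j Uz kJ)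
    fix \<zeta> assume \<zeta>: "\<zeta> \<in> z k ` U k" "\<zeta> \<notin> z k ` (K i \<inter> K j)"
    then obtain y where y: "y \<in> U k" "\<zeta> = z k y" "y \<notin> K i \<inter> K j" by blast
    then show "of_real (\<theta> i (inv_into (U k) (z k) \<zeta>)) * \<omega> j (U k, z k) (inv_into (U k) (z k) \<zeta>) = 0"
      using zero[OF j Uz[OF kJ], of y] \<theta>0[OF i, of y] c(5) by (auto simp: \<omega>_def)
  qed
  have sum1: "(\<Sum>i\<in>J. complex_of_real (\<theta> i y) * c) = c" if "y \<in> X" for y c
    using \<theta>1[OF that] by (metis mult_1 of_real_1 of_real_sum sum_distrib_right)
  \<comment> \<open>the differential of the constant \<open>\<Sum>\<^sub>j \<theta>\<^sub>j = 1\<close>\<close>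
  have dsum: "(\<Sum>j\<in>J. u j (V, w) \<zeta>) = 0 \<and> (\<Sum>j\<in>J. v j (V, w) \<zeta>) = 0" if V: "(V, w) \<in> A" and \<zeta>: "\<zeta> \<in> w ` V" for V w \<zeta>
  proof -
    note c = chart_inv[OF A V]
    have "wirtinger (w ` V) (\<lambda>\<zeta>. \<Sum>j\<in>J. of_real (\<theta> j (inv_into V w \<zeta>))) (\<lambda>_. 0) (\<lambda>_. 0)"
    proof (rule wirtinger_transform[OF wirtinger_const[of _ 1] c(2)])
      show "1 = (\<Sum>j\<in>J. complex_of_real (\<theta> j (inv_into V w \<zeta>)))" if "\<zeta> \<in> w ` V" for \<zeta>
        using sum1[of "inv_into V w \<zeta>" 1] c(7)[OF that] c(8) by auto
    qed
    from wirtinger_unique[OF wirtinger_sum[of J, OF uv[OF _ V]] this \<zeta>] show ?thesis by auto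
  qed
  have "(\<Sum>j\<in>J. LINT \<zeta>:z j ` U j|lborel. \<omega> j (U j, z j) (inv_into (U j) (z j) \<zeta>)) = (\<Sum>j\<in>J. \<Sum>i\<in>J. ?I i j j)"
  proof (rule sum.cong[OF refl])
    fix j assume j: "j \<in> J"
    note c = chart_inv[OF A Uz[OF j]]
    have "(LINT \<zeta>:z j ` U j|lborel. \<omega> j (U j, z j) (inv_into (U j) (z j) \<zeta>)) =
        (LINT \<zeta>:z j ` U j|lborel. \<Sum>i\<in>J. of_real (\<theta> i (inv_into (U j) (z j) \<zeta>)) * \<omega> j (U j, z j) (inv_into (U j) (z j) \<zeta>))"
    proof (rule set_lebesgue_integral_cong)
      have "inv_into (U j) (z j) \<zeta> \<in> X" if "\<zeta> \<in> z j ` U j" for \<zeta> using c(7)[OF that] c(8) by blast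
      then show "\<forall>\<zeta>. \<zeta> \<in> z j ` U j \<longrightarrow> \<omega> j (U j, z j) (inv_into (U j) (z j) \<zeta>) =
          (\<Sum>i\<in>J. of_real (\<theta> i (inv_into (U j) (z j) \<zeta>)) * \<omega> j (U j, z j) (inv_into (U j) (z j) \<zeta>))"
        using sum1 by metis
    qed (use c(2) in auto)
    also have "\<dots> = (\<Sum>i\<in>J. ?I i j j)"
      unfolding set_lebesgue_integral_def scaleR_sum_right
      by (rule Bochner_Integration.integral_sum) (use int[OF _ _ j] in \<open>auto simp: set_integrable_def\<close>)
    finally show "(LINT \<zeta>:z j ` U j|lborel. \<omega> j (U j, z j) (inv_into (U j) (z j) \<zeta>)) = (\<Sum>i\<in>J. ?I i j j)" .
  qed
  also have "\<dots> = (\<Sum>j\<in>J. \<Sum>i\<in>J. ?I i j i)" using swap by (intro sum.cong refl) auto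
  also have "\<dots> = (\<Sum>i\<in>J. \<Sum>j\<in>J. ?I i j i)" by (rule sum.swap)
  also have "\<dots> = 0"
  proof (rule sum.neutral, rule ballI)
    fix i assume i: "i \<in> J"
    note c = chart_inv[OF A Uz[OF i]]
    have "(\<Sum>j\<in>J. ?I i j i) = (LINT \<zeta>:z i ` U i|lborel. \<Sum>j\<in>J. of_real (\<theta> i (inv_into (U i) (z i) \<zeta>)) * \<omega> j (U i, z i) (inv_into (U i) (z i) \<zeta>))"
      unfolding set_lebesgue_integral_def scaleR_sum_right
      by (rule Bochner_Integration.integral_sum[symmetric]) (use int[OF _ i] in \<open>auto simp: set_integrable_def\<close>)
    also have "\<dots> = (LINT \<zeta>:z i ` U i|lborel. 0)"
    proof (rule set_lebesgue_integral_cong, use c(2) in simp, intro allI impI)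
      fix \<zeta> assume "\<zeta> \<in> z i ` U i"
      then obtain y where y: "y \<in> U i" "\<zeta> = z i y" by blast
      have "(\<Sum>j\<in>J. \<omega> j (U i, z i) y) = (\<Sum>j\<in>J. v j (U i, z i) (z i y)) * a (U i, z i) y - (\<Sum>j\<in>J. u j (U i, z i) (z i y)) * b (U i, z i) y"
        by (simp add: \<omega>_def sum_subtractf sum_distrib_right)
      also have "\<dots> = 0" using dsum[OF Uz[OF i], of "z i y"] y by simp
      finally show "(\<Sum>j\<in>J. of_real (\<theta> i (inv_into (U i) (z i) \<zeta>)) * \<omega> j (U i, z i) (inv_into (U i) (z i) \<zeta>)) = 0"
        using c(5)[OF y(1)] by (simp add: y(2) sum_distrib_left[symmetric])
    qed
    finally show "(\<Sum>j\<in>J. ?I i j i) = 0" by simp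
  qed
  finally have \<omega>sum: "(\<Sum>j\<in>J. LINT \<zeta>:z j ` U j|lborel. \<omega> j (U j, z j) (inv_into (U j) (z j) \<zeta>)) = 0" .
  let ?k = "\<lambda>j \<zeta>. \<theta> j (inv_into (U j) (z j) \<zeta>) * \<kappa> (U j, z j) (inv_into (U j) (z j) \<zeta>)"
  have local: "continuous_on (z j ` U j) (?k j) \<and> set_integrable lborel (z j ` U j) (?k j) \<and>
      of_real (LINT \<zeta>:z j ` U j|lborel. ?k j \<zeta>) + (LINT \<zeta>:z j ` U j|lborel. \<omega> j (U j, z j) (inv_into (U j) (z j) \<zeta>)) = 0"
    if j: "j \<in> J" for j
  proof -
    note c = chart_inv[OF A Uz[OF j]]
    let ?S = "z j ` U j" and ?iv = "inv_into (U j) (z j)" and ?\<alpha> = "(U j, z j)"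
    obtain p q p' q' where pq: "wirtinger ?S (\<lambda>\<zeta>. a ?\<alpha> (?iv \<zeta>)) p q" "wirtinger ?S (\<lambda>\<zeta>. b ?\<alpha> (?iv \<zeta>)) p' q'"
      and \<kappa>: "\<And>y. y \<in> U j \<Longrightarrow> q (z j y) - p' (z j y) = of_real (\<kappa> ?\<alpha> y)"
      using form[OF Uz[OF j]] by blast
    have zK: "compact (z j ` K j)" "z j ` K j \<subseteq> ?S"
      using compact_continuous_image[OF continuous_on_subset[OF c(3) K(2)[OF j]] K(1)[OF j]] K(2)[OF j] by auto
    have \<theta>z: "\<theta> j (?iv \<zeta>) = 0" if "\<zeta> \<in> ?S" "\<zeta> \<notin> z j ` K j" for \<zeta>
      by (rule \<theta>0[OF j]) (use that c(6) in \<open>metis imageI\<close>)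
    note m = uv[OF j Uz[OF j], THEN wirtinger_mult]
    have 0: "(LINT \<zeta>:?S|lborel. (v j ?\<alpha> \<zeta> * a ?\<alpha> (?iv \<zeta>) + of_real (\<theta> j (?iv \<zeta>)) * q \<zeta>) -
        (u j ?\<alpha> \<zeta> * b ?\<alpha> (?iv \<zeta>) + of_real (\<theta> j (?iv \<zeta>)) * p' \<zeta>)) = 0"
      by (rule stokes_compact_support[OF c(2) zK m[OF pq(1)] _ m[OF pq(2)]]) (simp_all add: \<theta>z)
    have \<kappa>': "complex_of_real (\<kappa> ?\<alpha> (?iv \<zeta>)) = q \<zeta> - p' \<zeta>" if "\<zeta> \<in> ?S" for \<zeta>
      using \<kappa>[OF c(7)[OF that]] c(6)[OF that] by simp
    have "continuous_on ?S q" "continuous_on ?S p'" using pq by (auto simp: wirtinger_def)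
    then have "continuous_on ?S (\<lambda>\<zeta>. complex_of_real (\<theta> j (?iv \<zeta>)) * (q \<zeta> - p' \<zeta>))"
      using \<theta>_cont[OF j Uz[OF j]] by (intro continuous_on_mult continuous_on_diff)
    then have kc: "continuous_on ?S (\<lambda>\<zeta>. complex_of_real (?k j \<zeta>))"
      using \<kappa>' by (simp cong: continuous_on_cong)
    then have 1: "continuous_on ?S (?k j)" using continuous_on_Re[OF kc] by simp
    have kint: "set_integrable lborel ?S (\<lambda>\<zeta>. complex_of_real (?k j \<zeta>))"
      by (rule integral_compact_support(1)[OF continuous_on_subset[OF kc zK(2)] zK]) (simp add: \<theta>z)
    then have 2: "set_integrable lborel ?S (?k j)"
      using integrable_Re[of lborel "\<lambda>\<zeta>. indicator ?S \<zeta> *\<^sub>R complex_of_real (?k j \<zeta>)"]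
      unfolding set_integrable_def by simp
    have \<omega>int: "set_integrable lborel ?S (\<lambda>\<zeta>. \<omega> j ?\<alpha> (?iv \<zeta>))"
    proof (rule integral_compact_support(1)[OF continuous_on_subset[OF \<omega>_cont[OF j Uz[OF j]] zK(2)] zK])
      fix \<zeta> assume "\<zeta> \<in> ?S" "\<zeta> \<notin> z j ` K j"
      then obtain y where "y \<in> U j" "\<zeta> = z j y" "y \<notin> K j" by blast
      then show "\<omega> j ?\<alpha> (?iv \<zeta>) = 0" using zero[OF j Uz[OF j], of y] c(5) by (simp add: \<omega>_def)
    qed
    have "(LINT \<zeta>:?S|lborel. complex_of_real (?k j \<zeta>) + \<omega> j ?\<alpha> (?iv \<zeta>)) = 0"
      unfolding 0[symmetric]
    proof (rule set_lebesgue_integral_cong, use c(2) in simp, intro allI impI)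
      fix \<zeta> assume \<zeta>: "\<zeta> \<in> ?S"
      show "complex_of_real (?k j \<zeta>) + \<omega> j ?\<alpha> (?iv \<zeta>) =
         (v j ?\<alpha> \<zeta> * a ?\<alpha> (?iv \<zeta>) + of_real (\<theta> j (?iv \<zeta>)) * q \<zeta>) -
        (u j ?\<alpha> \<zeta> * b ?\<alpha> (?iv \<zeta>) + of_real (\<theta> j (?iv \<zeta>)) * p' \<zeta>)"
        unfolding of_real_mult \<kappa>'[OF \<zeta>] using c(6)[OF \<zeta>] by (simp add: \<omega>_def algebra_simps)
    qed
    then have "(LINT \<zeta>:?S|lborel. complex_of_real (?k j \<zeta>)) + (LINT \<zeta>:?S|lborel. \<omega> j ?\<alpha> (?iv \<zeta>)) = 0"
      using set_integral_add(2)[OF kint \<omega>int] by simp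
    moreover have "(LINT \<zeta>:?S|lborel. complex_of_real (?k j \<zeta>)) = of_real (LINT \<zeta>:?S|lborel. ?k j \<zeta>)"
      by (rule set_integral_complex_of_real)
    ultimately show ?thesis using 1 2 by simp
  qed
  have "complex_of_real (\<Sum>j\<in>J. LINT \<zeta>:z j ` U j|lborel. ?k j \<zeta>) +
     (\<Sum>j\<in>J. LINT \<zeta>:z j ` U j|lborel. \<omega> j (U j, z j) (inv_into (U j) (z j) \<zeta>)) = 0"
    unfolding of_real_sum sum.distrib[symmetric] using local by (intro sum.neutral) auto
  then have sum0: "(\<Sum>j\<in>J. LINT \<zeta>:z j ` U j|lborel. ?k j \<zeta>) = 0" using \<omega>sum by (simp only: add_0_right of_real_eq_0_iff)
  have knn: "0 \<le> ?k j \<zeta>" if "j \<in> J" "\<zeta> \<in> z j ` U j" for j \<zeta>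
    using \<theta>nn[OF that(1)] nonneg[OF Uz[OF that(1)] chart_inv(7)[OF A Uz[OF that(1)] that(2)]] by simp
  have "0 \<le> (LINT \<zeta>:z j ` U j|lborel. ?k j \<zeta>)" if "j \<in> J" for j
    unfolding set_lebesgue_integral_def using knn[OF that] by (intro integral_nonneg_AE AE_I2) (auto simp: indicator_def)
  then have k0: "(LINT \<zeta>:z j ` U j|lborel. ?k j \<zeta>) = 0" if "j \<in> J" for j
    using sum0 J that by (subst (asm) sum_nonneg_eq_0_iff) auto
  obtain j where j: "j \<in> J" "\<theta> j x \<noteq> 0"
    using \<theta>1[OF x] by (metis sum.neutral zero_neq_one)
  then have xU: "x \<in> U j" using \<theta>0 K(2) by blast
  have "?k j (z j x) = 0"
    by (rule continuous_nonneg_integral_eq_0[OF chart_inv(2)[OF A Uz[OF j(1)]] _ knn[OF j(1)] _ k0[OF j(1)]])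
      (use local[OF j(1)] xU in auto)
  then have "\<kappa> (U j, z j) x = 0" using j(2) chart_inv(5)[OF A Uz[OF j(1)] xU] by simp
  then show ?thesis using Uz[OF j(1)] xU by blast
qed

text \<open>
  The local forms \<open>\<eta>\<^sub>\<alpha> = \<Sum>\<^sub>k cnj f\<^sub>k df\<^sub>k\<close> satisfy \<open>\<eta>\<^sub>\<beta> - \<eta>\<^sub>\<alpha> = dH\<^sub>\<alpha>\<^sub>\<beta>\<close> on overlaps. As \<open>H\<close> is a cocycle, a partition of unity
  writes it as a difference \<open>r\<^sub>\<beta> - r\<^sub>\<alpha>\<close> of functions of class \<open>C\<^sup>2\<close>. Then the \<open>\<eta>\<^sub>\<alpha> - dr\<^sub>\<alpha>\<close> agree on overlaps and form a global form
  whose differential is still that of \<open>\<eta>\<^sub>\<alpha>\<close>, namely \<open>2\<i> \<Sum>\<^sub>k \<bar>f\<^sub>k'\<bar>\<^sup>2 dx dy\<close>. So \<open>stokes_nonneg\<close> applies.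
\<close>

lemma locally_constant_of_exact_cocycle:
  fixes X :: "'a::t2_space set" and f :: "'a chart \<Rightarrow> 'k \<Rightarrow> 'a \<Rightarrow> complex" and H :: "'a chart \<Rightarrow> 'a chart \<Rightarrow> 'a \<Rightarrow> complex"
  assumes A: "complex_atlas X A" and X: "compact X" and I: "finite I"
    and f: "\<And>U z k. (U, z) \<in> A \<Longrightarrow> k \<in> I \<Longrightarrow> (\<lambda>\<zeta>. f (U, z) k (inv_into U z \<zeta>)) holomorphic_on z ` U"
    and H: "\<And>U z V w. (U, z) \<in> A \<Longrightarrow> (V, w) \<in> A \<Longrightarrow>
      (\<lambda>\<zeta>. H (U, z) (V, w) (inv_into U z \<zeta>)) holomorphic_on z ` (U \<inter> V)"
    and cocycle: "\<And>\<alpha> \<beta> \<gamma> x. \<alpha> \<in> A \<Longrightarrow> \<beta> \<in> A \<Longrightarrow> \<gamma> \<in> A \<Longrightarrow> x \<in> fst \<alpha> \<Longrightarrow> x \<in> fst \<beta> \<Longrightarrow> x \<in> fst \<gamma> \<Longrightarrow>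
      H \<alpha> \<gamma> x = H \<alpha> \<beta> x + H \<beta> \<gamma> x"
    and dH: "\<And>U z V w x. (U, z) \<in> A \<Longrightarrow> (V, w) \<in> A \<Longrightarrow> x \<in> U \<Longrightarrow> x \<in> V \<Longrightarrow>
      deriv (\<lambda>\<zeta>. H (U, z) (V, w) (inv_into U z \<zeta>)) (z x) =
        (\<Sum>k\<in>I. cnj (f (V, w) k x) * deriv (\<lambda>\<zeta>. f (V, w) k (inv_into U z \<zeta>)) (z x)) -
        (\<Sum>k\<in>I. cnj (f (U, z) k x) * deriv (\<lambda>\<zeta>. f (U, z) k (inv_into U z \<zeta>)) (z x))"
    and x: "x \<in> X"
  shows "\<exists>(U, z)\<in>A. x \<in> U \<and> (\<forall>k\<in>I. deriv (\<lambda>\<zeta>. f (U, z) k (inv_into U z \<zeta>)) (z x) = 0)"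
proof -
  obtain J U z K \<theta> where J: "finite (J :: 'a set)" and Uz: "\<And>j. j \<in> J \<Longrightarrow> (U j, z j) \<in> A"
    and K: "\<And>j. j \<in> J \<Longrightarrow> compact (K j)" "\<And>j. j \<in> J \<Longrightarrow> K j \<subseteq> U j"
    and \<theta>0: "\<And>j y. j \<in> J \<Longrightarrow> y \<notin> K j \<Longrightarrow> \<theta> j y = 0" and \<theta>nn: "\<And>j y. j \<in> J \<Longrightarrow> 0 \<le> (\<theta> j y :: real)"
    and \<theta>1: "\<And>y. y \<in> X \<Longrightarrow> (\<Sum>j\<in>J. \<theta> j y) = 1"
    and \<theta>C2: "\<And>j V w. j \<in> J \<Longrightarrow> (V, w) \<in> A \<Longrightarrow> C2_on (w ` V) (\<lambda>\<zeta>. of_real (\<theta> j (inv_into V w \<zeta>)))"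
    by (rule partition_of_unity[OF A X]) (rule that; assumption)
  \<comment> \<open>outside of \<open>U\<^sub>j\<close>, where \<open>\<theta>\<^sub>j\<close> vanishes, \<open>H\<close> has no meaning\<close>
  define r where "r \<alpha> y = - (\<Sum>j\<in>J. of_real (\<theta> j y) * (if y \<in> U j then H \<alpha> (U j, z j) y else 0))" for \<alpha> y
  have r_diff: "r \<beta> y = r \<alpha> y + H \<alpha> \<beta> y" if \<alpha>: "\<alpha> \<in> A" "y \<in> fst \<alpha>" and \<beta>: "\<beta> \<in> A" "y \<in> fst \<beta>" and y: "y \<in> X" for \<alpha> \<beta> y
  proof -
    have "of_real (\<theta> j y) * (if y \<in> U j then H \<alpha> (U j, z j) y else 0) =
        of_real (\<theta> j y) * (if y \<in> U j then H \<beta> (U j, z j) y else 0) + of_real (\<theta> j y) * H \<alpha> \<beta> y" if j: "j \<in> J" for j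
    proof (cases "y \<in> U j")
      case True
      then show ?thesis using cocycle[OF \<alpha>(1) \<beta>(1) Uz[OF j] \<alpha>(2) \<beta>(2)] by (simp add: algebra_simps)
    next
      case False
      then have "\<theta> j y = 0" using \<theta>0[OF j] K(2)[OF j] by blast
      then show ?thesis by simp
    qed
    then have "- r \<alpha> y = - r \<beta> y + (\<Sum>j\<in>J. of_real (\<theta> j y) * H \<alpha> \<beta> y)"
      unfolding r_def by (simp add: sum.distrib)
    also have "(\<Sum>j\<in>J. of_real (\<theta> j y) * H \<alpha> \<beta> y) = H \<alpha> \<beta> y"
      using \<theta>1[OF y] by (metis mult_1 of_real_1 of_real_sum sum_distrib_right)
    finally show ?thesis by (simp add: algebra_simps)
  qed
  have "C2_on (w ` V) (\<lambda>\<zeta>. r (V, w) (inv_into V w \<zeta>))" if V: "(V, w) \<in> A" for V w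
  proof -
    note d = chart_inv[OF A V]
    let ?t = "\<lambda>j \<zeta>. complex_of_real (\<theta> j (inv_into V w \<zeta>)) * (if inv_into V w \<zeta> \<in> U j then H (V, w) (U j, z j) (inv_into V w \<zeta>) else 0)"
    have s: "C2_on (w ` V) (?t j)" if j: "j \<in> J" for j
    proof -
      note o = chart_transition(1)[OF A V Uz[OF j]]
      have "C2_on (w ` (V \<inter> U j)) (\<lambda>\<zeta>. complex_of_real (\<theta> j (inv_into V w \<zeta>)) * H (V, w) (U j, z j) (inv_into V w \<zeta>))"
        by (intro C2_on_mult C2_on_holomorphic[OF H[OF V Uz[OF j]] o] C2_on_subset[OF \<theta>C2[OF j V]]) auto
      then have 1: "C2_on (w ` (V \<inter> U j)) (?t j)"
        by (rule C2_on_transform[OF _ o]) (use d(5) in auto)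
      have "openin (top_of_set X) (V - K j)"
        using openin_diff[OF d(1) closed_subset[OF _ compact_imp_closed[OF K(1)[OF j]]]] K(2)[OF j] chart_inv(8)[OF A Uz[OF j]]
        by auto
      then have o': "open (w ` (V - K j))" by (rule chart_open_image[OF A V]) auto
      have 2: "C2_on (w ` (V - K j)) (?t j)"
        by (rule C2_on_transform[OF C2_on_const[of _ 0] o']) (use d(5) \<theta>0[OF j] in auto)
      have "w ` (V \<inter> U j) \<union> w ` (V - K j) = w ` V" using K(2)[OF j] by auto
      then show ?thesis using C2_on_Un[OF 1 2 o o'] by simp
    qed
    have "C2_on (w ` V) (\<lambda>\<zeta>. (-1) * (\<Sum>j\<in>J. ?t j \<zeta>))"
      by (rule C2_on_mult[OF C2_on_const C2_on_sum]) (rule s)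
    then show ?thesis by (simp add: r_def)
  qed
  then have "\<forall>\<alpha>. \<exists>a b p c q. \<alpha> \<in> A \<longrightarrow> wirtinger (snd \<alpha> ` fst \<alpha>) (\<lambda>\<zeta>. r \<alpha> (inv_into (fst \<alpha>) (snd \<alpha>) \<zeta>)) a b \<and>
      wirtinger (snd \<alpha> ` fst \<alpha>) a p c \<and> wirtinger (snd \<alpha> ` fst \<alpha>) b c q"
    unfolding C2_on_def by force
  then obtain ra rb rp rc rq where "\<forall>\<alpha>. \<alpha> \<in> A \<longrightarrow> wirtinger (snd \<alpha> ` fst \<alpha>) (\<lambda>\<zeta>. r \<alpha> (inv_into (fst \<alpha>) (snd \<alpha>) \<zeta>)) (ra \<alpha>) (rb \<alpha>) \<and>
      wirtinger (snd \<alpha> ` fst \<alpha>) (ra \<alpha>) (rp \<alpha>) (rc \<alpha>) \<and> wirtinger (snd \<alpha> ` fst \<alpha>) (rb \<alpha>) (rc \<alpha>) (rq \<alpha>)"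
    by metis
  then have r: "wirtinger (w ` V) (\<lambda>\<zeta>. r (V, w) (inv_into V w \<zeta>)) (ra (V, w)) (rb (V, w))"
      "wirtinger (w ` V) (ra (V, w)) (rp (V, w)) (rc (V, w))" "wirtinger (w ` V) (rb (V, w)) (rc (V, w)) (rq (V, w))"
    if "(V, w) \<in> A" for V w using that by force+
  let ?f = "\<lambda>V w k \<zeta>. f (V, w) k (inv_into V w \<zeta>)"
  define a where "a \<alpha> y = (\<Sum>k\<in>I. cnj (f \<alpha> k y) * deriv (\<lambda>\<zeta>. f \<alpha> k (inv_into (fst \<alpha>) (snd \<alpha>) \<zeta>)) (snd \<alpha> y)) - ra \<alpha> (snd \<alpha> y)" for \<alpha> y
  define b where "b \<alpha> y = - rb \<alpha> (snd \<alpha> y)" for \<alpha> and y :: 'a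
  define \<kappa> where "\<kappa> \<alpha> y = (\<Sum>k\<in>I. (cmod (deriv (\<lambda>\<zeta>. f \<alpha> k (inv_into (fst \<alpha>) (snd \<alpha>) \<zeta>)) (snd \<alpha> y)))\<^sup>2)" for \<alpha> and y :: 'a
  have "\<exists>(U, z)\<in>A. x \<in> U \<and> \<kappa> (U, z) x = 0"
  proof (rule stokes_nonneg[OF A X _ _ _ x])
    fix V w assume V: "(V, w) \<in> A"
    note d = chart_inv[OF A V]
    have fw: "wirtinger (w ` V) (?f V w k) (deriv (?f V w k)) (\<lambda>_. 0)"
      "wirtinger (w ` V) (deriv (?f V w k)) (deriv (deriv (?f V w k))) (\<lambda>_. 0)" if "k \<in> I" for k
      using wirtinger_holomorphic[OF f[OF V that] d(2)] wirtinger_holomorphic[OF holomorphic_deriv[OF f[OF V that] d(2)] d(2)] by auto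
    have "wirtinger (w ` V) (\<lambda>\<zeta>. (\<Sum>k\<in>I. cnj (?f V w k \<zeta>) * deriv (?f V w k) \<zeta>) + - ra (V, w) \<zeta>)
      (\<lambda>\<zeta>. (\<Sum>k\<in>I. cnj 0 * deriv (?f V w k) \<zeta> + cnj (?f V w k \<zeta>) * deriv (deriv (?f V w k)) \<zeta>) + - rp (V, w) \<zeta>)
      (\<lambda>\<zeta>. (\<Sum>k\<in>I. cnj (deriv (?f V w k) \<zeta>) * deriv (?f V w k) \<zeta> + cnj (?f V w k \<zeta>) * 0) + - rc (V, w) \<zeta>)"
      by (intro wirtinger_add wirtinger_sum wirtinger_mult wirtinger_cnj wirtinger_uminus fw r V)
    then have 1: "wirtinger (w ` V) (\<lambda>\<zeta>. a (V, w) (inv_into V w \<zeta>))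
      (\<lambda>\<zeta>. (\<Sum>k\<in>I. cnj 0 * deriv (?f V w k) \<zeta> + cnj (?f V w k \<zeta>) * deriv (deriv (?f V w k)) \<zeta>) + - rp (V, w) \<zeta>)
      (\<lambda>\<zeta>. (\<Sum>k\<in>I. cnj (deriv (?f V w k) \<zeta>) * deriv (?f V w k) \<zeta> + cnj (?f V w k \<zeta>) * 0) + - rc (V, w) \<zeta>)"
      by (rule wirtinger_transform[OF _ d(2)]) (simp add: a_def d(6))
    have 2: "wirtinger (w ` V) (\<lambda>\<zeta>. b (V, w) (inv_into V w \<zeta>)) (\<lambda>\<zeta>. - rc (V, w) \<zeta>) (\<lambda>\<zeta>. - rq (V, w) \<zeta>)"
      by (rule wirtinger_transform[OF wirtinger_uminus[OF r(3)[OF V]] d(2)]) (simp add: b_def d(6))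
    have 3: "((\<Sum>k\<in>I. cnj (deriv (?f V w k) (w y)) * deriv (?f V w k) (w y) + cnj (?f V w k (w y)) * 0) + - rc (V, w) (w y)) - (- rc (V, w) (w y)) =
        of_real (\<kappa> (V, w) y)" for y
      by (simp add: \<kappa>_def complex_norm_square mult.commute del: of_real_power)
    show "\<exists>p q p' q'. wirtinger (w ` V) (\<lambda>\<zeta>. a (V, w) (inv_into V w \<zeta>)) p q \<and>
      wirtinger (w ` V) (\<lambda>\<zeta>. b (V, w) (inv_into V w \<zeta>)) p' q' \<and> (\<forall>y\<in>V. q (w y) - p' (w y) = of_real (\<kappa> (V, w) y))"
      using 1 2 3 by blast
    show "0 \<le> \<kappa> (V, w) y" for y by (simp add: \<kappa>_def sum_nonneg)
    fix V' w' y assume V': "(V', w') \<in> A" and y: "y \<in> V" "y \<in> V'"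
    note d' = chart_inv[OF A V'] and t = chart_transition[OF A V V']
    let ?\<tau> = "w' \<circ> inv_into V w" and ?T = "w ` (V \<inter> V')"
    have \<tau>: "inv_into V' w' (?\<tau> \<zeta>) = inv_into V w \<zeta>" "?\<tau> \<zeta> \<in> w' ` V'" if "\<zeta> \<in> ?T" for \<zeta> using that d(5) d'(5) by auto
    have wy: "w y \<in> ?T" "?\<tau> (w y) = w' y" using y d(5) by auto
    have Hh: "wirtinger ?T (\<lambda>\<zeta>. H (V, w) (V', w') (inv_into V w \<zeta>)) (deriv (\<lambda>\<zeta>. H (V, w) (V', w') (inv_into V w \<zeta>))) (\<lambda>_. 0)"
      by (rule wirtinger_holomorphic[OF H[OF V V'] t(1)])
    \<comment> \<open>the differential of \<open>r\<close> for the second chart, computed in the first chart in two ways\<close>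
    have W: "wirtinger ?T (\<lambda>\<zeta>. r (V', w') (inv_into V' w' (?\<tau> \<zeta>))) (\<lambda>\<zeta>. ra (V', w') (?\<tau> \<zeta>) * deriv ?\<tau> \<zeta>)
       (\<lambda>\<zeta>. rb (V', w') (?\<tau> \<zeta>) * cnj (deriv ?\<tau> \<zeta>))"
      by (rule wirtinger_compose[OF r(1)[OF V'] t(2,1)]) (use \<tau>(2) in blast)
    have W': "wirtinger ?T (\<lambda>\<zeta>. r (V', w') (inv_into V' w' (?\<tau> \<zeta>)))
       (\<lambda>\<zeta>. ra (V, w) \<zeta> + deriv (\<lambda>\<zeta>. H (V, w) (V', w') (inv_into V w \<zeta>)) \<zeta>) (\<lambda>\<zeta>. rb (V, w) \<zeta> + 0)"
    proof (rule wirtinger_transform[OF wirtinger_add[OF wirtinger_subset[OF r(1)[OF V]] Hh] t(1)])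
      fix \<zeta> assume \<zeta>: "\<zeta> \<in> ?T"
      then have "inv_into V w \<zeta> \<in> V \<inter> V'" using d(5) by auto
      then show "r (V, w) (inv_into V w \<zeta>) + H (V, w) (V', w') (inv_into V w \<zeta>) = r (V', w') (inv_into V' w' (?\<tau> \<zeta>))"
        using \<tau>(1)[OF \<zeta>] r_diff[OF V _ V'] d(8) by auto
    qed auto
    have eq: "ra (V', w') (w' y) * deriv ?\<tau> (w y) = ra (V, w) (w y) + deriv (\<lambda>\<zeta>. H (V, w) (V', w') (inv_into V w \<zeta>)) (w y)"
      "rb (V', w') (w' y) * cnj (deriv ?\<tau> (w y)) = rb (V, w) (w y)"
      using wirtinger_unique[OF W W' wy(1)] unfolding wy(2) by simp_all
    have chain: "deriv (\<lambda>\<zeta>. f (V', w') k (inv_into V w \<zeta>)) (w y) = deriv (?f V' w' k) (w' y) * deriv ?\<tau> (w y)" if k: "k \<in> I" for k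
    proof (rule DERIV_imp_deriv)
      have "(?f V' w' k \<circ> ?\<tau> has_field_derivative deriv (?f V' w' k) (?\<tau> (w y)) * deriv ?\<tau> (w y)) (at (w y))"
        by (rule DERIV_chain[OF holomorphic_derivI[OF f[OF V' k] d'(2)] holomorphic_derivI[OF t(2,1)]]) (use wy y in auto)
      then have "(?f V' w' k \<circ> ?\<tau> has_field_derivative deriv (?f V' w' k) (w' y) * deriv ?\<tau> (w y)) (at (w y))"
        using wy(2) by simp
      then show "((\<lambda>\<zeta>. f (V', w') k (inv_into V w \<zeta>)) has_field_derivative deriv (?f V' w' k) (w' y) * deriv ?\<tau> (w y)) (at (w y))"
        by (rule has_field_derivative_transform_within_open[OF _ t(1) wy(1)]) (use \<tau>(1) in auto)
    qed
    have "a (V, w) y = (\<Sum>k\<in>I. cnj (f (V', w') k y) * deriv (\<lambda>\<zeta>. f (V', w') k (inv_into V w \<zeta>)) (w y)) -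
        deriv (\<lambda>\<zeta>. H (V, w) (V', w') (inv_into V w \<zeta>)) (w y) - ra (V, w) (w y)"
      using dH[OF V V' y] by (simp add: a_def)
    also have "\<dots> = (\<Sum>k\<in>I. cnj (f (V', w') k y) * deriv (?f V' w' k) (w' y)) * deriv ?\<tau> (w y) - ra (V', w') (w' y) * deriv ?\<tau> (w y)"
      unfolding eq(1) by (simp add: chain sum_distrib_right mult.assoc)
    finally show "a (V, w) y = a (V', w') y * deriv ?\<tau> (w y) \<and> b (V, w) y = b (V', w') y * cnj (deriv ?\<tau> (w y))"
      using eq(2) by (simp add: a_def b_def algebra_simps)
  qed
  then show ?thesis
  proof (elim bexE case_prodE conjE)
    fix \<alpha> V w assume V: "\<alpha> \<in> A" "\<alpha> = (V, w)" "x \<in> V" "\<kappa> (V, w) x = 0"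
    then have "\<forall>k\<in>I. deriv (?f V w k) (w x) = 0"
      using I by (simp add: \<kappa>_def sum_nonneg_eq_0_iff)
    then show ?thesis using V by blast
  qed
qed

section \<open>Central extensions of free groups split\<close>

lemma free_group_simps:
  "carrier (free_group I) = {w. fst ` set w \<subseteq> I \<and> reduced_word w}"
  "v \<otimes>\<^bsub>free_group I\<^esub> w = foldr push_letter v w" "\<one>\<^bsub>free_group I\<^esub> = []"
  by (simp_all add: free_group_def)

lemma inv_letter_inv_letter [simp]: "inv_letter (inv_letter x) = x"
  by (simp add: inv_letter_def)

lemma fst_inv_letter [simp]: "fst (inv_letter x) = fst x"
  by (simp add: inv_letter_def)

lemma reduced_word_Nil [simp]: "reduced_word []" by (simp add: reduced_word_def)

lemma reduced_word_single [simp]: "reduced_word [x]" by (simp add: reduced_word_def)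

lemma reduced_word_ConsD: "reduced_word (x # w) \<Longrightarrow> reduced_word w"
  by (cases w) (simp_all add: reduced_word_def)

lemma push_letter_reduced: "reduced_word (x # w) \<Longrightarrow> push_letter x w = x # w"
  by (cases w) (simp_all add: reduced_word_def push_letter_def)

lemma push_letter_cases:
  assumes "reduced_word w"
  obtains "push_letter x w = x # w" "reduced_word (x # w)" | v where "w = inv_letter x # v" "push_letter x w = v"
proof (cases w)
  case (Cons y v)
  show ?thesis
  proof (cases "y = inv_letter x")
    case True
    then show ?thesis using Cons that(2) by (simp add: push_letter_def)
  next
    case False
    then show ?thesis using Cons that(1) assms by (simp add: push_letter_def reduced_word_def)
  qed
qed (use that(1) in \<open>simp add: push_letter_def\<close>)

lemma push_letter_in_free_group:
  assumes "w \<in> carrier (free_group I)" "fst x \<in> I" shows "push_letter x w \<in> carrier (free_group I)"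
proof -
  have "reduced_word w" using assms by (simp add: free_group_simps)
  then show ?thesis
    by (rule push_letter_cases[of w x])
      (use assms reduced_word_ConsD[of "inv_letter x"] in \<open>auto simp: free_group_simps\<close>)
qed

lemma free_group_mult_closed:
  assumes "v \<in> carrier (free_group I)" "w \<in> carrier (free_group I)"
  shows "v \<otimes>\<^bsub>free_group I\<^esub> w \<in> carrier (free_group I)"
  using assms(1)
proof (induction v)
  case (Cons x v)
  then have "v \<in> carrier (free_group I)" "fst x \<in> I"
    using reduced_word_ConsD[of x v] by (auto simp: free_group_simps)
  then show ?case using push_letter_in_free_group[OF Cons.IH] by (simp add: free_group_simps)
qed (use assms(2) in \<open>simp add: free_group_simps\<close>)

lemma free_group_ConsD:
  assumes "x # w \<in> carrier (free_group I)"
  shows "w \<in> carrier (free_group I)" "[x] \<in> carrier (free_group I)" "[inv_letter x] \<in> carrier (free_group I)"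
    "[x] \<otimes>\<^bsub>free_group I\<^esub> w = x # w"
  using assms reduced_word_ConsD[of x w] push_letter_reduced[of x w] by (auto simp: free_group_simps)

lemma free_group_letter_inverse: "[x] \<otimes>\<^bsub>free_group I\<^esub> [inv_letter x] = []"
  by (simp add: free_group_simps push_letter_def)

text \<open>
  A function \<open>K\<close> with \<open>K (v w) = K v + K w + \<beta> v w\<close> is determined by its values \<open>k\<close> on letters: this is its
  recursion along a reduced word.
\<close>

primrec splitting :: "('i \<times> bool \<Rightarrow> 'v::ab_group_add) \<Rightarrow> ('i word \<Rightarrow> 'i word \<Rightarrow> 'v) \<Rightarrow> 'i word \<Rightarrow> 'v" where
  "splitting k \<beta> [] = 0"
| "splitting k \<beta> (x # w) = k x + splitting k \<beta> w + \<beta> [x] w"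

text \<open>
  \<open>H\<^sup>2\<close> of a free group vanishes: \<open>\<beta>\<close> describes a central extension, and a free group lifts to each of its extensions,
  since the images of the generators can be chosen freely. In terms of \<open>K\<close>, its values on the generators are
  arbitrary (here \<open>0\<close>), and those on their inverses are then forced.
\<close>

lemma free_group_2_cocycle_splits:
  fixes \<beta> :: "'i word \<Rightarrow> 'i word \<Rightarrow> 'v::ab_group_add" and I :: "'i set"
  defines "F \<equiv> free_group I"
  assumes cocycle: "\<And>u v w. u \<in> carrier F \<Longrightarrow> v \<in> carrier F \<Longrightarrow> w \<in> carrier F \<Longrightarrow>
      \<beta> u v + \<beta> (u \<otimes>\<^bsub>F\<^esub> v) w = \<beta> v w + \<beta> u (v \<otimes>\<^bsub>F\<^esub> w)"
    and normalized: "\<And>w. w \<in> carrier F \<Longrightarrow> \<beta> [] w = 0" "\<And>w. w \<in> carrier F \<Longrightarrow> \<beta> w [] = 0"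
  obtains K where "\<And>v w. v \<in> carrier F \<Longrightarrow> w \<in> carrier F \<Longrightarrow> K (v \<otimes>\<^bsub>F\<^esub> w) = K v + K w + \<beta> v w"
proof -
  \<comment> \<open>the value on an inverse letter is forced by \<open>K [] = 0\<close>\<close>
  define k where "k x = (if snd x then 0 else - \<beta> [inv_letter x] [x])" for x
  let ?K = "splitting k \<beta>"
  have sym: "\<beta> [x] [inv_letter x] = \<beta> [inv_letter x] [x]" if "[x] \<in> carrier F" for x
  proof -
    have ix: "[inv_letter x] \<in> carrier F" using free_group_ConsD(3) that unfolding F_def by blast
    have "[inv_letter x] \<otimes>\<^bsub>F\<^esub> [x] = []"
      using free_group_letter_inverse[of I "inv_letter x"] by (simp add: F_def)
    then show ?thesis
      using cocycle[OF that ix that] free_group_letter_inverse[of I x] normalized[OF that] by (simp add: F_def)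
  qed
  have kk: "k x + k (inv_letter x) + \<beta> [x] [inv_letter x] = 0" if "[x] \<in> carrier F" for x
    using sym[OF that] by (cases x) (auto simp: k_def inv_letter_def)
  have push: "?K (push_letter x w) = k x + ?K w + \<beta> [x] w" if w: "w \<in> carrier F" and x: "fst x \<in> I" for x w
  proof -
    have "reduced_word w" using w by (simp add: F_def free_group_simps)
    then show ?thesis
    proof (rule push_letter_cases[of w x])
      fix v assume v: "w = inv_letter x # v" "push_letter x w = v"
      have X: "[x] \<in> carrier F" using x by (simp add: F_def free_group_simps)
      have V: "v \<in> carrier F" "[inv_letter x] \<in> carrier F" "[inv_letter x] \<otimes>\<^bsub>F\<^esub> v = w"
        using free_group_ConsD[of "inv_letter x" v I] w v(1) unfolding F_def by auto
      have "\<beta> [x] [inv_letter x] = \<beta> [inv_letter x] v + \<beta> [x] w"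
        using cocycle[OF X V(2,1)] free_group_letter_inverse[of I x] normalized(1)[OF V(1)] V(3) by (simp add: F_def)
      then show ?thesis using kk[OF X] v by (simp add: algebra_simps)
    qed simp
  qed
  have "?K (v \<otimes>\<^bsub>F\<^esub> w) = ?K v + ?K w + \<beta> v w" if "v \<in> carrier F" "w \<in> carrier F" for v w
    using that(1)
  proof (induction v)
    case Nil
    then show ?case using normalized(1)[OF that(2)] by (simp add: F_def free_group_simps)
  next
    case (Cons x v)
    have X: "v \<in> carrier F" "[x] \<in> carrier F" "[x] \<otimes>\<^bsub>F\<^esub> v = x # v" "fst x \<in> I"
      using free_group_ConsD[of x v I] Cons.prems unfolding F_def by (auto simp: free_group_simps)
    have vw: "v \<otimes>\<^bsub>F\<^esub> w \<in> carrier F" using free_group_mult_closed X(1) that(2) unfolding F_def by blast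
    have "(x # v) \<otimes>\<^bsub>F\<^esub> w = push_letter x (v \<otimes>\<^bsub>F\<^esub> w)" by (simp add: F_def free_group_simps)
    then have "?K ((x # v) \<otimes>\<^bsub>F\<^esub> w) = k x + (?K v + ?K w + \<beta> v w) + \<beta> [x] (v \<otimes>\<^bsub>F\<^esub> w)"
      using push[OF vw X(4)] Cons.IH[OF X(1)] by simp
    also have "\<dots> = ?K (x # v) + ?K w + \<beta> (x # v) w"
      using cocycle[OF X(2,1) that(2)] X(3) by (simp add: algebra_simps)
    finally show ?case .
  qed
  then show thesis by (rule that)
qed

section \<open>Unitary affine actions of free groups\<close>

lemma conj_transpose_nth: "conj_transpose M $ i $ j = cnj (M $ j $ i)"
  by (simp add: conj_transpose_def map_matrix_def transpose_def)

definition mat_inner :: "complex^'n^'n \<Rightarrow> complex^'n^'n \<Rightarrow> complex" where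
  "mat_inner M N = trace (M ** conj_transpose N)"

lemma mat_inner_eq: "mat_inner M N = (\<Sum>i\<in>UNIV. \<Sum>j\<in>UNIV. M $ i $ j * cnj (N $ i $ j))"
  by (simp add: mat_inner_def trace_def matrix_matrix_mult_def conj_transpose_nth)

lemma mat_inner_simps:
  "mat_inner (M + M') N = mat_inner M N + mat_inner M' N" "mat_inner M (N + N') = mat_inner M N + mat_inner M N'"
  "mat_inner M 0 = 0" "mat_inner 0 N = 0"
  by (simp_all add: mat_inner_eq algebra_simps sum.distrib)

lemma conj_transpose_mult: "conj_transpose (A ** B) = conj_transpose B ** conj_transpose (A :: complex^'n^'n)"
  by (simp add: vec_eq_iff conj_transpose_nth matrix_matrix_mult_def mult.commute)

lemma conj_transpose_conj_transpose [simp]: "conj_transpose (conj_transpose A) = A"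
  by (simp add: vec_eq_iff conj_transpose_nth)

lemma matrix_inv_eqI:
  fixes A :: "complex^'n^'n" assumes "A ** B = mat 1" "B ** A = mat 1" shows "matrix_inv A = B"
proof -
  have "A ** matrix_inv A = mat 1 \<and> matrix_inv A ** A = mat 1"
    unfolding matrix_inv_def by (rule someI[of _ B]) (use assms in auto)
  then have "B = B ** (A ** matrix_inv A)" by simp
  also have "\<dots> = (B ** A) ** matrix_inv A" by (rule matrix_mul_assoc)
  finally show ?thesis using assms(2) by simp
qed

lemma matrix_inv_inverse:
  fixes A :: "complex^'n^'n" assumes "invertible A"
  shows "A ** matrix_inv A = mat 1" "matrix_inv A ** A = mat 1"
  using assms matrix_inv_eqI unfolding invertible_def by metis+

lemma Ad_simps:
  "Ad T (M + N) = Ad T M + Ad T N" "Ad T (M - N) = Ad T M - Ad T N" "Ad T 0 = 0"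
  by (simp_all add: Ad_def vec_eq_iff matrix_matrix_mult_def algebra_simps sum.distrib sum_subtractf)

lemma Ad_mat_1 [simp]: "Ad (mat 1) M = M"
  by (simp add: Ad_def matrix_inv_eqI[of "mat 1" "mat 1"])

lemma Ad_mult:
  assumes "invertible A" "invertible B" shows "Ad (A ** B) M = Ad A (Ad B M)"
proof -
  have "A ** B ** (matrix_inv B ** matrix_inv A) = A ** (B ** matrix_inv B) ** matrix_inv A"
    "matrix_inv B ** matrix_inv A ** (A ** B) = matrix_inv B ** (matrix_inv A ** A) ** B"
    by (simp_all only: matrix_mul_assoc)
  then have "matrix_inv (A ** B) = matrix_inv B ** matrix_inv A"
    using matrix_inv_inverse[OF assms(1)] matrix_inv_inverse[OF assms(2)] by (intro matrix_inv_eqI) simp_all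
  then show ?thesis by (simp add: Ad_def matrix_mul_assoc)
qed

lemma unitary_groupD:
  assumes "U \<in> carrier unitary_group"
  shows "U ** conj_transpose U = mat 1" "conj_transpose U ** U = mat 1" "invertible U" "matrix_inv U = conj_transpose U"
  using assms matrix_inv_eqI[of U "conj_transpose U"] by (auto simp: unitary_group_def invertible_def)

lemma unitary_group_mult: "U \<in> carrier unitary_group \<Longrightarrow> V \<in> carrier unitary_group \<Longrightarrow> U ** V \<in> carrier unitary_group"
proof -
  assume "U \<in> carrier unitary_group" "V \<in> carrier unitary_group"
  note u = unitary_groupD[OF this(1)] and v = unitary_groupD[OF this(2)]
  have "U ** V ** (conj_transpose V ** conj_transpose U) = U ** (V ** conj_transpose V) ** conj_transpose U"
    "conj_transpose V ** conj_transpose U ** (U ** V) = conj_transpose V ** (conj_transpose U ** U) ** V"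
    by (simp_all only: matrix_mul_assoc)
  then show ?thesis using u v by (simp add: unitary_group_def conj_transpose_mult)
qed

lemma unitary_group_inverse:
  assumes U: "U \<in> carrier unitary_group" and "U ** V = mat 1" shows "V \<in> carrier unitary_group"
proof -
  note u = unitary_groupD[OF U]
  have "V = conj_transpose U ** U ** V" using u(2) by simp
  also have "\<dots> = conj_transpose U ** (U ** V)" by (simp only: matrix_mul_assoc)
  finally have "V = conj_transpose U" using assms(2) by simp
  then show ?thesis using u by (simp add: unitary_group_def)
qed

lemma mat_inner_Ad_unitary:
  assumes "U \<in> carrier unitary_group" shows "mat_inner (Ad U M) (Ad U N) = mat_inner M N"
proof -
  note u = unitary_groupD[OF assms]
  have "Ad U M ** conj_transpose (Ad U N) = U ** M ** (conj_transpose U ** U) ** conj_transpose N ** conj_transpose U"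
    by (simp add: Ad_def u(4) conj_transpose_mult matrix_mul_assoc)
  also have "\<dots> = U ** (M ** conj_transpose N ** conj_transpose U)" by (simp add: u(2) matrix_mul_assoc)
  finally have "mat_inner (Ad U M) (Ad U N) = trace ((M ** conj_transpose N ** conj_transpose U) ** U)"
    unfolding mat_inner_def using trace_mul_sym[of U] by simp
  also have "(M ** conj_transpose N ** conj_transpose U) ** U = M ** conj_transpose N ** (conj_transpose U ** U)"
    by (simp only: matrix_mul_assoc)
  finally show ?thesis by (simp add: mat_inner_def u(2))
qed

text \<open>
  With the hermitian form \<open>\<langle>M, N\<rangle>\<close> of \<open>mat_inner\<close>, the group \<open>F\<close> acts on matrices by the unitary affine maps
  \<open>w\<cdot>M = Ad (\<tau> w) M + e w\<close>. The functions \<open>h\<^sub>w(M) = \<langle>Ad (\<tau> w) M, e w\<rangle>\<close> nearly satisfy the cocycle identity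
  \<open>h\<^sub>v\<^sub>w(M) = h\<^sub>w(M) + h\<^sub>v(w\<cdot>M)\<close>: the defect \<open>\<langle>Ad (\<tau> v) (e w), e v\<rangle>\<close> does not depend on \<open>M\<close>. It is a 2-cocycle of \<open>F\<close>,
  the cup product of \<open>e\<close> with its conjugate, so constants \<open>K w\<close> remove it.
\<close>

lemma hermitian_cocycle_splits:
  fixes \<tau> :: "'i word \<Rightarrow> complex^'n^'n" and e :: "'i word \<Rightarrow> complex^'n^'n" and I :: "'i set"
  defines "F \<equiv> free_group I"
  assumes hom: "\<And>v w. v \<in> carrier F \<Longrightarrow> w \<in> carrier F \<Longrightarrow> \<tau> (v \<otimes>\<^bsub>F\<^esub> w) = \<tau> v ** \<tau> w"
    and unitary: "\<And>w. w \<in> carrier F \<Longrightarrow> \<tau> w \<in> carrier unitary_group"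
    and cocycle: "\<And>v w. v \<in> carrier F \<Longrightarrow> w \<in> carrier F \<Longrightarrow> e (v \<otimes>\<^bsub>F\<^esub> w) = e v + Ad (\<tau> v) (e w)"
  obtains K where "\<And>v w M. v \<in> carrier F \<Longrightarrow> w \<in> carrier F \<Longrightarrow>
    mat_inner (Ad (\<tau> (v \<otimes>\<^bsub>F\<^esub> w)) M) (e (v \<otimes>\<^bsub>F\<^esub> w)) + K (v \<otimes>\<^bsub>F\<^esub> w) =
      (mat_inner (Ad (\<tau> w) M) (e w) + K w) + (mat_inner (Ad (\<tau> v) (Ad (\<tau> w) M + e w)) (e v) + K v)"
proof -
  have closed: "v \<otimes>\<^bsub>F\<^esub> w \<in> carrier F" if "v \<in> carrier F" "w \<in> carrier F" for v w
    using that free_group_mult_closed unfolding F_def by blast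
  have nil: "[] \<in> carrier F" "[] \<otimes>\<^bsub>F\<^esub> w = w" for w by (simp_all add: F_def free_group_simps)
  have "\<tau> [] ** \<tau> [] = \<tau> []" using hom[OF nil(1) nil(1)] nil(2) by simp
  then have "conj_transpose (\<tau> []) ** \<tau> [] ** \<tau> [] = conj_transpose (\<tau> []) ** \<tau> []" by (metis matrix_mul_assoc)
  then have \<tau>1: "\<tau> [] = mat 1" using unitary_groupD(2)[OF unitary[OF nil(1)]] by simp
  have e1: "e [] = 0" using cocycle[OF nil(1) nil(1)] nil(2) \<tau>1 by simp
  have Ad: "Ad (\<tau> (v \<otimes>\<^bsub>F\<^esub> w)) M = Ad (\<tau> v) (Ad (\<tau> w) M)" if "v \<in> carrier F" "w \<in> carrier F" for v w M
    using hom[OF that] Ad_mult[OF unitary_groupD(3)[OF unitary[OF that(1)]] unitary_groupD(3)[OF unitary[OF that(2)]]] by simp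
  let ?b = "\<lambda>v w. mat_inner (Ad (\<tau> v) (e w)) (e v)"
  obtain K where K: "\<And>v w. v \<in> carrier F \<Longrightarrow> w \<in> carrier F \<Longrightarrow> K (v \<otimes>\<^bsub>F\<^esub> w) = K v + K w + ?b v w"
  proof (rule free_group_2_cocycle_splits[of I ?b, folded F_def])
    show "?b u v + ?b (u \<otimes>\<^bsub>F\<^esub> v) w = ?b v w + ?b u (v \<otimes>\<^bsub>F\<^esub> w)"
      if "u \<in> carrier F" "v \<in> carrier F" "w \<in> carrier F" for u v w
      using that by (simp add: cocycle Ad Ad_simps mat_inner_simps mat_inner_Ad_unitary unitary)
  qed (auto simp: \<tau>1 e1 Ad_simps mat_inner_simps)
  show thesis
    by (rule that[of K]) (simp add: K cocycle Ad Ad_simps mat_inner_simps mat_inner_Ad_unitary unitary)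
qed

lemma free_group_hom_unitary:
  fixes \<tau> :: "'i word \<Rightarrow> complex^'n^'n" and I :: "'i set"
  defines "F \<equiv> free_group I"
  assumes hom: "\<And>v w. v \<in> carrier F \<Longrightarrow> w \<in> carrier F \<Longrightarrow> \<tau> (v \<otimes>\<^bsub>F\<^esub> w) = \<tau> v ** \<tau> w"
    and one: "\<tau> [] = mat 1"
    and gen: "\<And>i. i \<in> I \<Longrightarrow> \<tau> (free_gen i) \<in> carrier unitary_group" and w: "w \<in> carrier F"
  shows "\<tau> w \<in> carrier unitary_group"
proof -
  have letter: "\<tau> [x] \<in> carrier unitary_group" if x: "fst x \<in> I" for x
  proof (cases "snd x")
    case True
    then have "[x] = free_gen (fst x)" by (cases x) (simp add: free_gen_def)
    then show ?thesis using gen[OF x] by simp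
  next
    case False
    then have ix: "[inv_letter x] = free_gen (fst x)" by (cases x) (simp add: free_gen_def inv_letter_def)
    have "[inv_letter x] \<in> carrier F" "[x] \<in> carrier F" using x by (simp_all add: F_def free_group_simps)
    then have "\<tau> [inv_letter x] ** \<tau> [x] = mat 1"
      using hom[of "[inv_letter x]" "[x]"] one free_group_letter_inverse[of I "inv_letter x"] by (simp add: F_def)
    then show ?thesis using unitary_group_inverse[of "\<tau> [inv_letter x]" "\<tau> [x]"] gen[OF x] ix by simp
  qed
  show ?thesis using w
  proof (induction w)
    case Nil
    have "conj_transpose (mat 1 :: complex^'n^'n) = mat 1" by (simp add: vec_eq_iff conj_transpose_nth mat_def)
    then show ?case using one by (simp add: unitary_group_def)
  next
    case (Cons x w)
    note d = free_group_ConsD[of x w I, folded F_def, OF Cons.prems]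
    have "fst x \<in> I" using Cons.prems by (simp add: F_def free_group_simps)
    then show ?case
      using hom[OF d(2,1)] d(4) unitary_group_mult[OF letter Cons.IH[OF d(1)]] by simp
  qed
qed

section \<open>Coverings of Riemann surfaces\<close>

lemma holomorphic_on_local:
  assumes "\<And>z. z \<in> S \<Longrightarrow> \<exists>W. open W \<and> z \<in> W \<and> f holomorphic_on W" shows "f holomorphic_on S"
  unfolding holomorphic_on_def
proof
  fix z assume "z \<in> S"
  then obtain W where "open W" "z \<in> W" "f holomorphic_on W" using assms by blast
  then show "f field_differentiable at z within S"
    using holomorphic_on_imp_differentiable_at field_differentiable_at_within by blast
qed

lemma continuous_on_local:
  assumes "\<And>x. x \<in> S \<Longrightarrow> \<exists>M. openin (top_of_set S) M \<and> x \<in> M \<and> continuous_on M f" shows "continuous_on S f"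
  unfolding continuous_on_def
proof
  fix x assume x: "x \<in> S"
  then obtain W where W: "open W" "x \<in> W" "continuous_on (S \<inter> W) f"
    using assms[OF x] by (auto simp: openin_open)
  have "at x within S = at x within (S \<inter> W)" by (rule at_within_nhd[OF W(2,1)]) auto
  then show "(f \<longlongrightarrow> f x) (at x within S)" using W x by (simp add: continuous_on_def)
qed

lemma atlas_locally_path_connected:
  assumes Y: "complex_atlas Y B" and N: "openin (top_of_set Y) N" "y \<in> N"
  shows "\<exists>M. openin (top_of_set Y) M \<and> y \<in> M \<and> M \<subseteq> N \<and> path_connected M"
proof -
  have "y \<in> Y" using openin_subset[OF N(1)] N(2) by auto
  then obtain U z where U: "(U, z) \<in> B" "y \<in> U" using chart_exists[OF Y] by blast
  note c = chart_inv[OF Y U(1)]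
  have o: "openin (top_of_set Y) (N \<inter> U)" using N(1) c(1) by (rule openin_Int)
  have "open (z ` (N \<inter> U))" by (rule chart_open_image[OF Y U(1) o]) simp
  moreover have "z y \<in> z ` (N \<inter> U)" using N U by blast
  ultimately obtain r where r: "r > 0" "ball (z y) r \<subseteq> z ` (N \<inter> U)" using open_contains_ball by metis
  define M where "M = U \<inter> z -` ball (z y) r"
  have M: "M = inv_into U z ` ball (z y) r"
  proof
    show "M \<subseteq> inv_into U z ` ball (z y) r" unfolding M_def using c(5) by force
    show "inv_into U z ` ball (z y) r \<subseteq> M" unfolding M_def using c(6,7) r(2) by auto
  qed
  have "openin (top_of_set U) (U \<inter> z -` ball (z y) r)" using continuous_openin_preimage_gen[OF c(3)] by simp
  then have "openin (top_of_set Y) M" unfolding M_def using c(1) openin_trans by blast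
  moreover have "y \<in> M" using U r by (simp add: M_def)
  moreover have "M \<subseteq> N" unfolding M using r(2) c(5) by auto
  moreover have "path_connected M" unfolding M
    by (intro path_connected_continuous_image continuous_on_subset[OF c(4)] convex_imp_path_connected convex_ball)
      (use r(2) in auto)
  ultimately show ?thesis by blast
qed

definition sheet_section :: "'b::topological_space set \<Rightarrow> ('b \<Rightarrow> 'a::topological_space) \<Rightarrow> 'a set \<Rightarrow> 'a set \<Rightarrow> ('a \<Rightarrow> 'b) \<Rightarrow> bool" where
  "sheet_section Y q X T s \<longleftrightarrow> openin (top_of_set X) T \<and> (\<exists>u. openin (top_of_set Y) u \<and> homeomorphism u T q s)"

lemma sheet_section:
  assumes "sheet_section Y q X T s"
  shows "openin (top_of_set X) T" "openin (top_of_set Y) (s ` T)" "s ` T \<subseteq> Y" "continuous_on T s"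
    "x \<in> T \<Longrightarrow> q (s x) = x" "y \<in> s ` T \<Longrightarrow> q y \<in> T" "y \<in> s ` T \<Longrightarrow> s (q y) = y"
proof -
  obtain u where "openin (top_of_set X) T" "openin (top_of_set Y) u" "homeomorphism u T q s"
    using assms unfolding sheet_section_def by blast
  moreover from this(3) have "u = s ` T" by (simp add: homeomorphism_def)
  ultimately show "openin (top_of_set X) T" "openin (top_of_set Y) (s ` T)" "s ` T \<subseteq> Y" "continuous_on T s"
    "x \<in> T \<Longrightarrow> q (s x) = x" "y \<in> s ` T \<Longrightarrow> q y \<in> T" "y \<in> s ` T \<Longrightarrow> s (q y) = y"
    using openin_subset[of "top_of_set Y" u] by (auto simp: homeomorphism_def)
qed

definition sheets :: "'b::topological_space set \<Rightarrow> ('b \<Rightarrow> 'a::topological_space) \<Rightarrow> 'a set \<Rightarrow> ('a set \<times> ('a \<Rightarrow> 'b) set) set" where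
  "sheets Y q X = {(T, \<S>). openin (top_of_set X) T \<and> (\<exists>v. \<Union>v = Y \<inter> q -` T \<and>
     (\<forall>u\<in>v. openin (top_of_set Y) u) \<and> pairwise disjnt v \<and> (\<forall>u\<in>v. \<exists>s. homeomorphism u T q s) \<and>
     \<S> = {s. \<exists>u\<in>v. homeomorphism u T q s})}"

lemma sheets_section: "(T, \<S>) \<in> sheets Y q X \<Longrightarrow> s \<in> \<S> \<Longrightarrow> sheet_section Y q X T s"
  unfolding sheets_def sheet_section_def by blast

text \<open>
  Sections over two evenly covered sets with a common value both invert \<open>q\<close> on an open set around that value, and so they
  agree near the point below it.
\<close>

lemma covering_local_system:
  assumes "covering_space Y q X"
  shows "local_system X (\<lambda>x. {y \<in> Y. q y = x}) (sheets Y q X)"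
proof
  fix z assume "z \<in> X"
  then obtain T v where "z \<in> T" "openin (top_of_set X) T" "\<Union>v = Y \<inter> q -` T"
     "\<forall>u\<in>v. openin (top_of_set Y) u" "pairwise disjnt v" "\<forall>u\<in>v. \<exists>s. homeomorphism u T q s"
    using assms unfolding covering_space_def by meson
  then have "(T, {s. \<exists>u\<in>v. homeomorphism u T q s}) \<in> sheets Y q X" unfolding sheets_def by blast
  then show "\<exists>(N, \<S>)\<in>sheets Y q X. z \<in> N" using \<open>z \<in> T\<close> by blast
next
  fix N \<S> assume "(N, \<S>) \<in> sheets Y q X"
  then show "openin (top_of_set X) N" by (simp add: sheets_def)
next
  fix N \<S> P z assume N: "(N, \<S>) \<in> sheets Y q X" "P \<in> \<S>" "z \<in> N"
  then show "P z \<in> {y \<in> Y. q y = z}" using sheet_section(3,5)[OF sheets_section[OF N(1,2)]] by auto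
next
  fix N \<S> z v assume N: "(N, \<S>) \<in> sheets Y q X" "z \<in> N" and v: "v \<in> {y \<in> Y. q y = z}"
  then obtain \<V> where \<V>: "\<Union>\<V> = Y \<inter> q -` N" "\<forall>u\<in>\<V>. \<exists>s. homeomorphism u N q s" "\<S> = {s. \<exists>u\<in>\<V>. homeomorphism u N q s}"
    unfolding sheets_def by blast
  have "v \<in> \<Union>\<V>" using v N(2) \<V>(1) by auto
  then obtain u s where u: "u \<in> \<V>" "v \<in> u" "homeomorphism u N q s" using \<V>(2) by blast
  then have "s z = v" using v by (auto simp: homeomorphism_def)
  then show "\<exists>P\<in>\<S>. P z = v" using u \<V>(3) by blast
next
  fix N \<S> P P' z z' assume N: "(N, \<S>) \<in> sheets Y q X" "P \<in> \<S>" "P' \<in> \<S>" "z \<in> N" "z' \<in> N" "P z = P' z"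
  then obtain \<V> where \<V>: "pairwise disjnt \<V>" "\<S> = {s. \<exists>u\<in>\<V>. homeomorphism u N q s}"
    unfolding sheets_def by blast
  obtain u u' where u: "u \<in> \<V>" "homeomorphism u N q P" "u' \<in> \<V>" "homeomorphism u' N q P'" using N \<V>(2) by blast
  then have "P z \<in> u" "P z \<in> u'" using N by (auto simp: homeomorphism_def)
  then have "u = u'" using \<V>(1) u unfolding pairwise_def disjnt_def by blast
  then have "P z' \<in> u" "q (P z') = z'" "P' (q (P z')) = P z'" using u N by (auto simp: homeomorphism_def)
  then show "P z' = P' z'" by simp
next
  fix N \<S> N' \<S>' P P' z
  assume N: "(N, \<S>) \<in> sheets Y q X" "(N', \<S>') \<in> sheets Y q X" "P \<in> \<S>" "P' \<in> \<S>'" "z \<in> N" "z \<in> N'" "P z = P' z"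
  note u = sheet_section[OF sheets_section[OF N(1,3)]] and u' = sheet_section[OF sheets_section[OF N(2,4)]]
  let ?u' = "P' ` N'"
  have "P \<in> N \<rightarrow> Y" using u(3) by auto
  from continuous_openin_preimage[OF u(4) this u'(2)] have "openin (top_of_set X) (N \<inter> P -` ?u')"
    using u(1) openin_trans by blast
  moreover have "P y = P' y" if "y \<in> N \<inter> P -` ?u'" for y
  proof -
    have "q (P y) = y" "P' (q (P y)) = P y" using u(5) u'(7) that by blast+
    then show ?thesis by simp
  qed
  moreover have "z \<in> N \<inter> P -` ?u'" using N(5-7) by simp
  ultimately show "\<exists>M. openin (top_of_set X) M \<and> z \<in> M \<and> (\<forall>y\<in>M. P y = P' y)" by blast
qed

locale covering_surface =
  fixes X :: "'a::t2_space set" and A :: "'a chart set" and Y :: "'b::t2_space set" and B :: "'b chart set" and q :: "'b \<Rightarrow> 'a"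
  assumes X: "riemann_surface X A" and YX: "universal_cover Y B q X A"
begin

lemma atlas: "complex_atlas X A" "complex_atlas Y B"
  using X YX by (auto simp: riemann_surface_def universal_cover_def)

lemma covering: "covering_space Y q X" using YX by (simp add: universal_cover_def)

lemma connected_Y: "connected Y" using YX by (simp add: universal_cover_def riemann_surface_def)

lemma simply_connected_Y: "simply_connected Y" using YX by (simp add: universal_cover_def)

lemma q: "continuous_on Y q" "q ` Y = X" "y \<in> Y \<Longrightarrow> q y \<in> X"
  using covering by (auto simp: covering_space_def)

lemma q_holomorphic:
  assumes "(V, w) \<in> B" "(U, z) \<in> A" shows "(z \<circ> q \<circ> inv_into V w) holomorphic_on w ` (V \<inter> q -` U)"
  using YX assms unfolding universal_cover_def holomorphic_map_def by blast

sublocale sheaf: local_system X "\<lambda>x. {y \<in> Y. q y = x}" "sheets Y q X"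
  by (rule covering_local_system[OF covering])

lemma section_through:
  assumes "y \<in> Y" obtains T s where "sheet_section Y q X T s" "q y \<in> T" "s (q y) = y"
proof -
  obtain T \<S> where T: "(T, \<S>) \<in> sheets Y q X" "q y \<in> T" using sheaf.cover[OF q(3)[OF assms]] by blast
  obtain s where "s \<in> \<S>" "s (q y) = y" using sheaf.section_through[OF T, of y] assms by auto
  then show thesis using that sheets_section[OF T(1)] T(2) by blast
qed

lemma lifts_continuous:
  assumes "sheaf.lifts S H u" "continuous_on S H" shows "continuous_on S u"
proof (rule continuous_on_local)
  fix x assume "x \<in> S"
  then obtain N \<S> P M where *: "(N, \<S>) \<in> sheets Y q X" "P \<in> \<S>" "openin (top_of_set S) M" "x \<in> M"
    "\<forall>x'\<in>M. H x' \<in> N \<and> u x' = P (H x')" using assms(1) unfolding sheaf.lifts_def by fast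
  have "continuous_on N P" using sheet_section(4)[OF sheets_section[OF *(1,2)]] .
  moreover have "continuous_on M H" using continuous_on_subset[OF assms(2)] openin_subset[OF *(3)] by auto
  ultimately have "continuous_on M (P \<circ> H)" using *(5) by (intro continuous_on_compose) (auto intro: continuous_on_subset)
  then have "continuous_on M u" using *(5) by (simp cong: continuous_on_cong)
  then show "\<exists>M. openin (top_of_set S) M \<and> x \<in> M \<and> continuous_on M u" using * by blast
qed

text \<open>
  Near each point, a continuous \<open>u\<close> stays in the sheet through its value there, and on this sheet \<open>u\<close> is recovered from
  \<open>q \<circ> u\<close> by the section.
\<close>

lemma liftsI:
  assumes u: "continuous_on S u" "u \<in> S \<rightarrow> Y" and H: "\<And>x. x \<in> S \<Longrightarrow> q (u x) = H x"
  shows "sheaf.lifts S H u"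
  unfolding sheaf.lifts_def
proof
  fix x assume x: "x \<in> S"
  have Hx: "H x \<in> X" using q(3) u(2) H x by force
  obtain N \<S> where N: "(N, \<S>) \<in> sheets Y q X" "H x \<in> N" using sheaf.cover[OF Hx] by blast
  have "u x \<in> Y" using u(2) x by blast
  then obtain P where P: "P \<in> \<S>" "P (H x) = u x" using sheaf.section_through[OF N, of "u x"] H x by auto
  note v = sheet_section[OF sheets_section[OF N(1) P(1)]]
  let ?v = "P ` N"
  have 1: "openin (top_of_set S) (S \<inter> u -` ?v)" using continuous_openin_preimage[OF u v(2)] .
  have 2: "x \<in> S \<inter> u -` ?v" using x N(2) P(2)[symmetric] by auto
  have 3: "\<forall>x'\<in>S \<inter> u -` ?v. H x' \<in> N \<and> u x' = P (H x')"
  proof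
    fix x' assume x': "x' \<in> S \<inter> u -` ?v"
    have e: "q (u x') = H x'" using H x' by blast
    have uv: "u x' \<in> ?v" using x' by blast
    have "q (u x') \<in> N" by (rule v(6)[OF uv])
    moreover have "P (q (u x')) = u x'" by (rule v(7)[OF uv])
    ultimately show "H x' \<in> N \<and> u x' = P (H x')" unfolding e by metis
  qed
  show "\<exists>(N, \<S>)\<in>sheets Y q X. \<exists>P\<in>\<S>. \<exists>M. openin (top_of_set S) M \<and> x \<in> M \<and> (\<forall>x'\<in>M. H x' \<in> N \<and> u x' = P (H x'))"
    by (rule bexI[OF _ N(1)], rule case_prodI, rule bexI[OF _ P(1)], rule exI[of _ "S \<inter> u -` ?v"]) (intro conjI 1 2 3)
qed

text \<open>
  The section inverts \<open>q\<close> on a sheet, and the inverse of an injective holomorphic function is holomorphic.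
\<close>

lemma section_holomorphic:
  assumes s: "sheet_section Y q X T s" and U: "(U, z) \<in> A" and V: "(V, w) \<in> B"
  shows "open (z ` (U \<inter> T \<inter> s -` V))" "(w \<circ> s \<circ> inv_into U z) holomorphic_on z ` (U \<inter> T \<inter> s -` V)"
proof -
  define u where "u = s ` T"
  note sec = sheet_section[OF s, folded u_def]
  have u: "openin (top_of_set X) T" "openin (top_of_set Y) u" "u \<subseteq> Y" "continuous_on T s" "s ` T = u"
    "\<And>x. x \<in> T \<Longrightarrow> q (s x) = x" "\<And>y. y \<in> u \<Longrightarrow> q y \<in> T" "\<And>y. y \<in> u \<Longrightarrow> s (q y) = y"
    by (fact sec u_def[symmetric])+
  note c = chart_inv[OF atlas(1) U] and d = chart_inv[OF atlas(2) V]
  let ?g = "z \<circ> q \<circ> inv_into V w" and ?O = "V \<inter> u \<inter> q -` U"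
  have "openin (top_of_set Y) (Y \<inter> q -` U)"
    using continuous_openin_preimage[OF q(1) _ c(1)] q(3) by blast
  from openin_Int[OF openin_Int[OF d(1) u(2)] this] have "openin (top_of_set Y) (V \<inter> u \<inter> (Y \<inter> q -` U))" .
  moreover have "V \<inter> u \<inter> (Y \<inter> q -` U) = ?O" using u(3) by auto
  ultimately have "open (w ` ?O)" by (intro chart_open_image[OF atlas(2) V]) auto
  moreover have "?g holomorphic_on w ` ?O" by (rule holomorphic_on_subset[OF q_holomorphic[OF V U]]) auto
  moreover have "inj_on ?g (w ` ?O)"
  proof (rule inj_onI)
    fix \<xi> \<eta> assume *: "\<xi> \<in> w ` ?O" "\<eta> \<in> w ` ?O" "?g \<xi> = ?g \<eta>"
    then obtain y y' where y: "y \<in> ?O" "y' \<in> ?O" "\<xi> = w y" "\<eta> = w y'" by blast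
    then have "z (q y) = z (q y')" using *(3) d(5) by simp
    then have "q y = q y'" using c(5) y by (metis IntD2 vimageD)
    then have "y = y'" using u(8) y by (metis IntD1 IntD2)
    then show "\<xi> = \<eta>" using y by simp
  qed
  ultimately obtain h where h: "h holomorphic_on ?g ` (w ` ?O)" "\<And>\<xi>. \<xi> \<in> w ` ?O \<Longrightarrow> h (?g \<xi>) = \<xi>" "open (?g ` (w ` ?O))"
    using holomorphic_has_inverse open_mapping_thm3 by metis
  have im: "?g ` (w ` ?O) = z ` (U \<inter> T \<inter> s -` V)"
  proof -
    have "?g ` (w ` ?O) = z ` q ` ?O" using d(5) by (auto simp: image_image intro!: image_cong)
    also have "q ` ?O = U \<inter> T \<inter> s -` V"
    proof
      show "q ` ?O \<subseteq> U \<inter> T \<inter> s -` V" using u(7,8) by auto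
      show "U \<inter> T \<inter> s -` V \<subseteq> q ` ?O"
      proof
        fix x assume "x \<in> U \<inter> T \<inter> s -` V"
        then have "s x \<in> ?O" "q (s x) = x" using u(5,6) by auto
        then show "x \<in> q ` ?O" by (metis imageI)
      qed
    qed
    finally show ?thesis .
  qed
  show "open (z ` (U \<inter> T \<inter> s -` V))" using h(3) im by simp
  show "(w \<circ> s \<circ> inv_into U z) holomorphic_on z ` (U \<inter> T \<inter> s -` V)"
  proof (rule holomorphic_transform[OF h(1)[unfolded im]])
    fix \<zeta> assume "\<zeta> \<in> z ` (U \<inter> T \<inter> s -` V)"
    then obtain x where x: "x \<in> U \<inter> T \<inter> s -` V" "\<zeta> = z x" by blast
    then have "s x \<in> ?O" "?g (w (s x)) = \<zeta>" using u(5,6) d(5) by auto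
    then have "h \<zeta> = w (s x)" using h(2)[of "w (s x)"] by auto
    then show "h \<zeta> = (w \<circ> s \<circ> inv_into U z) \<zeta>" using x c(5) by simp
  qed
qed

subsection \<open>Deck transformations\<close>

lemma deckD:
  assumes "T \<in> deck_transformations Y q"
  shows "continuous_on Y T" "T \<in> Y \<rightarrow> Y" "\<And>y. y \<in> Y \<Longrightarrow> q (T y) = q y" "T \<in> extensional Y"
  using assms by (auto simp: deck_transformations_def Bij_def homeomorphism_def)

lemma deck_lifts: "T \<in> deck_transformations Y q \<Longrightarrow> sheaf.lifts Y q T"
  using liftsI[of Y T q] deckD by blast

lemma lifts_q_unique:
  assumes "sheaf.lifts Y q T" "sheaf.lifts Y q T'" "y \<in> Y" "T y = T' y" "y' \<in> Y" shows "T y' = T' y'"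
  using sheaf.lifts_unique[OF connected_Y q(1) _ assms(1,2,3,4,5)] q(3) by blast

lemma deck_unique:
  assumes "T \<in> deck_transformations Y q" "T' \<in> deck_transformations Y q" "y \<in> Y" "T y = T' y" shows "T = T'"
  using lifts_q_unique[OF deck_lifts deck_lifts] assms extensionalityI[OF deckD(4) deckD(4)] by metis

text \<open>
  Lifting the projection \<open>q\<close> itself through \<open>q\<close> gives maps that send \<open>y\<close> to \<open>y'\<close> and \<open>y'\<close> to \<open>y\<close>; by uniqueness of lifts
  they are inverse to each other.
\<close>

lemma deck_exists:
  assumes y: "y \<in> Y" "y' \<in> Y" "q y = q y'" obtains T where "T \<in> deck_transformations Y q" "T y = y'"
proof -
  have qX: "q \<in> Y \<rightarrow> X" using q(3) by blast
  note ex = sheaf.global_lift_exists[OF simply_connected_Y atlas_locally_path_connected[OF atlas(2)] q(1) qX]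
  obtain T where T: "sheaf.lifts Y q T" "T y = y'" using ex[of y y'] y by auto
  obtain S where S: "sheaf.lifts Y q S" "S y' = y" using ex[of y' y] y by auto
  have cont: "continuous_on Y T" "continuous_on Y S" using lifts_continuous T S q(1) by auto
  have map: "T v \<in> Y" "q (T v) = q v" "S v \<in> Y" "q (S v) = q v" if "v \<in> Y" for v
    using sheaf.lifts_in_fib[OF T(1) that] sheaf.lifts_in_fib[OF S(1) that] by auto
  have id: "sheaf.lifts Y q (\<lambda>v. v)" by (rule liftsI) auto
  have comp: "sheaf.lifts Y q (\<lambda>v. S (T v))" "sheaf.lifts Y q (\<lambda>v. T (S v))"
    using map by (auto intro!: liftsI continuous_on_compose2[OF cont(2,1)] continuous_on_compose2[OF cont])
  have ST: "S (T v) = v" "T (S v) = v" if "v \<in> Y" for v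
    using lifts_q_unique[OF comp(1) id y(1) _ that] lifts_q_unique[OF comp(2) id y(2) _ that] S T by auto
  define R where "R = restrict T Y"
  have bij: "bij_betw R Y Y" by (rule bij_betw_byWitness[of _ S]) (use ST map in \<open>auto simp: R_def\<close>)
  have inv: "inv_into Y R v = S v" if "v \<in> Y" for v
    using bij_betw_inv_into_left[OF bij map(3)[OF that]] ST(2)[OF that] map(3)[OF that] by (simp add: R_def)
  have "homeomorphism Y Y R (inv_into Y R)"
  proof (rule homeomorphismI)
    show "continuous_on Y R" using cont(1) by (simp add: R_def cong: continuous_on_cong)
    show "continuous_on Y (inv_into Y R)" using cont(2) inv by (simp cong: continuous_on_cong)
    show "R ` Y \<subseteq> Y" "inv_into Y R ` Y \<subseteq> Y" using map inv by (auto simp: R_def)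
    show "inv_into Y R (R v) = v" "R (inv_into Y R v) = v" if "v \<in> Y" for v
      using that ST map inv by (simp_all add: R_def)
  qed
  moreover have "R \<in> Bij Y" using bij by (simp add: Bij_def R_def)
  moreover have "\<forall>v\<in>Y. q (R v) = q v" using map(2) by (simp add: R_def)
  ultimately have "R \<in> deck_transformations Y q" unfolding deck_transformations_def by blast
  then show thesis using that T(2) y(1) by (simp add: R_def)
qed

lemma deck_holomorphic:
  assumes T: "T \<in> deck_transformations Y q" and U: "(U, z) \<in> B" and V: "(V, w) \<in> B"
  shows "open (z ` (U \<inter> T -` V))" "(w \<circ> T \<circ> inv_into U z) holomorphic_on z ` (U \<inter> T -` V)"
proof -
  note c = chart_inv[OF atlas(2) U] and d = chart_inv[OF atlas(2) V] and t = deckD[OF T]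
  have oV: "openin (top_of_set Y) (Y \<inter> T -` V)" using continuous_openin_preimage[OF t(1,2) d(1)] .
  then have o: "openin (top_of_set Y) (U \<inter> T -` V)"
    using openin_Int[OF c(1) oV] c(8) by (metis inf.absorb_iff1 inf_assoc)
  then show "open (z ` (U \<inter> T -` V))" by (rule chart_open_image[OF atlas(2) U]) simp
  show "(w \<circ> T \<circ> inv_into U z) holomorphic_on z ` (U \<inter> T -` V)"
  proof (rule holomorphic_on_local)
    fix \<zeta> assume "\<zeta> \<in> z ` (U \<inter> T -` V)"
    then obtain y where y: "y \<in> U" "T y \<in> V" "\<zeta> = z y" by blast
    have yY: "y \<in> Y" "T y \<in> Y" using y c(8) t(2) by auto
    obtain N s where s: "sheet_section Y q X N s" "q (T y) \<in> N" "s (q (T y)) = T y" using section_through[OF yY(2)] .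
    have qT: "q (T y) = q y" using t(3) yY by simp
    obtain D a where D: "(D, a) \<in> A" "q y \<in> D" using chart_exists[OF atlas(1) q(3)[OF yY(1)]] by blast
    note dd = chart_inv[OF atlas(1) D(1)]
    define u where "u = s ` N"
    note sec = sheet_section[OF s(1), folded u_def]
    have u: "openin (top_of_set X) N" "openin (top_of_set Y) u" "s ` N = u" "continuous_on N s"
      "\<And>y. y \<in> u \<Longrightarrow> q y \<in> N" "\<And>y. y \<in> u \<Longrightarrow> s (q y) = y" by (fact sec u_def[symmetric])+
    define W where "W = U \<inter> (Y \<inter> q -` D) \<inter> (Y \<inter> T -` (V \<inter> u))"
    have qX: "q \<in> Y \<rightarrow> X" using q(3) by blast
    have "openin (top_of_set Y) W" unfolding W_def
      by (rule openin_Int[OF openin_Int[OF c(1) continuous_openin_preimage[OF q(1) qX dd(1)]]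
            continuous_openin_preimage[OF t(1,2) openin_Int[OF d(1) u(2)]]])
    then have oW: "open (z ` W)" by (rule chart_open_image[OF atlas(2) U]) (auto simp: W_def)
    have "T y \<in> u" using s u(3) by (metis imageI)
    then have "\<zeta> \<in> z ` W" using y yY D by (auto simp: W_def)
    let ?h = "(w \<circ> s \<circ> inv_into D a) \<circ> (a \<circ> q \<circ> inv_into U z)"
    have "?h holomorphic_on z ` W"
    proof (rule holomorphic_on_compose_gen[OF _ section_holomorphic(2)[OF s(1) D(1) V]])
      show "(a \<circ> q \<circ> inv_into U z) holomorphic_on z ` W"
        by (rule holomorphic_on_subset[OF q_holomorphic[OF U D(1)]]) (auto simp: W_def)
      show "(a \<circ> q \<circ> inv_into U z) ` (z ` W) \<subseteq> a ` (D \<inter> N \<inter> s -` V)"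
      proof (rule image_subsetI)
        fix \<xi> assume "\<xi> \<in> z ` W"
        then obtain v where v: "v \<in> W" "\<xi> = z v" by blast
        then have "q v \<in> D" "T v \<in> u" "T v \<in> V" "q (T v) = q v" using t(3) by (auto simp: W_def)
        then have "q v \<in> D \<inter> N \<inter> s -` V" using u(5,6)[of "T v"] by auto
        moreover have "inv_into U z \<xi> = v" using v c(5) by (auto simp: W_def)
        ultimately show "(a \<circ> q \<circ> inv_into U z) \<xi> \<in> a ` (D \<inter> N \<inter> s -` V)" by auto
      qed
    qed
    then have "(w \<circ> T \<circ> inv_into U z) holomorphic_on z ` W"
    proof (rule holomorphic_transform)
      fix \<xi> assume "\<xi> \<in> z ` W"
      then obtain v where v: "v \<in> W" "\<xi> = z v" by blast
      then have "q v \<in> D" "T v \<in> u" "q (T v) = q v" using t(3) by (auto simp: W_def)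
      then have "s (q v) = T v" "inv_into D a (a (q v)) = q v" using u(6)[of "T v"] dd(5) by auto
      moreover have "inv_into U z \<xi> = v" using v c(5) by (auto simp: W_def)
      ultimately show "?h \<xi> = (w \<circ> T \<circ> inv_into U z) \<xi>" by simp
    qed
    then show "\<exists>W. open W \<and> \<zeta> \<in> W \<and> (w \<circ> T \<circ> inv_into U z) holomorphic_on W" using oW \<open>\<zeta> \<in> z ` W\<close> by blast
  qed
qed

subsection \<open>The action of the fundamental group\<close>

definition loop_class :: "(real \<Rightarrow> 'a) \<Rightarrow> (real \<Rightarrow> 'a) set" where
  "loop_class h = {k. homotopic_paths X h k}"

lemma fundamental_group_carrier:
  "C \<in> carrier (fundamental_group X x) \<longleftrightarrow>
    (\<exists>h. C = loop_class h \<and> path h \<and> path_image h \<subseteq> X \<and> pathstart h = x \<and> pathfinish h = x)"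
  by (auto simp: fundamental_group_def loop_class_def)

lemma loop_class_eq: "homotopic_paths X h k \<Longrightarrow> loop_class h = loop_class k"
  unfolding loop_class_def using homotopic_paths_trans homotopic_paths_sym by blast

lemma path_q: "path h \<Longrightarrow> path_image h \<subseteq> Y \<Longrightarrow> path (q \<circ> h) \<and> path_image (q \<circ> h) \<subseteq> X"
  using path_continuous_image[OF _ continuous_on_subset[OF q(1)]] q(3) by (auto simp: path_image_def)

lemma path_lifts: "path h \<Longrightarrow> path_image h \<subseteq> Y \<Longrightarrow> sheaf.lifts {0..1} (q \<circ> h) h"
  by (rule liftsI) (auto simp: path_def path_image_def)

lemma path_Y_exists:
  assumes "y \<in> Y" "y' \<in> Y" obtains h where "path h" "path_image h \<subseteq> Y" "pathstart h = y" "pathfinish h = y'"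
  using simply_connected_imp_path_connected_general[OF simply_connected_Y] assms unfolding path_connected_def by blast

text \<open>
  Two candidates \<open>T\<close> come from lifts of homotopic loops with the same start, so they agree at \<open>y0\<close> by \<open>monodromy\<close>, and
  hence everywhere.
\<close>

lemma deck_action_eqI:
  assumes T: "T \<in> deck_transformations Y q" and y0: "y0 \<in> Y"
    and h: "path h" "path_image h \<subseteq> Y" "pathstart h = y0" "pathfinish h = T y0" "loop_class (q \<circ> h) = C"
  shows "deck_action Y q y0 C = T"
  unfolding deck_action_def
proof (rule the_equality)
  have "q \<circ> h \<in> C" using h(5) path_q[OF h(1,2)] by (auto simp: loop_class_def)
  then show "T \<in> deck_transformations Y q \<and>
     (\<exists>h. path h \<and> path_image h \<subseteq> Y \<and> pathstart h = y0 \<and> pathfinish h = T y0 \<and> q \<circ> h \<in> C)" using T h by blast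
  fix T' assume "T' \<in> deck_transformations Y q \<and>
     (\<exists>h. path h \<and> path_image h \<subseteq> Y \<and> pathstart h = y0 \<and> pathfinish h = T' y0 \<and> q \<circ> h \<in> C)"
  then obtain h' where T': "T' \<in> deck_transformations Y q" and h': "path h'" "path_image h' \<subseteq> Y" "pathstart h' = y0"
    "pathfinish h' = T' y0" "q \<circ> h' \<in> C" by blast
  have "homotopic_paths X (q \<circ> h) (q \<circ> h')" using h(5) h'(5) by (auto simp: loop_class_def)
  from sheaf.monodromy[OF this path_lifts[OF h(1,2)] path_lifts[OF h'(1,2)]]
  have "T y0 = T' y0" using h(3,4) h'(3,4) by (simp add: pathstart_def pathfinish_def)
  then show "T' = T" using deck_unique[OF T' T y0] by simp
qed

lemma deck_action_path:
  assumes C: "C \<in> carrier (fundamental_group X (q y0))" and y0: "y0 \<in> Y"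
  obtains h where "deck_action Y q y0 C \<in> deck_transformations Y q" "path h" "path_image h \<subseteq> Y" "pathstart h = y0"
    "pathfinish h = deck_action Y q y0 C y0" "loop_class (q \<circ> h) = C"
proof -
  obtain l where l: "C = loop_class l" "path l" "path_image l \<subseteq> X" "pathstart l = q y0" "pathfinish l = q y0"
    using C fundamental_group_carrier by blast
  obtain h where h: "sheaf.lifts {0..1} l h" "h 0 = y0"
    using sheaf.lift_path_exists[OF l(2,3), of y0] l(4) y0 by auto
  have hY: "h t \<in> Y \<and> q (h t) = l t" if "t \<in> {0..1}" for t using sheaf.lifts_in_fib[OF h(1) that] by auto
  have hp: "path h" "path_image h \<subseteq> Y"
    using lifts_continuous[OF h(1)] l(2) hY by (auto simp: path_def path_image_def)
  have "h 1 \<in> Y" "q y0 = q (h 1)" using hY[of 1] l(5) by (auto simp: pathfinish_def)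
  then obtain T where T: "T \<in> deck_transformations Y q" "T y0 = h 1" using deck_exists[OF y0] by metis
  have "homotopic_paths X l (q \<circ> h)" by (rule homotopic_paths_eq[OF l(2,3)]) (use hY in auto)
  then have C: "loop_class (q \<circ> h) = C" using loop_class_eq l(1) by simp
  have e: "pathstart h = y0" "pathfinish h = T y0" using h T by (auto simp: pathstart_def pathfinish_def)
  have "deck_action Y q y0 C = T" by (rule deck_action_eqI[OF T(1) y0 hp e C])
  then show thesis using that T(1) hp e C by simp
qed


lemma deck_action_transitive:
  assumes y0: "y0 \<in> Y" and y: "y \<in> Y" "y' \<in> Y" "q y = q y'"
  obtains C where "C \<in> carrier (fundamental_group X (q y0))" "deck_action Y q y0 C y = y'"
proof -
  obtain T where T: "T \<in> deck_transformations Y q" "T y = y'" using deck_exists[OF y] .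
  have Ty0: "T y0 \<in> Y" "q (T y0) = q y0" using deckD(2,3)[OF T(1)] y0 by auto
  obtain h where h: "path h" "path_image h \<subseteq> Y" "pathstart h = y0" "pathfinish h = T y0"
    using path_Y_exists[OF y0 Ty0(1)] .
  have "loop_class (q \<circ> h) \<in> carrier (fundamental_group X (q y0))"
    unfolding fundamental_group_carrier using path_q[OF h(1,2)] h(3,4) Ty0(2)
    by (intro exI[of _ "q \<circ> h"]) (simp add: pathstart_compose pathfinish_compose)
  moreover have "deck_action Y q y0 (loop_class (q \<circ> h)) = T" by (rule deck_action_eqI[OF T(1) y0 h refl])
  ultimately show thesis using that T(2) by simp
qed

text \<open>
  Equality at one point gives equality at \<open>y0\<close>. Then the lifted paths have equal ends in the simply
  connected \<open>Y\<close>, so they are homotopic, and so are their projections.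
\<close>

lemma deck_action_free:
  assumes y0: "y0 \<in> Y" and C: "C \<in> carrier (fundamental_group X (q y0))" and D: "D \<in> carrier (fundamental_group X (q y0))"
    and y: "y \<in> Y" "deck_action Y q y0 C y = deck_action Y q y0 D y"
  shows "C = D"
proof -
  obtain h where h: "deck_action Y q y0 C \<in> deck_transformations Y q" "path h" "path_image h \<subseteq> Y" "pathstart h = y0"
    "pathfinish h = deck_action Y q y0 C y0" "loop_class (q \<circ> h) = C" using deck_action_path[OF C y0] .
  obtain l where l: "deck_action Y q y0 D \<in> deck_transformations Y q" "path l" "path_image l \<subseteq> Y" "pathstart l = y0"
    "pathfinish l = deck_action Y q y0 D y0" "loop_class (q \<circ> l) = D" using deck_action_path[OF D y0] .
  have "deck_action Y q y0 C = deck_action Y q y0 D" by (rule deck_unique[OF h(1) l(1) y])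
  then have "homotopic_paths Y h l"
    using h l by (intro simply_connected_imp_homotopic_paths[OF simply_connected_Y]) simp_all
  then have "homotopic_paths X (q \<circ> h) (q \<circ> l)"
    using homotopic_paths_continuous_image[OF _ q(1)] q(3) by blast
  then show ?thesis using loop_class_eq h(6) l(6) by metis
qed

lemma loop_class_mult:
  assumes "path h" "path_image h \<subseteq> X" "path l" "path_image l \<subseteq> X" "pathfinish h = pathstart l"
  shows "loop_class h \<otimes>\<^bsub>fundamental_group X x\<^esub> loop_class l = loop_class (h +++ l)"
proof -
  have "loop_class h \<otimes>\<^bsub>fundamental_group X x\<^esub> loop_class l =
      {k. \<exists>h'. homotopic_paths X h h' \<and> (\<exists>l'. homotopic_paths X l l' \<and> homotopic_paths X (h' +++ l') k)}"
    by (auto simp: fundamental_group_def loop_class_def)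
  also have "\<dots> = {k. homotopic_paths X (h +++ l) k}"
  proof (intro Collect_cong iffI)
    fix k assume "homotopic_paths X (h +++ l) k"
    then show "\<exists>h'. homotopic_paths X h h' \<and> (\<exists>l'. homotopic_paths X l l' \<and> homotopic_paths X (h' +++ l') k)"
      using assms homotopic_paths_refl by blast
  next
    fix k assume "\<exists>h'. homotopic_paths X h h' \<and> (\<exists>l'. homotopic_paths X l l' \<and> homotopic_paths X (h' +++ l') k)"
    then obtain h' l' where "homotopic_paths X h h'" "homotopic_paths X l l'" "homotopic_paths X (h' +++ l') k" by blast
    then show "homotopic_paths X (h +++ l) k"
      using homotopic_paths_join[OF _ _ assms(5)] homotopic_paths_trans by blast
  qed
  finally show ?thesis by (simp add: loop_class_def)
qed

lemma fundamental_group_mult_closed: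
  assumes C: "C \<in> carrier (fundamental_group X x)" and D: "D \<in> carrier (fundamental_group X x)"
  shows "C \<otimes>\<^bsub>fundamental_group X x\<^esub> D \<in> carrier (fundamental_group X x)"
proof -
  obtain h where h: "C = loop_class h" "path h" "path_image h \<subseteq> X" "pathstart h = x" "pathfinish h = x"
    using C fundamental_group_carrier by blast
  obtain l where l: "D = loop_class l" "path l" "path_image l \<subseteq> X" "pathstart l = x" "pathfinish l = x"
    using D fundamental_group_carrier by blast
  have "C \<otimes>\<^bsub>fundamental_group X x\<^esub> D = loop_class (h +++ l)"
    unfolding h(1) l(1) using h l by (intro loop_class_mult) simp_all
  moreover have "path_image (h +++ l) \<subseteq> X" using h l by (intro subset_path_image_join)
  ultimately show ?thesis using h l by (auto simp: fundamental_group_carrier intro!: exI[of _ "h +++ l"])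
qed

text \<open>
  A path from \<open>y0\<close> to \<open>C\<cdot>y0\<close>, followed by the image under \<open>C\<close> of a path from \<open>y0\<close> to \<open>D\<cdot>y0\<close>, projects to a loop of the product class and
  ends at \<open>C\<cdot>(D\<cdot>y0)\<close>.
\<close>

lemma deck_action_mult:
  assumes y0: "y0 \<in> Y" and C: "C \<in> carrier (fundamental_group X (q y0))" and D: "D \<in> carrier (fundamental_group X (q y0))"
    and y: "y \<in> Y"
  shows "deck_action Y q y0 (C \<otimes>\<^bsub>fundamental_group X (q y0)\<^esub> D) y = deck_action Y q y0 C (deck_action Y q y0 D y)"
proof -
  define S where "S = deck_action Y q y0 C"
  define T where "T = deck_action Y q y0 D"
  obtain h where h: "S \<in> deck_transformations Y q" "path h" "path_image h \<subseteq> Y" "pathstart h = y0"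
    "pathfinish h = S y0" "loop_class (q \<circ> h) = C" using deck_action_path[OF C y0] unfolding S_def .
  obtain l where l: "T \<in> deck_transformations Y q" "path l" "path_image l \<subseteq> Y" "pathstart l = y0"
    "pathfinish l = T y0" "loop_class (q \<circ> l) = D" using deck_action_path[OF D y0] unfolding T_def .
  note s = deckD[OF h(1)] and t = deckD[OF l(1)]
  have Ty: "T v \<in> Y" "S v \<in> Y" if "v \<in> Y" for v using s t that by auto
  obtain R where R: "R \<in> deck_transformations Y q" "R y0 = S (T y0)"
    using deck_exists[of y0 "S (T y0)"] y0 Ty s(3) t(3) by metis
  have R': "R v = S (T v)" if "v \<in> Y" for v
  proof (rule lifts_q_unique[where T=R and T'="\<lambda>v. S (T v)", OF deck_lifts[OF R(1)] _ y0 R(2) that])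
    show "sheaf.lifts Y q (\<lambda>v. S (T v))"
      by (rule liftsI) (use Ty s t in \<open>auto intro!: continuous_on_compose2[OF s(1) t(1)]\<close>)
  qed
  have Sl: "path (S \<circ> l)" "path_image (S \<circ> l) \<subseteq> Y" "pathstart (S \<circ> l) = S y0" "pathfinish (S \<circ> l) = S (T y0)"
    using path_continuous_image[OF l(2) continuous_on_subset[OF s(1) l(3)]] l Ty
    by (auto simp: path_image_compose pathstart_compose pathfinish_compose)
  have "deck_action Y q y0 (C \<otimes>\<^bsub>fundamental_group X (q y0)\<^esub> D) = R"
  proof (rule deck_action_eqI[OF R(1) y0])
    show "path (h +++ (S \<circ> l))" "pathstart (h +++ (S \<circ> l)) = y0" "pathfinish (h +++ (S \<circ> l)) = R y0"
      using h Sl R(2) by simp_all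
    show "path_image (h +++ (S \<circ> l)) \<subseteq> Y" using h(3) Sl(2) by (rule subset_path_image_join)
    have ql: "loop_class (q \<circ> (S \<circ> l)) = D"
    proof -
      have "homotopic_paths X (q \<circ> l) (q \<circ> (S \<circ> l))"
      proof (rule homotopic_paths_eq)
        fix t :: real assume "t \<in> {0..1}"
        then have "l t \<in> Y" using l(3) by (auto simp: path_image_def)
        then show "(q \<circ> l) t = (q \<circ> (S \<circ> l)) t" using s(3) by simp
      qed (use path_q[OF l(2,3)] in auto)
      then show ?thesis using loop_class_eq l(6) by metis
    qed
    have "loop_class (q \<circ> h) \<otimes>\<^bsub>fundamental_group X (q y0)\<^esub> loop_class (q \<circ> (S \<circ> l)) = loop_class ((q \<circ> h) +++ (q \<circ> (S \<circ> l)))"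
      using path_q[OF h(2,3)] path_q[OF Sl(1,2)] h(5) Sl(3)
      by (intro loop_class_mult) (simp_all only: pathstart_compose pathfinish_compose)
    then show "loop_class (q \<circ> (h +++ (S \<circ> l))) = C \<otimes>\<^bsub>fundamental_group X (q y0)\<^esub> D"
      unfolding h(6) ql by (simp add: path_compose_join)
  qed
  then show ?thesis using R'[OF y] by (simp add: S_def T_def)
qed

end

section \<open>Primitives of matrix-valued 1-forms\<close>

definition has_mat_derivative :: "(complex \<Rightarrow> complex^'n^'n) \<Rightarrow> complex^'n^'n \<Rightarrow> complex \<Rightarrow> bool" where
  "has_mat_derivative F F' \<zeta> \<longleftrightarrow> (\<forall>i j. ((\<lambda>\<xi>. F \<xi> $ i $ j) has_field_derivative F' $ i $ j) (at \<zeta>))"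

lemma cscale_nth [simp]: "cscale c M $ i $ j = c * M $ i $ j"
  by (simp add: cscale_def map_matrix_def)

lemma has_mat_derivative_transform:
  assumes "has_mat_derivative F F' \<zeta>" "open S" "\<zeta> \<in> S" "\<And>\<xi>. \<xi> \<in> S \<Longrightarrow> F \<xi> = G \<xi>"
  shows "has_mat_derivative G F' \<zeta>"
  unfolding has_mat_derivative_def
proof (intro allI)
  fix i j
  have "((\<lambda>\<xi>. F \<xi> $ i $ j) has_field_derivative F' $ i $ j) (at \<zeta>)" using assms(1) by (simp add: has_mat_derivative_def)
  then show "((\<lambda>\<xi>. G \<xi> $ i $ j) has_field_derivative F' $ i $ j) (at \<zeta>)"
    by (rule has_field_derivative_transform_within_open[OF _ assms(2,3)]) (simp add: assms(4))
qed

lemma has_mat_derivative_const: "has_mat_derivative (\<lambda>_. M) 0 \<zeta>"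
  by (simp add: has_mat_derivative_def)

lemma has_mat_derivative_add:
  "has_mat_derivative F M \<zeta> \<Longrightarrow> has_mat_derivative G N \<zeta> \<Longrightarrow> has_mat_derivative (\<lambda>\<xi>. F \<xi> + G \<xi>) (M + N) \<zeta>"
  by (simp add: has_mat_derivative_def DERIV_add)

lemma has_mat_derivative_diff:
  "has_mat_derivative F M \<zeta> \<Longrightarrow> has_mat_derivative G N \<zeta> \<Longrightarrow> has_mat_derivative (\<lambda>\<xi>. F \<xi> - G \<xi>) (M - N) \<zeta>"
  by (simp add: has_mat_derivative_def DERIV_diff)

lemma Ad_nth: "Ad T M $ i $ j = (\<Sum>l\<in>UNIV. \<Sum>k\<in>UNIV. T $ i $ k * M $ k $ l * matrix_inv T $ l $ j)"
  by (simp add: Ad_def matrix_matrix_mult_def sum_distrib_right)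

lemma has_mat_derivative_Ad:
  "has_mat_derivative F M \<zeta> \<Longrightarrow> has_mat_derivative (\<lambda>\<xi>. Ad T (F \<xi>)) (Ad T M) \<zeta>"
  unfolding has_mat_derivative_def Ad_nth by (intro allI DERIV_sum DERIV_cmult DERIV_cmult_right) auto

lemma has_mat_derivative_mat_inner:
  assumes "has_mat_derivative F M \<zeta>"
  shows "((\<lambda>\<xi>. mat_inner (F \<xi>) N) has_field_derivative mat_inner M N) (at \<zeta>)"
  unfolding mat_inner_eq using assms unfolding has_mat_derivative_def by (intro DERIV_sum DERIV_cmult_right) auto

lemma has_mat_derivative_compose:
  assumes "has_mat_derivative F M (g \<zeta>)" "(g has_field_derivative c) (at \<zeta>)"
  shows "has_mat_derivative (\<lambda>\<xi>. F (g \<xi>)) (cscale c M) \<zeta>"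
  unfolding has_mat_derivative_def
proof (intro allI)
  fix i j
  have "((\<lambda>\<xi>. F \<xi> $ i $ j) has_field_derivative M $ i $ j) (at (g \<zeta>))" using assms(1) by (simp add: has_mat_derivative_def)
  from DERIV_chain2[OF this assms(2)]
  show "((\<lambda>\<xi>. F (g \<xi>) $ i $ j) has_field_derivative cscale c M $ i $ j) (at \<zeta>)" by (simp add: mult.commute)
qed

lemma has_mat_derivative_0_const:
  assumes "open S" "connected S" "\<And>\<zeta>. \<zeta> \<in> S \<Longrightarrow> has_mat_derivative F 0 \<zeta>" "\<zeta> \<in> S" "\<xi> \<in> S"
  shows "F \<zeta> = F \<xi>"
proof -
  have "F \<zeta> $ i $ j = F \<xi> $ i $ j" for i j
  proof -
    have "((\<lambda>\<xi>. F \<xi> $ i $ j) has_field_derivative 0) (at \<zeta>)" if "\<zeta> \<in> S" for \<zeta>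
      using assms(3)[OF that] by (simp add: has_mat_derivative_def)
    note d = this
    have "continuous_on S (\<lambda>\<xi>. F \<xi> $ i $ j)"
      by (rule DERIV_continuous_on[OF has_field_derivative_at_within[OF d]])
    then obtain c where "\<And>\<zeta>. \<zeta> \<in> S \<Longrightarrow> F \<zeta> $ i $ j = c"
      by (rule DERIV_zero_connected_constant[OF assms(2,1) finite.emptyI]) (use d in auto)
    then show ?thesis using assms(4,5) by simp
  qed
  then show ?thesis by (simp add: vec_eq_iff)
qed

definition primitive_on :: "'b::t2_space chart set \<Rightarrow> ('b, 'n::finite) mform \<Rightarrow> 'b set \<Rightarrow> ('b \<Rightarrow> complex^'n^'n) \<Rightarrow> bool" where
  "primitive_on B \<phi> N P \<longleftrightarrow> (\<forall>(U, z)\<in>B. \<forall>y\<in>N \<inter> U. has_mat_derivative (\<lambda>\<zeta>. P (inv_into U z \<zeta>)) (\<phi> (U, z) y) (z y))"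

lemma primitive_onD:
  "primitive_on B \<phi> N P \<Longrightarrow> (U, z) \<in> B \<Longrightarrow> y \<in> N \<Longrightarrow> y \<in> U \<Longrightarrow> has_mat_derivative (\<lambda>\<zeta>. P (inv_into U z \<zeta>)) (\<phi> (U, z) y) (z y)"
  unfolding primitive_on_def by blast

lemma chart_ball:
  assumes Y: "complex_atlas Y B" and U: "(U, z) \<in> B" and N: "openin (top_of_set Y) N" "y \<in> N" "y \<in> U"
  obtains r where "r > 0" "ball (z y) r \<subseteq> z ` U" "openin (top_of_set Y) (inv_into U z ` ball (z y) r)"
    "y \<in> inv_into U z ` ball (z y) r" "inv_into U z ` ball (z y) r \<subseteq> N"
proof -
  note c = chart_inv[OF Y U]
  have "open (z ` (N \<inter> U))" by (rule chart_open_image[OF Y U openin_Int[OF N(1) c(1)]]) simp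
  moreover have "z y \<in> z ` (N \<inter> U)" using N by blast
  ultimately obtain r where r: "r > 0" "ball (z y) r \<subseteq> z ` (N \<inter> U)" using open_contains_ball by metis
  have M: "inv_into U z ` ball (z y) r = U \<inter> z -` ball (z y) r"
  proof
    show "U \<inter> z -` ball (z y) r \<subseteq> inv_into U z ` ball (z y) r" using c(5) by force
    show "inv_into U z ` ball (z y) r \<subseteq> U \<inter> z -` ball (z y) r" using c(6,7) r(2) by auto
  qed
  have "openin (top_of_set U) (U \<inter> z -` ball (z y) r)" using continuous_openin_preimage_gen[OF c(3)] by simp
  then have "openin (top_of_set Y) (inv_into U z ` ball (z y) r)" unfolding M using c(1) openin_trans by blast
  moreover have "inv_into U z ` ball (z y) r \<subseteq> N" using r(2) c(5) by auto
  moreover have "y \<in> inv_into U z ` ball (z y) r" unfolding M using N r by simp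
  ultimately show thesis using that r by blast
qed

lemma zero_derivative_locally_constant:
  assumes Y: "complex_atlas Y B" and N: "openin (top_of_set Y) N" "y \<in> N"
    and g: "\<And>U z y. (U, z) \<in> B \<Longrightarrow> y \<in> N \<Longrightarrow> y \<in> U \<Longrightarrow> has_mat_derivative (\<lambda>\<zeta>. g (inv_into U z \<zeta>)) 0 (z y)"
  shows "\<exists>M. openin (top_of_set Y) M \<and> y \<in> M \<and> M \<subseteq> N \<and> (\<forall>y'\<in>M. g y' = g y)"
proof -
  have "y \<in> Y" using openin_subset[OF N(1)] N(2) by auto
  then obtain U z where U: "(U, z) \<in> B" "y \<in> U" using chart_exists[OF Y] by blast
  note c = chart_inv[OF Y U(1)]
  obtain r where r: "r > 0" "ball (z y) r \<subseteq> z ` U" "openin (top_of_set Y) (inv_into U z ` ball (z y) r)"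
    "y \<in> inv_into U z ` ball (z y) r" "inv_into U z ` ball (z y) r \<subseteq> N" using chart_ball[OF Y U(1) N U(2)] .
  have "g (inv_into U z \<zeta>) = g (inv_into U z (z y))" if "\<zeta> \<in> ball (z y) r" for \<zeta>
  proof (rule has_mat_derivative_0_const[of "ball (z y) r" "\<lambda>\<zeta>. g (inv_into U z \<zeta>)"])
    fix \<xi> assume \<xi>: "\<xi> \<in> ball (z y) r"
    then have "\<xi> \<in> z ` U" using r(2) by blast
    then have "inv_into U z \<xi> \<in> U" "z (inv_into U z \<xi>) = \<xi>" using c(6,7) by simp_all
    moreover have "inv_into U z \<xi> \<in> N" using r(5) \<xi> by blast
    ultimately have "inv_into U z \<xi> \<in> N" "inv_into U z \<xi> \<in> U" "z (inv_into U z \<xi>) = \<xi>" by simp_all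
    then show "has_mat_derivative (\<lambda>\<zeta>. g (inv_into U z \<zeta>)) 0 \<xi>" using g[OF U(1), of "inv_into U z \<xi>"] by simp
  qed (use that r in auto)
  then have "\<forall>y'\<in>inv_into U z ` ball (z y) r. g y' = g y" using c(5)[OF U(2)] by auto
  then show ?thesis using r by blast
qed

lemma zero_derivative_constant:
  assumes Y: "complex_atlas Y B" "connected Y"
    and g: "\<And>U z y. (U, z) \<in> B \<Longrightarrow> y \<in> U \<Longrightarrow> has_mat_derivative (\<lambda>\<zeta>. g (inv_into U z \<zeta>)) 0 (z y)"
    and y: "y \<in> Y" "y' \<in> Y"
  shows "g y = g y'"
proof (rule connected_equivalence_relation[OF Y(2) y, where R="\<lambda>y y'. g y = g y'"])
  fix a assume a: "a \<in> Y"
  have "\<exists>M. openin (top_of_set Y) M \<and> a \<in> M \<and> M \<subseteq> Y \<and> (\<forall>y'\<in>M. g y' = g a)"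
    by (rule zero_derivative_locally_constant[OF Y(1) _ a]) (use g in auto)
  then show "\<exists>T. openin (top_of_set Y) T \<and> a \<in> T \<and> (\<forall>x\<in>T. g a = g x)" by metis
qed auto

lemma primitives_differ_by_locally_constant:
  assumes Y: "complex_atlas Y B" and N: "openin (top_of_set Y) N" "openin (top_of_set Y) N'" "y \<in> N" "y \<in> N'"
    and P: "primitive_on B \<phi> N P" "primitive_on B \<phi> N' P'"
  shows "\<exists>M. openin (top_of_set Y) M \<and> y \<in> M \<and> M \<subseteq> N \<inter> N' \<and> (\<forall>y'\<in>M. P y' - P' y' = P y - P' y)"
proof (rule zero_derivative_locally_constant[OF Y openin_Int[OF N(1,2)]])
  fix U z v assume U: "(U, z) \<in> B" and v: "v \<in> N \<inter> N'" "v \<in> U"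
  then have "v \<in> N" "v \<in> N'" by auto
  from has_mat_derivative_diff[OF primitive_onD[OF P(1) U this(1) v(2)] primitive_onD[OF P(2) U this(2) v(2)]]
  show "has_mat_derivative (\<lambda>\<zeta>. P (inv_into U z \<zeta>) - P' (inv_into U z \<zeta>)) 0 (z v)" by simp
qed (use N in auto)

lemma primitive_on_add_const: "primitive_on B \<phi> N P \<Longrightarrow> primitive_on B \<phi> N (\<lambda>y. P y + M)"
  unfolding primitive_on_def
proof (intro ballI case_prodI2)
  fix \<alpha> U z y assume P: "\<forall>(U, z)\<in>B. \<forall>y\<in>N \<inter> U. has_mat_derivative (\<lambda>\<zeta>. P (inv_into U z \<zeta>)) (\<phi> (U, z) y) (z y)"
    and "\<alpha> \<in> B" "\<alpha> = (U, z)" "y \<in> N \<inter> U"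
  then have "has_mat_derivative (\<lambda>\<zeta>. P (inv_into U z \<zeta>)) (\<phi> (U, z) y) (z y)" by blast
  from has_mat_derivative_add[OF this has_mat_derivative_const]
  show "has_mat_derivative (\<lambda>\<zeta>. P (inv_into U z \<zeta>) + M) (\<phi> (U, z) y) (z y)" by simp
qed

lemma primitive_on_subset: "primitive_on B \<phi> N P \<Longrightarrow> M \<subseteq> N \<Longrightarrow> primitive_on B \<phi> M P"
  unfolding primitive_on_def by fast

lemma holomorphic_formD:
  assumes "holomorphic_form B \<phi>" "(U, z) \<in> B"
  shows "(\<lambda>\<zeta>. \<phi> (U, z) (inv_into U z \<zeta>) $ i $ j) holomorphic_on z ` U"
    "(V, w) \<in> B \<Longrightarrow> y \<in> U \<Longrightarrow> y \<in> V \<Longrightarrow> \<phi> (U, z) y = cscale (deriv (w \<circ> inv_into U z) (z y)) (\<phi> (V, w) y)"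
proof -
  note h = assms(1)[unfolded holomorphic_form_def]
  show "(\<lambda>\<zeta>. \<phi> (U, z) (inv_into U z \<zeta>) $ i $ j) holomorphic_on z ` U"
    using bspec[OF conjunct1[OF h] assms(2)] by simp
  show "\<phi> (U, z) y = cscale (deriv (w \<circ> inv_into U z) (z y)) (\<phi> (V, w) y)" if "(V, w) \<in> B" "y \<in> U" "y \<in> V"
  proof -
    note 1 = bspec[OF conjunct2[OF h] assms(2), unfolded prod.case]
    note 2 = bspec[OF 1 that(1), unfolded prod.case]
    show ?thesis by (rule bspec[OF 2]) (use that in blast)
  qed
qed

lemma primitive_on_transform:
  assumes Y: "complex_atlas Y B" and N: "openin (top_of_set Y) N" and P: "primitive_on B \<phi> N P" and eq: "\<And>y. y \<in> N \<Longrightarrow> P y = Q y"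
  shows "primitive_on B \<phi> N Q"
  unfolding primitive_on_def
proof (intro ballI case_prodI2)
  fix \<alpha> U z y assume \<alpha>: "\<alpha> \<in> B" "\<alpha> = (U, z)" and y: "y \<in> N \<inter> U"
  then have U: "(U, z) \<in> B" by simp
  obtain r where r: "r > 0" "inv_into U z ` ball (z y) r \<subseteq> N" 
    by (rule chart_ball[OF Y U N, of y]) (use y in blast, use y in blast, rule that)
  have "has_mat_derivative (\<lambda>\<zeta>. Q (inv_into U z \<zeta>)) (\<phi> (U, z) y) (z y)"
  proof (rule has_mat_derivative_transform[OF primitive_onD[OF P U]])
    show "P (inv_into U z \<xi>) = Q (inv_into U z \<xi>)" if "\<xi> \<in> ball (z y) r" for \<xi>
      by (rule eq) (use r(2) that in blast)
  qed (use y r(1) in auto)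
  then show "has_mat_derivative (\<lambda>\<zeta>. Q (inv_into U z \<zeta>)) (\<phi> (U, z) y) (z y)" .
qed

lemma local_primitive_exists:
  fixes \<phi> :: "('b::t2_space, 'n::finite) mform"
  assumes Y: "complex_atlas Y B" and \<phi>: "holomorphic_form B \<phi>" and y: "y \<in> Y"
  obtains N P where "openin (top_of_set Y) N" "y \<in> N" "connected N" "primitive_on B \<phi> N P"
proof -
  obtain U z where U: "(U, z) \<in> B" "y \<in> U" using chart_exists[OF Y y] by blast
  note c = chart_inv[OF Y U(1)]
  obtain r where r: "r > 0" "ball (z y) r \<subseteq> z ` U" "openin (top_of_set Y) (inv_into U z ` ball (z y) r)"
    "y \<in> inv_into U z ` ball (z y) r" using chart_ball[OF Y U(1) c(1) U(2,2)] .
  define N where "N = inv_into U z ` ball (z y) r"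
  have NU: "v \<in> U" "z v \<in> ball (z y) r" if "v \<in> N" for v using r(2) c(6,7) that unfolding N_def by auto
  have "\<exists>g. \<forall>\<zeta>\<in>ball (z y) r. (g has_field_derivative \<phi> (U, z) (inv_into U z \<zeta>) $ i $ j) (at \<zeta>)" for i j
  proof -
    have "(\<lambda>\<zeta>. \<phi> (U, z) (inv_into U z \<zeta>) $ i $ j) holomorphic_on z ` U"
      by (rule holomorphic_formD[OF \<phi> U(1)])
    then have "(\<lambda>\<zeta>. \<phi> (U, z) (inv_into U z \<zeta>) $ i $ j) holomorphic_on ball (z y) r"
      using r(2) holomorphic_on_subset by blast
    from holomorphic_convex_primitive'[OF convex_ball open_ball this]
    obtain g where "\<And>\<zeta>. \<zeta> \<in> ball (z y) r \<Longrightarrow> (g has_field_derivative \<phi> (U, z) (inv_into U z \<zeta>) $ i $ j) (at \<zeta> within ball (z y) r)"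
      by blast
    then show ?thesis by (metis at_within_open open_ball)
  qed
  then obtain g where g: "\<And>i j \<zeta>. \<zeta> \<in> ball (z y) r \<Longrightarrow> (g i j has_field_derivative \<phi> (U, z) (inv_into U z \<zeta>) $ i $ j) (at \<zeta>)" by metis
  define G where "G \<zeta> = (\<chi> i j. g i j \<zeta>)" for \<zeta>
  have G: "has_mat_derivative G (\<phi> (U, z) v) (z v)" if "v \<in> N" for v
    unfolding has_mat_derivative_def G_def using g[OF NU(2)[OF that]] c(5)[OF NU(1)[OF that]] by simp
  have "primitive_on B \<phi> N (\<lambda>v. G (z v))"
    unfolding primitive_on_def
  proof (intro ballI case_prodI2)
    fix \<alpha> V w v assume \<alpha>: "\<alpha> \<in> B" "\<alpha> = (V, w)" and v: "v \<in> N \<inter> V"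
    then have V: "(V, w) \<in> B" by simp
    note t = chart_transition[OF Y V U(1)] and d = chart_inv[OF Y V]
    have wv: "w v \<in> w ` (V \<inter> U)" using v NU(1) by blast
    have "((z \<circ> inv_into V w) has_field_derivative deriv (z \<circ> inv_into V w) (w v)) (at (w v))"
      by (rule holomorphic_derivI[OF t(2,1) wv])
    moreover have "has_mat_derivative G (\<phi> (U, z) v) ((z \<circ> inv_into V w) (w v))"
      using G v d(5) by simp
    ultimately have "has_mat_derivative (\<lambda>\<zeta>. G ((z \<circ> inv_into V w) \<zeta>)) (cscale (deriv (z \<circ> inv_into V w) (w v)) (\<phi> (U, z) v)) (w v)"
      by (intro has_mat_derivative_compose)
    moreover have "cscale (deriv (z \<circ> inv_into V w) (w v)) (\<phi> (U, z) v) = \<phi> (V, w) v"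
      using holomorphic_formD(2)[OF \<phi> V U(1)] v NU(1) by simp
    ultimately show "has_mat_derivative (\<lambda>\<zeta>. G (z (inv_into V w \<zeta>))) (\<phi> (V, w) v) (w v)" by simp
  qed
  moreover have "connected N" unfolding N_def
    by (intro connected_continuous_image continuous_on_subset[OF c(4) r(2)] convex_connected convex_ball)
  ultimately show thesis using that r(3,4) unfolding N_def by blast
qed

text \<open>
  The local primitives form a \<open>local_system\<close> with all matrices as fibre, since two of them differ by a locally constant
  function. A lift of the identity of \<open>Y\<close> is a global primitive.
\<close>

lemma primitive_exists:
  fixes Y :: "'b::t2_space set" and \<phi> :: "('b, 'n::finite) mform"
  assumes Y: "complex_atlas Y B" "simply_connected Y" and \<phi>: "holomorphic_form B \<phi>" and y0: "y0 \<in> Y"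
  obtains f where "primitive_on B \<phi> Y f"
proof -
  define \<T> where "\<T> = {(N, \<S>). \<exists>P. openin (top_of_set Y) N \<and> connected N \<and> primitive_on B \<phi> N P \<and> \<S> = range (\<lambda>M y. P y + M)}"
  have member: "\<exists>P. openin (top_of_set Y) N \<and> connected N \<and> primitive_on B \<phi> N P \<and> \<S> = range (\<lambda>M y. P y + M)"
    if "(N, \<S>) \<in> \<T>" for N \<S> using that by (simp add: \<T>_def)
  have prim: "primitive_on B \<phi> N P" if "(N, \<S>) \<in> \<T>" "P \<in> \<S>" for N \<S> P
    using member[OF that(1)] that(2) primitive_on_add_const by blast
  interpret local_system Y "\<lambda>_. UNIV" \<T>
  proof
    fix y assume "y \<in> Y"
    then obtain N P where "openin (top_of_set Y) N" "y \<in> N" "connected N" "primitive_on B \<phi> N P"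
      using local_primitive_exists[OF Y(1) \<phi>] by blast
    then show "\<exists>(N, \<S>)\<in>\<T>. y \<in> N" unfolding \<T>_def by blast
  next
    fix N \<S> assume "(N, \<S>) \<in> \<T>"
    then show "openin (top_of_set Y) N" using member by blast
  next
    fix N \<S> y and v :: "complex^'n^'n" assume "(N, \<S>) \<in> \<T>"
    then obtain P where "\<S> = range (\<lambda>M y. P y + M)" using member by blast
    then have "(\<lambda>y'. P y' + (v - P y)) \<in> \<S>" by blast
    then show "\<exists>P\<in>\<S>. P y = v" by (rule bexI[rotated]) simp
  next
    fix N \<S> P P' z z' assume *: "(N, \<S>) \<in> \<T>" "P \<in> \<S>" "P' \<in> \<S>" "P z = P' z"
    then obtain Q where "\<S> = range (\<lambda>M y. Q y + M)" using member by blast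
    then obtain M M' where "P = (\<lambda>y. Q y + M)" "P' = (\<lambda>y. Q y + M')" using * by blast
    then show "P z' = P' z'" using *(4) by simp
  next
    fix N \<S> N' \<S>' P P' z assume *: "(N, \<S>) \<in> \<T>" "(N', \<S>') \<in> \<T>" "P \<in> \<S>" "P' \<in> \<S>'" "z \<in> N" "z \<in> N'" "P z = P' z"
    have "openin (top_of_set Y) N" "openin (top_of_set Y) N'" using member * by blast+
    from primitives_differ_by_locally_constant[OF Y(1) this *(5,6) prim[OF *(1,3)] prim[OF *(2,4)]]
    show "\<exists>M. openin (top_of_set Y) M \<and> z \<in> M \<and> (\<forall>y\<in>M. P y = P' y)" using *(7) by auto
  qed auto
  obtain f where f: "lifts Y (\<lambda>y. y) f"
    using global_lift_exists[OF Y(2) atlas_locally_path_connected[OF Y(1)], of "\<lambda>y. y" y0 0] y0 by auto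
  have "primitive_on B \<phi> Y f"
    unfolding primitive_on_def
  proof (intro ballI case_prodI2)
    fix \<alpha> U z y assume \<alpha>: "\<alpha> \<in> B" "\<alpha> = (U, z)" and y: "y \<in> Y \<inter> U"
    then have U: "(U, z) \<in> B" by simp
    obtain N \<S> P M where *: "(N, \<S>) \<in> \<T>" "P \<in> \<S>" "openin (top_of_set Y) M" "y \<in> M" "\<forall>y'\<in>M. y' \<in> N \<and> f y' = P y'"
      using bspec[OF f[unfolded lifts_def], of y] y by fast
    have "primitive_on B \<phi> M P" by (rule primitive_on_subset[OF prim[OF *(1,2)]]) (use *(5) in blast)
    then have "primitive_on B \<phi> M f" by (rule primitive_on_transform[OF Y(1) *(3)]) (use *(5) in auto)
    then show "has_mat_derivative (\<lambda>\<zeta>. f (inv_into U z \<zeta>)) (\<phi> (U, z) y) (z y)" using primitive_onD U *(4) y by blast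
  qed
  then show thesis by (rule that)
qed

lemma has_form_integral_primitive:
  assumes Y: "complex_atlas Y B" and f: "primitive_on B \<phi> Y f" and h: "has_form_integral B \<phi> h I"
  shows "I = f (pathfinish h) - f (pathstart h)"
  using h
proof induction
  case (in_chart U z h)
  note c = chart_inv[OF Y in_chart(1)]
  have ends: "pathstart h \<in> U" "pathfinish h \<in> U" using in_chart(2) by auto
  have "contour_integral (z \<circ> h) (\<lambda>\<zeta>. \<phi> (U, z) (inv_into U z \<zeta>) $ i $ j) = f (pathfinish h) $ i $ j - f (pathstart h) $ i $ j" for i j
  proof -
    have "((\<lambda>\<zeta>. f (inv_into U z \<zeta>) $ i $ j) has_field_derivative \<phi> (U, z) (inv_into U z \<zeta>) $ i $ j) (at \<zeta> within z ` U)"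
      if "\<zeta> \<in> z ` U" for \<zeta>
    proof -
      have "has_mat_derivative (\<lambda>\<zeta>. f (inv_into U z \<zeta>)) (\<phi> (U, z) (inv_into U z \<zeta>)) (z (inv_into U z \<zeta>))"
        using primitive_onD[OF f in_chart(1)] c(7)[OF that] c(8) by blast
      then show ?thesis using c(6)[OF that] by (simp add: has_mat_derivative_def has_field_derivative_at_within)
    qed
    moreover have "path_image (z \<circ> h) \<subseteq> z ` U" using in_chart(2) by (auto simp: path_image_def)
    ultimately have "((\<lambda>\<zeta>. \<phi> (U, z) (inv_into U z \<zeta>) $ i $ j) has_contour_integral
        f (inv_into U z (pathfinish (z \<circ> h))) $ i $ j - f (inv_into U z (pathstart (z \<circ> h))) $ i $ j) (z \<circ> h)"
      using contour_integral_primitive[where f="\<lambda>\<zeta>. f (inv_into U z \<zeta>) $ i $ j" and S="z ` U", OF _ in_chart(3)] by simp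
    then show ?thesis using c(5) ends by (simp add: contour_integral_unique pathstart_compose pathfinish_compose)
  qed
  then show ?case by (simp add: vec_eq_iff)
next
  case (join h I l J)
  then show ?case by simp
qed

text \<open>
  The relation of being joined by such a path is transitive by \<open>join\<close>, and it contains all pairs of points in a
  disc of a chart. On the connected \<open>Y\<close> it thus holds for all pairs.
\<close>

lemma has_form_integral_exists:
  assumes Y: "complex_atlas Y B" "connected Y" and y: "y \<in> Y" "y' \<in> Y"
  shows "\<exists>h I. pathstart h = y \<and> pathfinish h = y' \<and> has_form_integral B \<phi> h I"
proof (rule connected_equivalence_relation_gen[OF Y(2) y, where P="\<lambda>_. True" and R="\<lambda>y y'. \<exists>h I. pathstart h = y \<and> pathfinish h = y' \<and> has_form_integral B \<phi> h I"])
  fix a b c assume "\<exists>h I. pathstart h = a \<and> pathfinish h = b \<and> has_form_integral B \<phi> h I"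
    "\<exists>h I. pathstart h = b \<and> pathfinish h = c \<and> has_form_integral B \<phi> h I"
  then obtain h I l J where "pathstart h = a" "pathfinish h = b" "has_form_integral B \<phi> h I" "pathstart l = b" "pathfinish l = c" "has_form_integral B \<phi> l J" by blast
  then have "has_form_integral B \<phi> (h +++ l) (I + J)" "pathstart (h +++ l) = a" "pathfinish (h +++ l) = c"
    using has_form_integral.join[of B \<phi> h I l J] by simp_all
  then show "\<exists>h I. pathstart h = a \<and> pathfinish h = c \<and> has_form_integral B \<phi> h I" by blast
next
  fix a assume a: "a \<in> Y"
  then obtain U z where U: "(U, z) \<in> B" "a \<in> U" using chart_exists[OF Y(1)] by blast
  note c = chart_inv[OF Y(1) U(1)]
  obtain r where r: "r > 0" "ball (z a) r \<subseteq> z ` U" "openin (top_of_set Y) (inv_into U z ` ball (z a) r)"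
    "a \<in> inv_into U z ` ball (z a) r" using chart_ball[OF Y(1) U(1) c(1) U(2,2)] .
  have "\<exists>h I. pathstart h = inv_into U z \<zeta> \<and> pathfinish h = inv_into U z \<xi> \<and> has_form_integral B \<phi> h I"
    if \<zeta>\<xi>: "\<zeta> \<in> ball (z a) r" "\<xi> \<in> ball (z a) r" for \<zeta> \<xi>
  proof -
    let ?l = "linepath \<zeta> \<xi>" and ?h = "inv_into U z \<circ> linepath \<zeta> \<xi>"
    have l: "?l t \<in> ball (z a) r" if "t \<in> {0..1}" for t
      using closed_segment_subset[OF \<zeta>\<xi> convex_ball] linepath_in_path[OF that] by blast
    have "z \<circ> ?h C1_differentiable_on {0..1}"
      unfolding C1_differentiable_on_def
    proof (intro exI conjI ballI)
      fix t :: real assume t: "t \<in> {0..1}"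
      show "(z \<circ> ?h has_vector_derivative \<xi> - \<zeta>) (at t)"
      proof (rule has_vector_derivative_transform_within_open)
        show "(?l has_vector_derivative \<xi> - \<zeta>) (at t)" by (rule has_vector_derivative_linepath_within)
        show "open (?l -` ball (z a) r)" by (intro open_vimage continuous_intros open_ball)
        show "t \<in> ?l -` ball (z a) r" using l[OF t] by simp
        show "?l s = (z \<circ> ?h) s" if "s \<in> ?l -` ball (z a) r" for s
          using that r(2) c(6)[of "?l s"] by auto
      qed
    qed auto
    then have valid: "valid_path (z \<circ> ?h)" by (simp add: valid_path_def C1_differentiable_imp_piecewise)
    have "inv_into U z (?l t) \<in> U" if "t \<in> {0..1}" for t using l[OF that] r(2) c(7) by blast
    then have "path_image ?h \<subseteq> U" by (auto simp: path_image_def)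
    from has_form_integral.in_chart[OF U(1) this valid, of \<phi>]
    show ?thesis by (intro exI conjI) (simp_all add: pathstart_compose pathfinish_compose)
  qed
  then show "\<exists>T. openin (top_of_set Y) T \<and> a \<in> T \<and> (\<forall>x\<in>T. \<forall>y\<in>T. True \<and> True \<longrightarrow>
      (\<exists>h I. pathstart h = x \<and> pathfinish h = y \<and> has_form_integral B \<phi> h I))"
    using r(3,4) by (intro exI[of _ "inv_into U z ` ball (z a) r"]) auto
qed auto

lemma form_integral_eq:
  assumes Y: "complex_atlas Y B" "connected Y" and f: "primitive_on B \<phi> Y f" and y: "y \<in> Y" "y' \<in> Y"
  shows "form_integral B \<phi> y y' = f y' - f y"
  unfolding form_integral_def
proof (rule the_equality)
  have eq: "I = f y' - f y" if "\<exists>h. pathstart h = y \<and> pathfinish h = y' \<and> has_form_integral B \<phi> h I" for I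
    using that has_form_integral_primitive[OF Y(1) f] by blast
  obtain h I where "pathstart h = y" "pathfinish h = y'" "has_form_integral B \<phi> h I"
    using has_form_integral_exists[OF Y y, of \<phi>] by blast
  moreover from this eq have "I = f y' - f y" by blast
  ultimately show "\<exists>h. pathstart h = y \<and> pathfinish h = y' \<and> has_form_integral B \<phi> h (f y' - f y)" by blast
  show "I = f y' - f y" if "\<exists>h. pathstart h = y \<and> pathfinish h = y' \<and> has_form_integral B \<phi> h I" for I
    by (rule eq[OF that])
qed

section \<open>Equivariant maps whose monodromy factors through a free group\<close>

lemma mat_inner_eq_pairs: "mat_inner M N = (\<Sum>k\<in>UNIV. M $ fst k $ snd k * cnj (N $ fst k $ snd k))"
  by (simp add: mat_inner_eq sum.cartesian_product case_prod_unfold UNIV_Times_UNIV)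

context covering_surface
begin

text \<open>
  Both maps stay in the sheet through their common value, on which \<open>q\<close> is injective.
\<close>

lemma lifts_agree_near:
  assumes u: "continuous_on S u" "u \<in> S \<rightarrow> Y" and v: "continuous_on S v" "v \<in> S \<rightarrow> Y"
    and eq: "\<And>x. x \<in> S \<Longrightarrow> q (u x) = q (v x)" and x: "x \<in> S" "u x = v x"
  obtains M where "openin (top_of_set S) M" "x \<in> M" "M \<subseteq> S" "\<And>x'. x' \<in> M \<Longrightarrow> u x' = v x'"
proof -
  have ux: "u x \<in> Y" using u(2) x(1) by blast
  obtain T s where s: "sheet_section Y q X T s" "q (u x) \<in> T" "s (q (u x)) = u x" using section_through[OF ux] .
  note sec = sheet_section[OF s(1)]
  have "u x \<in> s ` T" using s(2,3) by (metis imageI)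
  then have "x \<in> (S \<inter> u -` s ` T) \<inter> (S \<inter> v -` s ` T)" using x by auto
  moreover have "openin (top_of_set S) ((S \<inter> u -` s ` T) \<inter> (S \<inter> v -` s ` T))"
    by (rule openin_Int[OF continuous_openin_preimage[OF u sec(2)] continuous_openin_preimage[OF v sec(2)]])
  moreover have "u x' = v x'" if "x' \<in> (S \<inter> u -` s ` T) \<inter> (S \<inter> v -` s ` T)" for x'
  proof -
    have "u x' \<in> s ` T" "v x' \<in> s ` T" "x' \<in> S" using that by auto
    then show ?thesis using sec(7)[of "u x'"] sec(7)[of "v x'"] eq[of x'] by metis
  qed
  ultimately show thesis using that[of "(S \<inter> u -` s ` T) \<inter> (S \<inter> v -` s ` T)"] by blast
qed

text \<open>
  Restricting the charts of \<open>X\<close> to sets over which the covering has a section allows a function on \<open>Y\<close> to be read in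
  each of them. This replaces the integration over a fundamental polygon in classical proofs of the bilinear relations.
\<close>

definition section_atlas :: "'a chart set" where
  "section_atlas = {(U, z). \<exists>U0 T s. (U0, z) \<in> A \<and> U \<subseteq> U0 \<and> openin (top_of_set X) U \<and> sheet_section Y q X T s \<and> U \<subseteq> T}"

lemma section_atlasE:
  assumes "(U, z) \<in> section_atlas"
  obtains U0 where "(U0, z) \<in> A" "U \<subseteq> U0" "openin (top_of_set X) U" "\<forall>\<zeta>\<in>z ` U. inv_into U z \<zeta> = inv_into U0 z \<zeta>"
proof -
  obtain U0 where U0: "(U0, z) \<in> A" "U \<subseteq> U0" "openin (top_of_set X) U" using assms unfolding section_atlas_def by blast
  have "inv_into U z \<zeta> = inv_into U0 z \<zeta>" if "\<zeta> \<in> z ` U" for \<zeta>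
  proof -
    obtain x where x: "x \<in> U" "\<zeta> = z x" using \<open>\<zeta> \<in> z ` U\<close> by blast
    then have "inv_into U0 z \<zeta> = x" using chart_inv(5)[OF atlas(1) U0(1)] U0(2) by blast
    moreover have "inv_into U z \<zeta> = x"
      using x inv_into_f_f[OF inj_on_subset[OF chart_inj[OF atlas(1) U0(1)] U0(2)]] by simp
    ultimately show ?thesis by simp
  qed
  then show thesis using that U0 by blast
qed

lemma complex_atlas_section_atlas: "complex_atlas X section_atlas"
  unfolding complex_atlas_def
proof (intro conjI ballI case_prodI2)
  show "(\<Union>(U, z)\<in>section_atlas. U) = X"
  proof
    show "(\<Union>(U, z)\<in>section_atlas. U) \<subseteq> X"
    proof
      fix x assume "x \<in> (\<Union>(U, z)\<in>section_atlas. U)"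
      then obtain U z where U: "(U, z) \<in> section_atlas" "x \<in> U" by blast
      obtain U0 where "(U0, z) \<in> A" "U \<subseteq> U0" "openin (top_of_set X) U" "\<forall>\<zeta>\<in>z ` U. inv_into U z \<zeta> = inv_into U0 z \<zeta>"
        using section_atlasE[OF U(1)] .
      then show "x \<in> X" using openin_subset U(2) by fastforce
    qed
    show "X \<subseteq> (\<Union>(U, z)\<in>section_atlas. U)"
    proof
      fix x assume x: "x \<in> X"
      then obtain y where y: "y \<in> Y" "q y = x" using q(2) by blast
      obtain T s where s: "sheet_section Y q X T s" "q y \<in> T" using section_through[OF y(1)] .
      obtain U z where U: "(U, z) \<in> A" "x \<in> U" using chart_exists[OF atlas(1) x] by blast
      have "openin (top_of_set X) (U \<inter> T)" using chart_inv(1)[OF atlas(1) U(1)] sheet_section(1)[OF s(1)] by (rule openin_Int)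
      then have "(U \<inter> T, z) \<in> section_atlas" unfolding section_atlas_def using U(1) s(1) by blast
      then show "x \<in> (\<Union>(U, z)\<in>section_atlas. U)" using U(2) s(2) y(2) by blast
    qed
  qed
next
  fix \<alpha> U z assume "\<alpha> \<in> section_atlas" "\<alpha> = (U, z)"
  then have U: "(U, z) \<in> section_atlas" by simp
  obtain U0 where U0: "(U0, z) \<in> A" "U \<subseteq> U0" "openin (top_of_set X) U" "\<forall>\<zeta>\<in>z ` U. inv_into U z \<zeta> = inv_into U0 z \<zeta>"
    using section_atlasE[OF U] .
  note c = chart_inv[OF atlas(1) U0(1)]
  show "openin (top_of_set X) U" by (rule U0(3))
  show "open (z ` U)" by (rule chart_open_image[OF atlas(1) U0(1,3,2)])
  have zU: "z ` U \<subseteq> z ` U0" using U0(2) by blast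
  have inj: "inj_on z U" using inj_on_subset[OF chart_inj[OF atlas(1) U0(1)] U0(2)] .
  show "homeomorphism U (z ` U) z (inv_into U z)"
  proof (rule homeomorphismI)
    show "continuous_on U z" using continuous_on_subset[OF c(3) U0(2)] .
    show "continuous_on (z ` U) (inv_into U z)"
      by (rule continuous_on_eq[OF continuous_on_subset[OF c(4) zU]]) (metis U0(4))
  qed (use inj in auto)
next
  fix \<alpha> \<beta> U z V w assume "\<alpha> \<in> section_atlas" "\<alpha> = (U, z)" "\<beta> \<in> section_atlas" "\<beta> = (V, w)"
  then have U: "(U, z) \<in> section_atlas" and V: "(V, w) \<in> section_atlas" by simp_all
  obtain U0 where U0: "(U0, z) \<in> A" "U \<subseteq> U0" "openin (top_of_set X) U" "\<forall>\<zeta>\<in>z ` U. inv_into U z \<zeta> = inv_into U0 z \<zeta>"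
    using section_atlasE[OF U] .
  obtain V0 where V0: "(V0, w) \<in> A" "V \<subseteq> V0" "openin (top_of_set X) V" "\<forall>\<zeta>\<in>w ` V. inv_into V w \<zeta> = inv_into V0 w \<zeta>"
    using section_atlasE[OF V] .
  have "(w \<circ> inv_into U0 z) holomorphic_on z ` (U \<inter> V)"
    by (rule holomorphic_on_subset[OF chart_transition(2)[OF atlas(1) U0(1) V0(1)]]) (use U0(2) V0(2) in blast)
  then show "(w \<circ> inv_into U z) holomorphic_on z ` (U \<inter> V)"
  proof (rule holomorphic_transform)
    fix \<zeta> assume "\<zeta> \<in> z ` (U \<inter> V)"
    then have "\<zeta> \<in> z ` U" by blast
    then show "(w \<circ> inv_into U0 z) \<zeta> = (w \<circ> inv_into U z) \<zeta>" using bspec[OF U0(4)] by (metis comp_apply)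
  qed
qed

text \<open>
  Choose a section \<open>s\<^sub>\<alpha>\<close> of the covering over each chart of \<open>section_atlas\<close>. The maps \<open>f \<circ> s\<^sub>\<alpha>\<close> and \<open>f \<circ> s\<^sub>\<beta>\<close> differ on
  overlaps by the affine map of the locally constant \<open>g\<^sub>\<alpha>\<^sub>\<beta> \<in> \<pi>\<^sub>1\<close> that takes \<open>s\<^sub>\<alpha>\<close> to \<open>s\<^sub>\<beta>\<close>. As \<open>Ad (\<tau> w)\<close> is unitary,
  the forms \<open>\<langle>d(f \<circ> s\<^sub>\<alpha>), f \<circ> s\<^sub>\<alpha>\<rangle>\<close> then differ by the differential of \<open>h\<^sub>w \<circ> f \<circ> s\<^sub>\<alpha>\<close>, with \<open>h\<^sub>w\<close> as in
  \<open>hermitian_cocycle_splits\<close> and \<open>w = p g\<^sub>\<alpha>\<^sub>\<beta>\<close>. The constants \<open>K w\<close> turn these functions into a cocycle on \<open>X\<close>, and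
  \<open>locally_constant_of_exact_cocycle\<close> applies.
\<close>

theorem equivariant_map_constant:
  fixes p :: "(real \<Rightarrow> 'a) set \<Rightarrow> 'i word" and \<tau> e :: "'i word \<Rightarrow> complex^'n^'n" and f :: "'b \<Rightarrow> complex^'n^'n" and I :: "'i set"
    and y0 :: 'b
  defines "G \<equiv> fundamental_group X (q y0)" and "act \<equiv> deck_action Y q y0" and "F \<equiv> free_group I"
  assumes comp: "compact X" and y0: "y0 \<in> Y"
    and p: "\<And>C. C \<in> carrier G \<Longrightarrow> p C \<in> carrier F" "\<And>C D. C \<in> carrier G \<Longrightarrow> D \<in> carrier G \<Longrightarrow> p (C \<otimes>\<^bsub>G\<^esub> D) = p C \<otimes>\<^bsub>F\<^esub> p D"
    and \<tau>: "\<And>v w. v \<in> carrier F \<Longrightarrow> w \<in> carrier F \<Longrightarrow> \<tau> (v \<otimes>\<^bsub>F\<^esub> w) = \<tau> v ** \<tau> w"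
      "\<And>w. w \<in> carrier F \<Longrightarrow> \<tau> w \<in> carrier unitary_group"
    and e: "\<And>v w. v \<in> carrier F \<Longrightarrow> w \<in> carrier F \<Longrightarrow> e (v \<otimes>\<^bsub>F\<^esub> w) = e v + Ad (\<tau> v) (e w)"
    and hol: "\<And>V w y. (V, w) \<in> B \<Longrightarrow> y \<in> V \<Longrightarrow> \<exists>M. has_mat_derivative (\<lambda>\<zeta>. f (inv_into V w \<zeta>)) M (w y)"
    and equi: "\<And>C y. C \<in> carrier G \<Longrightarrow> y \<in> Y \<Longrightarrow> f (act C y) = Ad (\<tau> (p C)) (f y) + e (p C)"
    and y: "y \<in> Y" "y' \<in> Y"
  shows "f y = f y'"
proof -
  note A' = complex_atlas_section_atlas
  obtain K where K: "\<And>v w M. v \<in> carrier F \<Longrightarrow> w \<in> carrier F \<Longrightarrow>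
    mat_inner (Ad (\<tau> (v \<otimes>\<^bsub>F\<^esub> w)) M) (e (v \<otimes>\<^bsub>F\<^esub> w)) + K (v \<otimes>\<^bsub>F\<^esub> w) =
      (mat_inner (Ad (\<tau> w) M) (e w) + K w) + (mat_inner (Ad (\<tau> v) (Ad (\<tau> w) M + e w)) (e v) + K v)"
    using hermitian_cocycle_splits[of I \<tau> e, folded F_def, OF \<tau> e] by blast
  have "\<forall>\<alpha>. \<exists>s. \<alpha> \<in> section_atlas \<longrightarrow> (\<exists>T. sheet_section Y q X T s \<and> fst \<alpha> \<subseteq> T)"
    unfolding section_atlas_def by fastforce
  then obtain s where s: "\<And>\<alpha>. \<alpha> \<in> section_atlas \<Longrightarrow> \<exists>T. sheet_section Y q X T (s \<alpha>) \<and> fst \<alpha> \<subseteq> T" by metis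
  have sY: "s \<alpha> x \<in> Y" "q (s \<alpha> x) = x" if \<alpha>: "\<alpha> \<in> section_atlas" and x: "x \<in> fst \<alpha>" for \<alpha> x
  proof -
    obtain T where T: "sheet_section Y q X T (s \<alpha>)" "fst \<alpha> \<subseteq> T" using s[OF \<alpha>] by blast
    then show "s \<alpha> x \<in> Y" "q (s \<alpha> x) = x" using sheet_section(3,5)[OF T(1)] x by blast+
  qed
  have s_cont: "continuous_on (fst \<alpha>) (s \<alpha>)" if \<alpha>: "\<alpha> \<in> section_atlas" for \<alpha>
  proof -
    obtain T where T: "sheet_section Y q X T (s \<alpha>)" "fst \<alpha> \<subseteq> T" using s[OF \<alpha>] by blast
    show ?thesis by (rule continuous_on_subset[OF sheet_section(4)[OF T(1)] T(2)])
  qed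
  have deck: "act C \<in> deck_transformations Y q" if "C \<in> carrier G" for C
    using deck_action_path[OF that[unfolded G_def] y0] unfolding act_def by blast
  have fs: "\<exists>M. has_mat_derivative (\<lambda>\<zeta>. f (s (U, z) (inv_into U z \<zeta>))) M (z x)"
    if U: "(U, z) \<in> section_atlas" and x: "x \<in> U" for U z x
  proof -
    note c = chart_inv[OF A' U]
    obtain T where T: "sheet_section Y q X T (s (U, z))" "U \<subseteq> T" using s[OF U] by auto
    obtain U0 where U0: "(U0, z) \<in> A" "U \<subseteq> U0" "openin (top_of_set X) U" "\<forall>\<zeta>\<in>z ` U. inv_into U z \<zeta> = inv_into U0 z \<zeta>"
    using section_atlasE[OF U] .
    have sx: "s (U, z) x \<in> Y" using sY(1)[OF U] x by simp
    obtain V w where V: "(V, w) \<in> B" "s (U, z) x \<in> V" using chart_exists[OF atlas(2) sx] by blast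
    obtain M where M: "has_mat_derivative (\<lambda>\<zeta>. f (inv_into V w \<zeta>)) M (w (s (U, z) x))" using hol[OF V] by blast
    let ?h = "w \<circ> s (U, z) \<circ> inv_into U0 z" and ?O = "z ` (U0 \<inter> T \<inter> s (U, z) -` V)"
    note h = section_holomorphic[OF T(1) U0(1) V(1)]
    have zx: "z x \<in> ?O" using x U0(2) T(2) V(2) by blast
    have hzx: "?h (z x) = w (s (U, z) x)" using chart_inv(5)[OF atlas(1) U0(1)] x U0(2) by auto
    have "has_mat_derivative (\<lambda>\<zeta>. f (inv_into V w (?h \<zeta>))) (cscale (deriv ?h (z x)) M) (z x)"
      by (rule has_mat_derivative_compose[OF _ holomorphic_derivI[OF h(2,1) zx]]) (use M hzx in simp)
    then have "has_mat_derivative (\<lambda>\<zeta>. f (s (U, z) (inv_into U z \<zeta>))) (cscale (deriv ?h (z x)) M) (z x)"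
    proof (rule has_mat_derivative_transform)
      show "open (?O \<inter> z ` U)" using h(1) c(2) by (rule open_Int)
      show "z x \<in> ?O \<inter> z ` U" using zx x by blast
      fix \<zeta> assume \<zeta>: "\<zeta> \<in> ?O \<inter> z ` U"
      then obtain x' where x': "x' \<in> U0" "s (U, z) x' \<in> V" "\<zeta> = z x'" by blast
      have "inv_into U0 z \<zeta> = x'" using chart_inv(5)[OF atlas(1) U0(1) x'(1)] x'(3) by simp
      moreover have "inv_into V w (w (s (U, z) x')) = s (U, z) x'" using chart_inv(5)[OF atlas(2) V(1) x'(2)] .
      moreover have "inv_into U z \<zeta> = inv_into U0 z \<zeta>" using bspec[OF U0(4), of \<zeta>] \<zeta> by blast
      ultimately show "f (inv_into V w (?h \<zeta>)) = f (s (U, z) (inv_into U z \<zeta>))" by (simp del: image_eqI)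
    qed
    then show ?thesis by blast
  qed
  \<comment> \<open>by freeness of the action, there is only one such class\<close>
  define g where "g \<alpha> \<beta> x = (SOME C. C \<in> carrier G \<and> act C (s \<alpha> x) = s \<beta> x)" for \<alpha> \<beta> x
  have g: "g \<alpha> \<beta> x \<in> carrier G" "act (g \<alpha> \<beta> x) (s \<alpha> x) = s \<beta> x"
    if "\<alpha> \<in> section_atlas" "\<beta> \<in> section_atlas" "x \<in> fst \<alpha>" "x \<in> fst \<beta>" for \<alpha> \<beta> x
  proof -
    note y = sY(1)[OF that(1,3)] sY(1)[OF that(2,4)]
    have "q (s \<alpha> x) = q (s \<beta> x)" using sY(2)[OF that(1,3)] sY(2)[OF that(2,4)] by simp
    from deck_action_transitive[OF y0 y this]
    obtain C where "C \<in> carrier G" "act C (s \<alpha> x) = s \<beta> x" unfolding G_def act_def .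
    then have "g \<alpha> \<beta> x \<in> carrier G \<and> act (g \<alpha> \<beta> x) (s \<alpha> x) = s \<beta> x" 
      unfolding g_def using someI[of "\<lambda>C. C \<in> carrier G \<and> act C (s \<alpha> x) = s \<beta> x" C] by blast
    then show "g \<alpha> \<beta> x \<in> carrier G" "act (g \<alpha> \<beta> x) (s \<alpha> x) = s \<beta> x" by simp_all
  qed
  have g_unique: "C = g \<alpha> \<beta> x"
    if "\<alpha> \<in> section_atlas" "\<beta> \<in> section_atlas" "x \<in> fst \<alpha>" "x \<in> fst \<beta>" "C \<in> carrier G" "act C (s \<alpha> x) = s \<beta> x" for \<alpha> \<beta> x C
    using deck_action_free[OF y0 that(5)[unfolded G_def] g(1)[OF that(1-4), unfolded G_def] sY(1)[OF that(1,3)]]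
      g(2)[OF that(1-4)] that(6) unfolding act_def by simp
  have fg: "f (s \<beta> x) = Ad (\<tau> (p (g \<alpha> \<beta> x))) (f (s \<alpha> x)) + e (p (g \<alpha> \<beta> x))"
    if "\<alpha> \<in> section_atlas" "\<beta> \<in> section_atlas" "x \<in> fst \<alpha>" "x \<in> fst \<beta>" for \<alpha> \<beta> x
    using equi[OF g(1)[OF that] sY(1)[OF that(1,3)]] g(2)[OF that] by simp
  have g_near: "\<exists>W. open (z ` W) \<and> x \<in> W \<and> W \<subseteq> U \<inter> V \<and> (\<forall>x'\<in>W. g (U, z) (V, w) x' = g (U, z) (V, w) x)"
    if U: "(U, z) \<in> section_atlas" and V: "(V, w) \<in> section_atlas" and x: "x \<in> U" "x \<in> V" for U z V w x
  proof -
    let ?C = "g (U, z) (V, w) x"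
    have C: "?C \<in> carrier G" "act ?C (s (U, z) x) = s (V, w) x" using g[OF U V] x by simp_all
    note d = deckD[OF deck[OF C(1)]]
    have sUV: "s (U, z) x' \<in> Y" "s (V, w) x' \<in> Y" "q (s (U, z) x') = x'" "q (s (V, w) x') = x'" if "x' \<in> U \<inter> V" for x'
      using sY[OF U] sY[OF V] that by simp_all
    have cu: "continuous_on (U \<inter> V) (s (U, z))" "continuous_on (U \<inter> V) (s (V, w))"
      using continuous_on_subset[OF s_cont[OF U]] continuous_on_subset[OF s_cont[OF V]] by auto
    have img: "s (U, z) ` (U \<inter> V) \<subseteq> Y" using sUV(1) by blast
    have ca: "continuous_on (U \<inter> V) (\<lambda>x'. act ?C (s (U, z) x'))"
      by (rule continuous_on_compose2[OF d(1) cu(1) img])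
    obtain W where W: "openin (top_of_set (U \<inter> V)) W" "x \<in> W" "W \<subseteq> U \<inter> V" "\<And>x'. x' \<in> W \<Longrightarrow> act ?C (s (U, z) x') = s (V, w) x'"
    proof (rule lifts_agree_near[OF ca _ cu(2)])
      show "(\<lambda>x'. act ?C (s (U, z) x')) \<in> U \<inter> V \<rightarrow> Y" "s (V, w) \<in> U \<inter> V \<rightarrow> Y" using sUV d(2) by blast+
      show "q (act ?C (s (U, z) x')) = q (s (V, w) x')" if "x' \<in> U \<inter> V" for x'
        using d(3)[OF sUV(1)[OF that]] sUV(3,4)[OF that] by simp
    qed (use x C in auto)
    have "openin (top_of_set X) (U \<inter> V)" using chart_inv(1)[OF A' U] chart_inv(1)[OF A' V] by (rule openin_Int)
    then have "openin (top_of_set X) W" using W(1) openin_trans by blast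
    then have "open (z ` W)" by (rule chart_open_image[OF A' U]) (use W(3) in blast)
    moreover have "g (U, z) (V, w) x' = ?C" if x': "x' \<in> W" for x'
      using g_unique[OF U V _ _ C(1) W(4)[OF x'], symmetric] W(3) x' by auto
    ultimately show ?thesis using W(2,3) by blast
  qed
  define H where "H \<alpha> \<beta> x = mat_inner (Ad (\<tau> (p (g \<alpha> \<beta> x))) (f (s \<alpha> x))) (e (p (g \<alpha> \<beta> x))) + K (p (g \<alpha> \<beta> x))" for \<alpha> \<beta> x
  have deriv: "((\<lambda>\<zeta>. H (U, z) (V, w) (inv_into U z \<zeta>)) has_field_derivative
        mat_inner (Ad (\<tau> (p (g (U, z) (V, w) x))) M) (e (p (g (U, z) (V, w) x)))) (at (z x)) \<and>
      has_mat_derivative (\<lambda>\<zeta>. f (s (V, w) (inv_into U z \<zeta>))) (Ad (\<tau> (p (g (U, z) (V, w) x))) M) (z x)"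
    if U: "(U, z) \<in> section_atlas" and V: "(V, w) \<in> section_atlas" and x: "x \<in> U" "x \<in> V"
      and M: "has_mat_derivative (\<lambda>\<zeta>. f (s (U, z) (inv_into U z \<zeta>))) M (z x)" for U z V w x M
  proof -
    let ?C = "g (U, z) (V, w) x"
    let ?A = "\<tau> (p ?C)" and ?E = "e (p ?C)"
    note c = chart_inv[OF A' U]
    obtain W where W: "open (z ` W)" "x \<in> W" "W \<subseteq> U \<inter> V" "\<forall>x'\<in>W. g (U, z) (V, w) x' = ?C"
      using g_near[OF U V x] by blast
    have zx: "z x \<in> z ` W" using W(2) by blast
    have inv: "inv_into U z \<zeta> \<in> W" if "\<zeta> \<in> z ` W" for \<zeta> using that c(5) W(3) by auto
    note 1 = has_mat_derivative_Ad[OF M, of ?A]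
    have "((\<lambda>\<zeta>. mat_inner (Ad ?A (f (s (U, z) (inv_into U z \<zeta>)))) ?E + K (p ?C)) has_field_derivative mat_inner (Ad ?A M) ?E + 0) (at (z x))"
      by (intro DERIV_add has_mat_derivative_mat_inner 1 DERIV_const)
    then have "((\<lambda>\<zeta>. mat_inner (Ad ?A (f (s (U, z) (inv_into U z \<zeta>)))) ?E + K (p ?C)) has_field_derivative mat_inner (Ad ?A M) ?E) (at (z x))"
      by simp
    then have "((\<lambda>\<zeta>. H (U, z) (V, w) (inv_into U z \<zeta>)) has_field_derivative mat_inner (Ad ?A M) ?E) (at (z x))"
      by (rule has_field_derivative_transform_within_open[OF _ W(1) zx]) (use W(4) inv in \<open>simp add: H_def\<close>)
    moreover have "has_mat_derivative (\<lambda>\<zeta>. Ad ?A (f (s (U, z) (inv_into U z \<zeta>))) + ?E) (Ad ?A M) (z x)"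
      using has_mat_derivative_add[OF 1 has_mat_derivative_const] by simp
    then have "has_mat_derivative (\<lambda>\<zeta>. f (s (V, w) (inv_into U z \<zeta>))) (Ad ?A M) (z x)"
    proof (rule has_mat_derivative_transform[OF _ W(1) zx])
      fix \<zeta> assume "\<zeta> \<in> z ` W"
      from inv[OF this] have \<zeta>W: "inv_into U z \<zeta> \<in> W" .
      then have "inv_into U z \<zeta> \<in> U" "inv_into U z \<zeta> \<in> V" using W(3) by blast+
      then show "Ad ?A (f (s (U, z) (inv_into U z \<zeta>))) + ?E = f (s (V, w) (inv_into U z \<zeta>))"
        using fg[OF U V, of "inv_into U z \<zeta>"] bspec[OF W(4) \<zeta>W] by simp
    qed
    ultimately show ?thesis by blast
  qed
  have crit: "\<exists>(U, z)\<in>section_atlas. x \<in> U \<and> (\<forall>k\<in>UNIV. deriv (\<lambda>\<zeta>. f (s (U, z) (inv_into U z \<zeta>)) $ fst k $ snd k) (z x) = 0)"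
    if x: "x \<in> X" for x
  proof (rule locally_constant_of_exact_cocycle[OF A' comp _ _ _ _ _ x, where f="\<lambda>\<alpha> k x. f (s \<alpha> x) $ fst k $ snd k" and H=H])
    show "finite (UNIV :: ('n \<times> 'n) set)" by simp
  next
    fix U z and k :: "'n \<times> 'n" assume U: "(U, z) \<in> section_atlas"
    show "(\<lambda>\<zeta>. f (s (U, z) (inv_into U z \<zeta>)) $ fst k $ snd k) holomorphic_on z ` U"
      unfolding holomorphic_on_def
    proof
      fix \<zeta> assume "\<zeta> \<in> z ` U"
      then obtain x where "x \<in> U" "\<zeta> = z x" by blast
      then have "(\<lambda>\<zeta>. f (s (U, z) (inv_into U z \<zeta>)) $ fst k $ snd k) field_differentiable at \<zeta>"
        using fs[OF U] unfolding has_mat_derivative_def field_differentiable_def by blast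
      then show "(\<lambda>\<zeta>. f (s (U, z) (inv_into U z \<zeta>)) $ fst k $ snd k) field_differentiable at \<zeta> within z ` U"
        by (rule field_differentiable_at_within)
    qed
  next
    fix U z V w assume U: "(U, z) \<in> section_atlas" and V: "(V, w) \<in> section_atlas"
    show "(\<lambda>\<zeta>. H (U, z) (V, w) (inv_into U z \<zeta>)) holomorphic_on z ` (U \<inter> V)"
      unfolding holomorphic_on_def
    proof
      fix \<zeta> assume "\<zeta> \<in> z ` (U \<inter> V)"
      then obtain x where x: "x \<in> U" "x \<in> V" "\<zeta> = z x" by blast
      obtain M where "has_mat_derivative (\<lambda>\<zeta>. f (s (U, z) (inv_into U z \<zeta>))) M (z x)" using fs[OF U x(1)] by blast
      then have "(\<lambda>\<zeta>. H (U, z) (V, w) (inv_into U z \<zeta>)) field_differentiable at \<zeta>"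
        using deriv[OF U V x(1,2)] x(3) unfolding field_differentiable_def by blast
      then show "(\<lambda>\<zeta>. H (U, z) (V, w) (inv_into U z \<zeta>)) field_differentiable at \<zeta> within z ` (U \<inter> V)"
        by (rule field_differentiable_at_within)
    qed
    fix x assume x: "x \<in> U" "x \<in> V"
    let ?C = "g (U, z) (V, w) x"
    let ?A = "\<tau> (p ?C)" and ?E = "e (p ?C)"
    have C: "?C \<in> carrier G" using g(1)[OF U V] x by simp
    obtain M where M: "has_mat_derivative (\<lambda>\<zeta>. f (s (U, z) (inv_into U z \<zeta>))) M (z x)" using fs[OF U x(1)] by blast
    note d = deriv[OF U V x M]
    have dU: "deriv (\<lambda>\<zeta>. f (s (U, z) (inv_into U z \<zeta>)) $ i $ j) (z x) = M $ i $ j" for i j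
      using M by (intro DERIV_imp_deriv) (simp add: has_mat_derivative_def)
    have dV: "deriv (\<lambda>\<zeta>. f (s (V, w) (inv_into U z \<zeta>)) $ i $ j) (z x) = Ad ?A M $ i $ j" for i j
      using d by (intro DERIV_imp_deriv) (simp add: has_mat_derivative_def)
    have "mat_inner (Ad ?A M) (f (s (V, w) x)) - mat_inner M (f (s (U, z) x)) = mat_inner (Ad ?A M) ?E"
      using fg[OF U V] x by (simp add: mat_inner_simps mat_inner_Ad_unitary[OF \<tau>(2)[OF p(1)[OF C]]])
    then show "deriv (\<lambda>\<zeta>. H (U, z) (V, w) (inv_into U z \<zeta>)) (z x) =
        (\<Sum>k\<in>UNIV. cnj (f (s (V, w) x) $ fst k $ snd k) * deriv (\<lambda>\<zeta>. f (s (V, w) (inv_into U z \<zeta>)) $ fst k $ snd k) (z x)) -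
        (\<Sum>k\<in>UNIV. cnj (f (s (U, z) x) $ fst k $ snd k) * deriv (\<lambda>\<zeta>. f (s (U, z) (inv_into U z \<zeta>)) $ fst k $ snd k) (z x))"
      using DERIV_imp_deriv[OF conjunct1[OF d]] by (simp add: dU dV mat_inner_eq_pairs mult.commute)
  next
    fix \<alpha> \<beta> \<gamma> x assume \<alpha>\<beta>\<gamma>: "\<alpha> \<in> section_atlas" "\<beta> \<in> section_atlas" "\<gamma> \<in> section_atlas" "x \<in> fst \<alpha>" "x \<in> fst \<beta>" "x \<in> fst \<gamma>"
    let ?C = "g \<alpha> \<beta> x" and ?D = "g \<beta> \<gamma> x"
    note C = g[OF \<alpha>\<beta>\<gamma>(1,2,4,5)] and D = g[OF \<alpha>\<beta>\<gamma>(2,3,5,6)]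
    have DC: "?D \<otimes>\<^bsub>G\<^esub> ?C \<in> carrier G"
      using fundamental_group_mult_closed D(1) C(1) unfolding G_def by blast
    have "act (?D \<otimes>\<^bsub>G\<^esub> ?C) (s \<alpha> x) = act ?D (act ?C (s \<alpha> x))"
      using deck_action_mult[OF y0 D(1)[unfolded G_def] C(1)[unfolded G_def] sY(1)[OF \<alpha>\<beta>\<gamma>(1,4)]] unfolding G_def act_def .
    then have "?D \<otimes>\<^bsub>G\<^esub> ?C = g \<alpha> \<gamma> x" using C(2) D(2) by (intro g_unique \<alpha>\<beta>\<gamma> DC) simp
    then have "p (g \<alpha> \<gamma> x) = p ?D \<otimes>\<^bsub>F\<^esub> p ?C" using p(2)[OF D(1) C(1)] by simp
    then show "H \<alpha> \<gamma> x = H \<alpha> \<beta> x + H \<beta> \<gamma> x"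
      using K[OF p(1)[OF D(1)] p(1)[OF C(1)], of "f (s \<alpha> x)"] fg[OF \<alpha>\<beta>\<gamma>(1,2,4,5)] by (simp add: H_def)
  qed
  show ?thesis
  proof (rule zero_derivative_constant[OF atlas(2) connected_Y _ y])
    fix V w v assume V: "(V, w) \<in> B" and v: "v \<in> V"
    note d = chart_inv[OF atlas(2) V]
    have vY: "v \<in> Y" using v d(8) by blast
    obtain U z where U: "(U, z) \<in> section_atlas" "q v \<in> U"
      and zero: "\<And>i j. deriv (\<lambda>\<zeta>. f (s (U, z) (inv_into U z \<zeta>)) $ i $ j) (z (q v)) = 0"
      using crit[OF q(3)[OF vY]] by fastforce
    note c = chart_inv[OF A' U(1)]
    obtain U0 where U0: "(U0, z) \<in> A" "U \<subseteq> U0" "openin (top_of_set X) U" "\<forall>\<zeta>\<in>z ` U. inv_into U z \<zeta> = inv_into U0 z \<zeta>"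
    using section_atlasE[OF U(1)] .
    obtain M where M: "has_mat_derivative (\<lambda>\<zeta>. f (s (U, z) (inv_into U z \<zeta>))) M (z (q v))" using fs[OF U] by blast
    have "M $ i $ j = 0" for i j
      using DERIV_imp_deriv[of "\<lambda>\<zeta>. f (s (U, z) (inv_into U z \<zeta>)) $ i $ j"] M zero[of i j] unfolding has_mat_derivative_def by metis
    then have "M = 0" by (simp add: vec_eq_iff)
    with M have M0: "has_mat_derivative (\<lambda>\<zeta>. f (s (U, z) (inv_into U z \<zeta>))) 0 (z (q v))" by simp
    have sv: "s (U, z) (q v) \<in> Y" "q (s (U, z) (q v)) = q v" using sY[OF U(1)] U(2) by simp_all
    obtain C where C: "C \<in> carrier G" "act C (s (U, z) (q v)) = v"
      using deck_action_transitive[OF y0 sv(1) vY sv(2)] unfolding G_def act_def by blast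
    note t = deckD[OF deck[OF C(1)]]
    have qX: "q \<in> Y \<rightarrow> X" using q(3) by blast
    let ?S = "V \<inter> (Y \<inter> q -` U)"
    have oS: "openin (top_of_set Y) ?S" by (rule openin_Int[OF d(1) continuous_openin_preimage[OF q(1) qX c(1)]])
    have sq: "s (U, z) (q v') \<in> Y" "q (s (U, z) (q v')) = q v'" if "v' \<in> ?S" for v' using sY[OF U(1)] that by simp_all
    have cont_q: "continuous_on ?S q" by (rule continuous_on_subset[OF q(1)]) blast
    have im1: "q ` ?S \<subseteq> U" by blast
    have cont_s: "continuous_on U (s (U, z))" using s_cont[OF U(1)] by simp
    have im2: "(\<lambda>v'. s (U, z) (q v')) ` ?S \<subseteq> Y" using sq(1) by blast
    have cont: "continuous_on ?S (\<lambda>v'. act C (s (U, z) (q v')))"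
      by (rule continuous_on_compose2[OF t(1) continuous_on_compose2[OF cont_s cont_q im1] im2])
    obtain W where W: "openin (top_of_set ?S) W" "v \<in> W" "W \<subseteq> ?S" "\<And>v'. v' \<in> W \<Longrightarrow> act C (s (U, z) (q v')) = v'"
    proof (rule lifts_agree_near[OF cont _ continuous_on_id])
      show "(\<lambda>v'. act C (s (U, z) (q v'))) \<in> ?S \<rightarrow> Y" "(\<lambda>v'. v') \<in> ?S \<rightarrow> Y" using sq(1) t(2) by blast+
      show "q (act C (s (U, z) (q v'))) = q v'" if "v' \<in> ?S" for v' using t(3)[OF sq(1)[OF that]] sq(2)[OF that] by simp
    qed (use v vY U(2) C(2) in auto)
    have "openin (top_of_set Y) W" using W(1) oS openin_trans by blast
    then have oW: "open (w ` W)" by (rule chart_open_image[OF atlas(2) V]) (use W(3) in blast)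
    have wv: "w v \<in> w ` W" using W(2) by blast
    let ?h = "z \<circ> q \<circ> inv_into V w"
    have "?h holomorphic_on w ` W" by (rule holomorphic_on_subset[OF q_holomorphic[OF V U0(1)]]) (use W(3) U0(2) in blast)
    then have dh: "(?h has_field_derivative deriv ?h (w v)) (at (w v))" by (rule holomorphic_derivI[OF _ oW wv])
    have "?h (w v) = z (q v)" using d(5)[OF v] by simp
    then have "has_mat_derivative (\<lambda>\<zeta>. f (s (U, z) (inv_into U z (?h \<zeta>)))) (cscale (deriv ?h (w v)) 0) (w v)"
      by (intro has_mat_derivative_compose[OF _ dh]) (use M0 in simp)
    from has_mat_derivative_add[OF has_mat_derivative_Ad[OF this, of "\<tau> (p C)"] has_mat_derivative_const[of "e (p C)"]]
    have "has_mat_derivative (\<lambda>\<zeta>. Ad (\<tau> (p C)) (f (s (U, z) (inv_into U z (?h \<zeta>)))) + e (p C)) (Ad (\<tau> (p C)) (cscale (deriv ?h (w v)) 0) + 0) (w v)" .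
    moreover have "cscale (deriv ?h (w v)) 0 = (0 :: complex^'n^'n)" by (simp add: vec_eq_iff)
    ultimately have "has_mat_derivative (\<lambda>\<zeta>. Ad (\<tau> (p C)) (f (s (U, z) (inv_into U z (?h \<zeta>)))) + e (p C)) 0 (w v)"
      by (simp add: Ad_simps)
    then show "has_mat_derivative (\<lambda>\<zeta>. f (inv_into V w \<zeta>)) 0 (w v)"
    proof (rule has_mat_derivative_transform[OF _ oW wv])
      fix \<zeta> assume "\<zeta> \<in> w ` W"
      then obtain v' where v': "v' \<in> W" "\<zeta> = w v'" by blast
      then have "v' \<in> V" "q v' \<in> U" using W(3) by blast+
      then have "inv_into V w \<zeta> = v'" "inv_into U z (?h \<zeta>) = q v'" using d(5) c(5) v'(2) by simp_all
      moreover have "f v' = Ad (\<tau> (p C)) (f (s (U, z) (q v'))) + e (p C)"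
        using equi[OF C(1) sq(1)] W(3,4) v'(1) by force
      ultimately show "Ad (\<tau> (p C)) (f (s (U, z) (inv_into U z (?h \<zeta>)))) + e (p C) = f (inv_into V w \<zeta>)" by simp
    qed
  qed
qed

end

section \<open>The period map of a representation that factors through a free group\<close>

lemma Ad_matrix_mult:
  assumes "invertible T" shows "Ad T (M ** N) = Ad T M ** Ad T N"
proof -
  have "Ad T M ** Ad T N = T ** M ** (matrix_inv T ** T) ** N ** matrix_inv T"
    by (simp only: Ad_def matrix_mul_assoc)
  then show ?thesis by (simp add: matrix_inv_inverse[OF assms] Ad_def matrix_mul_assoc)
qed

lemma Ad_one: "invertible T \<Longrightarrow> Ad T (mat 1) = mat 1"
  by (simp add: Ad_def matrix_inv_inverse)

lemma Ad_matrix_inv: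
  assumes "invertible T"
  shows "invertible (matrix_inv T)" "matrix_inv (matrix_inv T) = T"
    "Ad (matrix_inv T) (Ad T M) = M" "Ad T (Ad (matrix_inv T) M) = M"
proof -
  note i = matrix_inv_inverse[OF assms]
  show inv: "invertible (matrix_inv T)" using i unfolding invertible_def by blast
  show "matrix_inv (matrix_inv T) = T" using i by (intro matrix_inv_eqI)
  show "Ad (matrix_inv T) (Ad T M) = M" "Ad T (Ad (matrix_inv T) M) = M"
    using Ad_mult[OF inv assms] Ad_mult[OF assms inv] i by (metis Ad_mat_1)+
qed

text \<open>
  Conjugation by \<open>S\<close> intertwines the adjoint action of \<open>T\<close> with that of its conjugate; it passes from \<open>\<rho>\<close> to an equivalent
  unitary representation.
\<close>

lemma Ad_Ad:
  assumes "invertible S" "invertible T"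
  shows "Ad S (Ad T M) = Ad (Ad S T) (Ad S M)"
proof -
  note i = Ad_matrix_inv[OF assms(1)]
  have "invertible (S ** T)" using assms by (rule invertible_mult)
  then have "invertible (Ad S T)" unfolding Ad_def using i(1) by (rule invertible_mult)
  then have "Ad (Ad S T) (Ad S M) = Ad (Ad S T ** S) M" using Ad_mult assms(1) by metis
  also have "Ad S T ** S = S ** T ** (matrix_inv S ** S)" by (simp only: Ad_def matrix_mul_assoc)
  also have "\<dots> = S ** T" using matrix_inv_inverse(2)[OF assms(1)] by simp
  finally show ?thesis using Ad_mult[OF assms] by simp
qed

lemma hom_GL_D:
  assumes "\<rho> \<in> hom G GL"
  shows "x \<in> carrier G \<Longrightarrow> invertible (\<rho> x)" "x \<in> carrier G \<Longrightarrow> y \<in> carrier G \<Longrightarrow> \<rho> (x \<otimes>\<^bsub>G\<^esub> y) = \<rho> x ** \<rho> y"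
  using assms by (auto simp: hom_def GL_def)

lemma cohomologousD:
  assumes "(c, d) \<in> cohomologous G \<rho>"
  shows "c \<in> cocycles G \<rho>" "d \<in> cocycles G \<rho>" "\<exists>M. \<forall>x\<in>carrier G. c x - d x = Ad (\<rho> x) M - M"
proof -
  show "c \<in> cocycles G \<rho>" "d \<in> cocycles G \<rho>" using assms by (auto simp: cohomologous_def)
  from assms obtain M where M: "(\<lambda>x\<in>carrier G. c x - d x) = (\<lambda>x\<in>carrier G. Ad (\<rho> x) M - M)"
    unfolding cohomologous_def coboundaries_def by blast
  have "c x - d x = Ad (\<rho> x) M - M" if "x \<in> carrier G" for x using fun_cong[OF M, of x] that by simp
  then show "\<exists>M. \<forall>x\<in>carrier G. c x - d x = Ad (\<rho> x) M - M" by blast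
qed

lemma cohomologousI:
  assumes "c \<in> cocycles G \<rho>" "d \<in> cocycles G \<rho>" "\<And>x. x \<in> carrier G \<Longrightarrow> c x - d x = Ad (\<rho> x) M - M"
  shows "(c, d) \<in> cohomologous G \<rho>"
proof -
  have "(\<lambda>x\<in>carrier G. c x - d x) = (\<lambda>x\<in>carrier G. Ad (\<rho> x) M - M)" using assms(3) by (rule restrict_ext)
  then show ?thesis using assms(1,2) unfolding cohomologous_def coboundaries_def by blast
qed

lemma equiv_cohomologous: "equiv (cocycles G \<rho>) (cohomologous G \<rho>)"
proof (rule equivI)
  show "cohomologous G \<rho> \<subseteq> cocycles G \<rho> \<times> cocycles G \<rho>" by (auto simp: cohomologous_def)
  show "refl_on (cocycles G \<rho>) (cohomologous G \<rho>)"
  proof (rule refl_onI)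
    show "(c, c) \<in> cohomologous G \<rho>" if "c \<in> cocycles G \<rho>" for c
      by (rule cohomologousI[OF that that, where M=0]) (simp add: Ad_simps)
  qed
  show "sym (cohomologous G \<rho>)"
  proof (rule symI)
    fix c d assume cd: "(c, d) \<in> cohomologous G \<rho>"
    note h = cohomologousD[OF cd]
    obtain M where M: "\<forall>x\<in>carrier G. c x - d x = Ad (\<rho> x) M - M" using h(3) by blast
    have "d x - c x = Ad (\<rho> x) (- M) - (- M)" if "x \<in> carrier G" for x
      using bspec[OF M that] Ad_simps(2)[of "\<rho> x" 0 M] by (simp add: Ad_simps(3) algebra_simps)
    then show "(d, c) \<in> cohomologous G \<rho>" by (rule cohomologousI[OF h(2,1)])
  qed
  show "trans (cohomologous G \<rho>)"
  proof (rule transI)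
    fix c d e assume cd: "(c, d) \<in> cohomologous G \<rho>" and de: "(d, e) \<in> cohomologous G \<rho>"
    note h = cohomologousD[OF cd] and k = cohomologousD[OF de]
    obtain M N where M: "\<forall>x\<in>carrier G. c x - d x = Ad (\<rho> x) M - M" and N: "\<forall>x\<in>carrier G. d x - e x = Ad (\<rho> x) N - N"
      using h(3) k(3) by blast
    have "c x - e x = Ad (\<rho> x) (M + N) - (M + N)" if "x \<in> carrier G" for x
    proof -
      have "c x - e x = (c x - d x) + (d x - e x)" by simp
      also have "\<dots> = (Ad (\<rho> x) M - M) + (Ad (\<rho> x) N - N)" using bspec[OF M that] bspec[OF N that] by simp
      finally show ?thesis by (simp add: Ad_simps)
    qed
    then show "(c, e) \<in> cohomologous G \<rho>" by (rule cohomologousI[OF h(1) k(2)])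
  qed
qed

lemma H1_class_eq: "(c, d) \<in> cohomologous G \<rho> \<Longrightarrow> H1_class G \<rho> c = H1_class G \<rho> d"
  unfolding H1_class_def by (rule equiv_class_eq[OF equiv_cohomologous])

lemma H1_class_refl: "c \<in> cocycles G \<rho> \<Longrightarrow> c \<in> H1_class G \<rho> c"
  unfolding H1_class_def by (rule equiv_class_self[OF equiv_cohomologous])

lemma cocycle_pullback:
  assumes closed: "\<And>x y. x \<in> carrier G \<Longrightarrow> y \<in> carrier G \<Longrightarrow> x \<otimes>\<^bsub>G\<^esub> y \<in> carrier G"
    and p: "p \<in> hom G F" and \<rho>: "\<And>x. x \<in> carrier G \<Longrightarrow> \<rho> x = \<sigma> (p x)"
    and c: "c \<in> cocycles F \<sigma>"
  shows "(\<lambda>x\<in>carrier G. c (p x)) \<in> cocycles G \<rho>"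
proof -
  have "c (v \<otimes>\<^bsub>F\<^esub> w) = c v + Ad (\<sigma> v) (c w)" if "v \<in> carrier F" "w \<in> carrier F" for v w
    using c that unfolding cocycles_def by blast
  then show ?thesis using p closed \<rho> by (auto simp: cocycles_def hom_def Pi_iff)
qed

lemma cohomologous_pullback:
  assumes closed: "\<And>x y. x \<in> carrier G \<Longrightarrow> y \<in> carrier G \<Longrightarrow> x \<otimes>\<^bsub>G\<^esub> y \<in> carrier G"
    and p: "p \<in> hom G F" and \<rho>: "\<And>x. x \<in> carrier G \<Longrightarrow> \<rho> x = \<sigma> (p x)"
    and cd: "(c, d) \<in> cohomologous F \<sigma>"
  shows "(\<lambda>x\<in>carrier G. c (p x), \<lambda>x\<in>carrier G. d (p x)) \<in> cohomologous G \<rho>"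
proof -
  note h = cohomologousD[OF cd]
  obtain M where M: "\<forall>w\<in>carrier F. c w - d w = Ad (\<sigma> w) M - M" using h(3) by blast
  have pF: "p x \<in> carrier F" if "x \<in> carrier G" for x using p that by (auto simp: hom_def)
  show ?thesis
    by (rule cohomologousI[where M=M, OF cocycle_pullback[where F=F and \<sigma>=\<sigma>, OF closed p \<rho> h(1)] cocycle_pullback[where F=F and \<sigma>=\<sigma>, OF closed p \<rho> h(2)]])
      (use M pF \<rho> in auto)
qed

lemma H1_pullback_class:
  assumes closed: "\<And>x y. x \<in> carrier G \<Longrightarrow> y \<in> carrier G \<Longrightarrow> x \<otimes>\<^bsub>G\<^esub> y \<in> carrier G"
    and p: "p \<in> hom G F" and \<rho>: "\<And>x. x \<in> carrier G \<Longrightarrow> \<rho> x = \<sigma> (p x)"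
    and c: "c \<in> cocycles F \<sigma>"
  shows "H1_pullback G \<rho> p (H1_class F \<sigma> c) = H1_class G \<rho> (\<lambda>x\<in>carrier G. c (p x))"
proof -
  have "H1_class G \<rho> (\<lambda>x\<in>carrier G. d (p x)) = H1_class G \<rho> (\<lambda>x\<in>carrier G. c (p x))"
    if "d \<in> H1_class F \<sigma> c" for d
  proof -
    have "(c, d) \<in> cohomologous F \<sigma>" using that by (simp add: H1_class_def)
    then show ?thesis using H1_class_eq[OF cohomologous_pullback[where F=F and \<sigma>=\<sigma>, OF closed p \<rho>]] by metis
  qed
  then show ?thesis using H1_class_refl[OF c] unfolding H1_pullback_def by blast
qed

context covering_surface
begin

text \<open>
  Equivariance of \<open>\<phi>\<close> says that \<open>y \<mapsto> f(\<gamma> y) - Ad (\<rho> \<gamma>) (f y)\<close> has derivative zero.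
\<close>

lemma primitive_equivariant:
  fixes \<rho> :: "(real \<Rightarrow> 'a) set \<Rightarrow> complex^'n^'n" and y0 :: 'b
  defines "G \<equiv> fundamental_group X (q y0)" and "act \<equiv> deck_action Y q y0"
  assumes y0: "y0 \<in> Y" and \<phi>: "\<phi> \<in> equivariant_forms B G act \<rho>" and f: "primitive_on B \<phi> Y f"
    and x: "x \<in> carrier G" and y: "y \<in> Y" "y' \<in> Y"
  shows "f (act x y) - Ad (\<rho> x) (f y) = f (act x y') - Ad (\<rho> x) (f y')"
proof (rule zero_derivative_constant[OF atlas(2) connected_Y _ y])
  fix U z v assume U: "(U, z) \<in> B" and v: "v \<in> U"
  have deck: "act x \<in> deck_transformations Y q"
    using deck_action_path[OF x[unfolded G_def] y0] unfolding act_def by blast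
  note c = chart_inv[OF atlas(2) U] and t = deckD[OF deck]
  have vY: "v \<in> Y" using v c(8) by blast
  then have avY: "act x v \<in> Y" using t(2) by blast
  obtain V w where V: "(V, w) \<in> B" "act x v \<in> V" using chart_exists[OF atlas(2) avY] by blast
  let ?O = "z ` (U \<inter> act x -` V)" and ?h = "w \<circ> act x \<circ> inv_into U z"
  note h = deck_holomorphic[OF deck U V(1)]
  have zv: "z v \<in> ?O" using v V(2) by blast
  have hzv: "?h (z v) = w (act x v)" using c(5)[OF v] by simp
  have "has_mat_derivative (\<lambda>\<zeta>. f (inv_into V w \<zeta>)) (\<phi> (V, w) (act x v)) (?h (z v))"
    unfolding hzv by (rule primitive_onD[OF f V(1) avY V(2)])
  from has_mat_derivative_compose[OF this holomorphic_derivI[OF h(2,1) zv]]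
  have "has_mat_derivative (\<lambda>\<zeta>. f (inv_into V w (?h \<zeta>))) (cscale (deriv ?h (z v)) (\<phi> (V, w) (act x v))) (z v)" .
  moreover have "cscale (deriv ?h (z v)) (\<phi> (V, w) (act x v)) = Ad (\<rho> x) (\<phi> (U, z) v)"
    using \<phi> x U V v unfolding equivariant_forms_def by blast
  ultimately have "has_mat_derivative (\<lambda>\<zeta>. f (inv_into V w (?h \<zeta>))) (Ad (\<rho> x) (\<phi> (U, z) v)) (z v)" by simp
  then have "has_mat_derivative (\<lambda>\<zeta>. f (act x (inv_into U z \<zeta>))) (Ad (\<rho> x) (\<phi> (U, z) v)) (z v)"
  proof (rule has_mat_derivative_transform[OF _ h(1) zv])
    fix \<zeta> assume "\<zeta> \<in> ?O"
    then obtain u where u: "u \<in> U" "act x u \<in> V" "\<zeta> = z u" by blast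
    have "inv_into U z \<zeta> = u" using c(5)[OF u(1)] u(3) by simp
    then show "f (inv_into V w (?h \<zeta>)) = f (act x (inv_into U z \<zeta>))"
      using chart_inv(5)[OF atlas(2) V(1) u(2)] by simp
  qed
  from has_mat_derivative_diff[OF this has_mat_derivative_Ad[OF primitive_onD[OF f U vY v], of "\<rho> x"]]
  show "has_mat_derivative (\<lambda>\<zeta>. f (act x (inv_into U z \<zeta>)) - Ad (\<rho> x) (f (inv_into U z \<zeta>))) 0 (z v)" by simp
qed

lemma zero_form:
  fixes \<rho> :: "'g \<Rightarrow> complex^'n^'n"
  assumes y: "z0 \<in> Y" "\<And>x. x \<in> carrier G \<Longrightarrow> act x z0 \<in> Y"
  shows "(\<lambda>\<alpha> y. 0) \<in> equivariant_forms B G act \<rho>"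
    "period_map B G act z0 \<rho> (\<lambda>\<alpha> y. 0) = H1_class G \<rho> (\<lambda>x\<in>carrier G. 0)"
proof -
  have "cscale c 0 = (0 :: complex^'n^'n)" for c by (simp add: vec_eq_iff)
  then show "(\<lambda>\<alpha> y. 0) \<in> equivariant_forms B G act \<rho>"
    by (auto simp: equivariant_forms_def holomorphic_form_def Ad_simps)
  have "primitive_on B (\<lambda>\<alpha> y. 0 :: complex^'n^'n) Y (\<lambda>y. 0)"
    unfolding primitive_on_def using has_mat_derivative_const by blast
  from form_integral_eq[OF atlas(2) connected_Y this y(1)]
  have "(\<lambda>x\<in>carrier G. form_integral B (\<lambda>\<alpha> y. 0 :: complex^'n^'n) z0 (act x z0)) = (\<lambda>x\<in>carrier G. 0)"
    by (intro restrict_ext) (simp add: y(2))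
  then show "period_map B G act z0 \<rho> (\<lambda>\<alpha> y. 0) = H1_class G \<rho> (\<lambda>x\<in>carrier G. 0)"
    by (simp add: period_map_def)
qed

text \<open>
  The hypothesis on \<open>M\<close> says that the primitive \<open>f - f z0 + M\<close> of \<open>\<phi>\<close> has exactly the periods \<open>c (p \<gamma>)\<close>. After conjugation by
  \<open>T\<close>, which makes the representation unitary, it is constant by \<open>equivariant_map_constant\<close>. Unitarity on the image of
  \<open>p\<close> gives unitarity on all of \<open>F\<close>, because this image contains the generators.
\<close>

theorem form_integral_zero_of_free_period:
  fixes p :: "(real \<Rightarrow> 'a) set \<Rightarrow> 'i word" and \<sigma> :: "'i word \<Rightarrow> complex^'n^'n"
    and \<rho> :: "(real \<Rightarrow> 'a) set \<Rightarrow> complex^'n^'n" and I :: "'i set" and y0 z0 :: 'b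
  defines "G \<equiv> fundamental_group X (q y0)" and "act \<equiv> deck_action Y q y0" and "F \<equiv> free_group I"
  assumes comp: "compact X" and y0: "y0 \<in> Y" and z0: "z0 \<in> Y"
    and p: "p \<in> hom G F" and gens: "\<And>i. i \<in> I \<Longrightarrow> free_gen i \<in> p ` carrier G"
    and \<rho>: "\<And>x. x \<in> carrier G \<Longrightarrow> \<rho> x = \<sigma> (p x)" and \<sigma>: "\<sigma> \<in> hom F GL"
    and T: "invertible T" "\<And>x. x \<in> carrier G \<Longrightarrow> Ad (matrix_inv T) (\<rho> x) \<in> carrier unitary_group"
    and \<phi>: "\<phi> \<in> equivariant_forms B G act \<rho>" and c: "c \<in> cocycles F \<sigma>"
    and M: "\<And>x. x \<in> carrier G \<Longrightarrow> form_integral B \<phi> z0 (act x z0) - c (p x) = Ad (\<rho> x) M - M"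
    and y: "y \<in> Y"
  shows "form_integral B \<phi> z0 y = 0"
proof -
  have "holomorphic_form B \<phi>" using \<phi> by (simp add: equivariant_forms_def)
  then obtain f where f: "primitive_on B \<phi> Y f" using primitive_exists[OF atlas(2) simply_connected_Y _ y0] by blast
  note int = form_integral_eq[OF atlas(2) connected_Y f z0]
  have actY: "act x u \<in> Y" if "x \<in> carrier G" "u \<in> Y" for x u
    using deckD(2) deck_action_path[OF that(1)[unfolded G_def] y0] that(2) unfolding act_def by blast
  have pF: "p x \<in> carrier F" if "x \<in> carrier G" for x using p that by (auto simp: hom_def)
  have pm: "p (x \<otimes>\<^bsub>G\<^esub> x') = p x \<otimes>\<^bsub>F\<^esub> p x'" if "x \<in> carrier G" "x' \<in> carrier G" for x x'
    using p that by (auto simp: hom_def)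
  let ?S = "matrix_inv T"
  note S = Ad_matrix_inv[OF T(1)]
  note \<sigma>D = hom_GL_D[OF \<sigma>]
  define \<tau> where "\<tau> w = Ad ?S (\<sigma> w)" for w
  define e where "e w = Ad ?S (c w)" for w
  \<comment> \<open>the constants make the period of \<open>f'\<close> equal to \<open>e (p x)\<close>, without a coboundary\<close>
  define f' where "f' u = Ad ?S (f u - f z0 + M)" for u
  have \<tau>_mult: "\<tau> (v \<otimes>\<^bsub>F\<^esub> w) = \<tau> v ** \<tau> w" if "v \<in> carrier F" "w \<in> carrier F" for v w
    unfolding \<tau>_def \<sigma>D(2)[OF that] by (rule Ad_matrix_mult[OF S(1)])
  have nil: "[] \<in> carrier F" "[] \<otimes>\<^bsub>F\<^esub> [] = []" by (simp_all add: F_def free_group_simps)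
  \<comment> \<open>homomorphisms of \<^const>\<open>hom\<close> are not assumed to preserve the unit\<close>
  have "\<sigma> [] = \<sigma> [] ** \<sigma> []" using \<sigma>D(2)[OF nil(1,1)] nil(2) by simp
  then have "matrix_inv (\<sigma> []) ** \<sigma> [] = matrix_inv (\<sigma> []) ** \<sigma> [] ** \<sigma> []" by (metis matrix_mul_assoc)
  then have "\<sigma> [] = mat 1" using matrix_inv_inverse(2)[OF \<sigma>D(1)[OF nil(1)]] by simp
  then have \<tau>_one: "\<tau> [] = mat 1" unfolding \<tau>_def by (simp add: Ad_one[OF S(1)])
  have \<tau>_unitary: "\<tau> w \<in> carrier unitary_group" if "w \<in> carrier F" for w
  proof (rule free_group_hom_unitary[of I \<tau>, folded F_def, OF \<tau>_mult \<tau>_one _ that])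
    fix i assume "i \<in> I"
    then obtain x where "x \<in> carrier G" "free_gen i = p x" using gens by blast
    then show "\<tau> (free_gen i) \<in> carrier unitary_group" using T(2) \<rho> unfolding \<tau>_def by simp
  qed
  have conj: "Ad ?S (Ad (\<sigma> w) N) = Ad (\<tau> w) (Ad ?S N)" if "w \<in> carrier F" for w N
    unfolding \<tau>_def by (rule Ad_Ad[OF S(1) \<sigma>D(1)[OF that]])
  have e_cocycle: "e (v \<otimes>\<^bsub>F\<^esub> w) = e v + Ad (\<tau> v) (e w)" if "v \<in> carrier F" "w \<in> carrier F" for v w
  proof -
    have "c (v \<otimes>\<^bsub>F\<^esub> w) = c v + Ad (\<sigma> v) (c w)" using c that unfolding cocycles_def by blast
    then show ?thesis unfolding e_def by (simp add: Ad_simps conj[OF that(1)])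
  qed
  have equi: "f' (act x u) = Ad (\<tau> (p x)) (f' u) + e (p x)" if x: "x \<in> carrier G" and u: "u \<in> Y" for x u
  proof -
    have "f (act x u) - Ad (\<rho> x) (f u) = f (act x z0) - Ad (\<rho> x) (f z0)"
      using primitive_equivariant[OF y0 \<phi>[unfolded G_def act_def] f x[unfolded G_def] u z0] unfolding act_def .
    moreover have "f (act x z0) - f z0 - c (p x) = Ad (\<rho> x) M - M"
      using M[OF x] int[OF actY[OF x z0]] by simp
    ultimately have "f (act x u) - f z0 + M = Ad (\<rho> x) (f u - f z0 + M) + c (p x)"
      by (simp add: Ad_simps algebra_simps)
    then show ?thesis unfolding f'_def e_def \<rho>[OF x] by (simp only: Ad_simps(1) conj[OF pF[OF x]])
  qed
  have hol: "\<exists>N. has_mat_derivative (\<lambda>\<zeta>. f' (inv_into V w \<zeta>)) N (w u)" if V: "(V, w) \<in> B" and u: "u \<in> V" for V w u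
  proof -
    have "u \<in> Y" using u chart_inv(8)[OF atlas(2) V] by blast
    note d = primitive_onD[OF f V this u]
    show ?thesis unfolding f'_def
      using has_mat_derivative_Ad[OF has_mat_derivative_add[OF has_mat_derivative_diff[OF d has_mat_derivative_const] has_mat_derivative_const]]
      by blast
  qed
  have "f' y = f' z0"
    by (rule equivariant_map_constant[where p=p and \<tau>=\<tau> and e=e and I=I and ?y0.0=y0, folded G_def act_def F_def,
          OF comp y0 pF pm \<tau>_mult \<tau>_unitary e_cocycle hol equi y z0])
  then have "Ad T (f' y) = Ad T (f' z0)" by simp
  then show ?thesis unfolding f'_def S(4) using int[OF y] by simp
qed

end

theorem proposition6:
  fixes X :: "'a::t2_space set" and A :: "'a chart set" and g :: nat
    and Y :: "'b::t2_space set" and B :: "'b chart set" and q :: "'b \<Rightarrow> 'a" and y0 z0 :: 'b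
    and a b :: "nat \<Rightarrow> (real \<Rightarrow> 'a) set"
    and p :: "(real \<Rightarrow> 'a) set \<Rightarrow> nat word"
    and \<rho> :: "(real \<Rightarrow> 'a) set \<Rightarrow> complex^'n^'n"
    and \<sigma> :: "nat word \<Rightarrow> complex^'n^'n"
  defines "\<pi>\<^sub>1 \<equiv> fundamental_group X (q y0)"
    and "act \<equiv> deck_action Y q y0"
    and "F \<equiv> free_group {..<g}"
  assumes "riemann_surface X A" and "compact X" and "has_genus X g"
    and "universal_cover Y B q X A" and "y0 \<in> Y" and "z0 \<in> Y"
    and "canonical_basis \<pi>\<^sub>1 g a b"
    and "p \<in> hom \<pi>\<^sub>1 F"
    and "\<And>i. i < g \<Longrightarrow> p (a i) = \<one>\<^bsub>F\<^esub>" and "\<And>i. i < g \<Longrightarrow> p (b i) = free_gen i"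
    and "\<rho> \<in> hom \<pi>\<^sub>1 GL"
    and "rep_class \<pi>\<^sub>1 \<rho> \<in> schottky_reps \<pi>\<^sub>1 F p \<inter> unitary_reps \<pi>\<^sub>1"
    and "\<sigma> \<in> hom F GL" and "\<And>x. x \<in> carrier \<pi>\<^sub>1 \<Longrightarrow> \<rho> x = \<sigma> (p x)"
  shows "H1_pullback \<pi>\<^sub>1 \<rho> p ` H1 F \<sigma> \<inter>
         period_map B \<pi>\<^sub>1 act z0 \<rho> ` equivariant_forms B \<pi>\<^sub>1 act \<rho> =
         {H1_class \<pi>\<^sub>1 \<rho> (\<lambda>x\<in>carrier \<pi>\<^sub>1. 0)}"
proof -
  interpret covering_surface X A Y B q
    using assms by unfold_locales
  note y0 = \<open>y0 \<in> Y\<close> and z0 = \<open>z0 \<in> Y\<close> and p = \<open>p \<in> hom \<pi>\<^sub>1 F\<close> and \<sigma> = \<open>\<sigma> \<in> hom F GL\<close>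
  note \<rho> = \<open>\<And>x. x \<in> carrier \<pi>\<^sub>1 \<Longrightarrow> \<rho> x = \<sigma> (p x)\<close>
  have closed: "x \<otimes>\<^bsub>\<pi>\<^sub>1\<^esub> x' \<in> carrier \<pi>\<^sub>1" if "x \<in> carrier \<pi>\<^sub>1" "x' \<in> carrier \<pi>\<^sub>1" for x x'
    using fundamental_group_mult_closed that unfolding \<pi>\<^sub>1_def by blast
  have actY: "act x z0 \<in> Y" if "x \<in> carrier \<pi>\<^sub>1" for x
    using deckD(2) deck_action_path[OF that[unfolded \<pi>\<^sub>1_def] y0] z0 unfolding act_def by blast
  have pullback: "H1_pullback \<pi>\<^sub>1 \<rho> p (H1_class F \<sigma> c) = H1_class \<pi>\<^sub>1 \<rho> (\<lambda>x\<in>carrier \<pi>\<^sub>1. c (p x))"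
    if "c \<in> cocycles F \<sigma>" for c
    by (rule H1_pullback_class[where F=F and \<sigma>=\<sigma>, OF closed p \<rho> that])
  have gens: "free_gen i \<in> p ` carrier \<pi>\<^sub>1" if "i \<in> {..<g}" for i
  proof -
    have "b i \<in> carrier \<pi>\<^sub>1" using \<open>canonical_basis \<pi>\<^sub>1 g a b\<close> that unfolding canonical_basis_def by blast
    moreover have "p (b i) = free_gen i" using assms that by simp
    ultimately show ?thesis by (metis imageI)
  qed
  have "\<rho> \<in> rep_class \<pi>\<^sub>1 \<rho>"
    using \<open>\<rho> \<in> hom \<pi>\<^sub>1 GL\<close> unfolding rep_class_def by (auto intro!: exI[of _ "mat 1"] simp: invertible_def)
  moreover obtain \<rho>' where \<rho>': "\<rho>' \<in> hom \<pi>\<^sub>1 unitary_group" "rep_class \<pi>\<^sub>1 \<rho> = rep_class \<pi>\<^sub>1 \<rho>'"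
    using \<open>rep_class \<pi>\<^sub>1 \<rho> \<in> schottky_reps \<pi>\<^sub>1 F p \<inter> unitary_reps \<pi>\<^sub>1\<close> unfolding unitary_reps_def by blast
  ultimately obtain T where T: "invertible T" "\<And>x. x \<in> carrier \<pi>\<^sub>1 \<Longrightarrow> \<rho> x = Ad T (\<rho>' x)"
    unfolding rep_class_def by blast
  have unitary: "Ad (matrix_inv T) (\<rho> x) \<in> carrier unitary_group" if "x \<in> carrier \<pi>\<^sub>1" for x
    using \<rho>'(1) that T(2)[OF that] Ad_matrix_inv(3)[OF T(1)] by (auto simp: hom_def)
  show ?thesis
  proof
    show "H1_pullback \<pi>\<^sub>1 \<rho> p ` H1 F \<sigma> \<inter> period_map B \<pi>\<^sub>1 act z0 \<rho> ` equivariant_forms B \<pi>\<^sub>1 act \<rho> \<subseteq>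
      {H1_class \<pi>\<^sub>1 \<rho> (\<lambda>x\<in>carrier \<pi>\<^sub>1. 0)}"
    proof
      fix C assume C: "C \<in> H1_pullback \<pi>\<^sub>1 \<rho> p ` H1 F \<sigma> \<inter> period_map B \<pi>\<^sub>1 act z0 \<rho> ` equivariant_forms B \<pi>\<^sub>1 act \<rho>"
      then obtain c where c: "c \<in> cocycles F \<sigma>" "C = H1_pullback \<pi>\<^sub>1 \<rho> p (H1_class F \<sigma> c)"
        unfolding H1_def H1_class_def by (auto elim!: quotientE)
      obtain \<phi> where \<phi>: "\<phi> \<in> equivariant_forms B \<pi>\<^sub>1 act \<rho>" "C = period_map B \<pi>\<^sub>1 act z0 \<rho> \<phi>" using C by blast
      let ?per = "\<lambda>x\<in>carrier \<pi>\<^sub>1. form_integral B \<phi> z0 (act x z0)"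
      have cp: "(\<lambda>x\<in>carrier \<pi>\<^sub>1. c (p x)) \<in> cocycles \<pi>\<^sub>1 \<rho>"
        by (rule cocycle_pullback[where F=F and \<sigma>=\<sigma>, OF closed p \<rho> c(1)])
      have "(\<lambda>x\<in>carrier \<pi>\<^sub>1. c (p x)) \<in> H1_class \<pi>\<^sub>1 \<rho> ?per"
        using H1_class_refl[OF cp] pullback[OF c(1)] c(2) \<phi>(2) unfolding period_map_def by simp
      then have "(?per, \<lambda>x\<in>carrier \<pi>\<^sub>1. c (p x)) \<in> cohomologous \<pi>\<^sub>1 \<rho>" by (simp add: H1_class_def)
      from cohomologousD(3)[OF this]
      obtain M where M: "\<And>x. x \<in> carrier \<pi>\<^sub>1 \<Longrightarrow> form_integral B \<phi> z0 (act x z0) - c (p x) = Ad (\<rho> x) M - M" by auto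
      have zero: "form_integral B \<phi> z0 y = 0" if "y \<in> Y" for y
        by (rule form_integral_zero_of_free_period[where \<rho>=\<rho> and I="{..<g}" and ?y0.0=y0, folded \<pi>\<^sub>1_def act_def F_def,
            OF \<open>compact X\<close> y0 z0 p gens \<rho> \<sigma> T(1) unitary \<phi>(1) c(1) M that])
      have "?per = (\<lambda>x\<in>carrier \<pi>\<^sub>1. 0)" by (rule restrict_ext) (rule zero[OF actY])
      then show "C \<in> {H1_class \<pi>\<^sub>1 \<rho> (\<lambda>x\<in>carrier \<pi>\<^sub>1. 0)}" using \<phi>(2) by (simp add: period_map_def)
    qed
  next
    let ?z = "(\<lambda>w\<in>carrier F. 0) :: nat word \<Rightarrow> complex^'n^'n"
    have "v \<otimes>\<^bsub>F\<^esub> w \<in> carrier F" if "v \<in> carrier F" "w \<in> carrier F" for v w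
      using free_group_mult_closed that unfolding F_def by blast
    then have z: "?z \<in> cocycles F \<sigma>" by (auto simp: cocycles_def Ad_simps)
    have "(\<lambda>x\<in>carrier \<pi>\<^sub>1. ?z (p x)) = (\<lambda>x\<in>carrier \<pi>\<^sub>1. 0)"
      using p by (intro restrict_ext) (auto simp: hom_def)
    then have "H1_pullback \<pi>\<^sub>1 \<rho> p (H1_class F \<sigma> ?z) = H1_class \<pi>\<^sub>1 \<rho> (\<lambda>x\<in>carrier \<pi>\<^sub>1. 0)"
      using pullback[OF z] by simp
    moreover have "H1_class F \<sigma> ?z \<in> H1 F \<sigma>" unfolding H1_def H1_class_def by (rule quotientI[OF z])
    ultimately have "H1_class \<pi>\<^sub>1 \<rho> (\<lambda>x\<in>carrier \<pi>\<^sub>1. 0) \<in> H1_pullback \<pi>\<^sub>1 \<rho> p ` H1 F \<sigma>" by (metis imageI)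
    moreover have "H1_class \<pi>\<^sub>1 \<rho> (\<lambda>x\<in>carrier \<pi>\<^sub>1. 0) \<in> period_map B \<pi>\<^sub>1 act z0 \<rho> ` equivariant_forms B \<pi>\<^sub>1 act \<rho>"
      using zero_form[where G=\<pi>\<^sub>1 and act=act and \<rho>=\<rho>, OF z0 actY] by (metis imageI)
    ultimately show "{H1_class \<pi>\<^sub>1 \<rho> (\<lambda>x\<in>carrier \<pi>\<^sub>1. 0)} \<subseteq>
        H1_pullback \<pi>\<^sub>1 \<rho> p ` H1 F \<sigma> \<inter> period_map B \<pi>\<^sub>1 act z0 \<rho> ` equivariant_forms B \<pi>\<^sub>1 act \<rho>" by blast
  qed
qed

end
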